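(* Let $n\ge 1$, let $D=B(0,r_0)\subset\mathbb{R}^n$ be an open ball centered at $0$, and let $f$ be a convex $C^2$ function on a neighborhood of the closed ball $\bar D$ with $f(0)=0$ and $\nabla f(0)=0$. Let $\phi:\mathbb{R}^n\to\mathbb{R}$ be a $C^1$ function supported in $D$. Let $g_1,\dots,g_q$ be finitely many real analytic functions defined on a neighborhood of $\bar D$, none identically zero. Then there is a constant $C$, depending only on $\phi$, $f$ and the $g_i$, such that for every $v=(v_1,\dots,v_{n+1})\in\mathbb{R}^{n+1}$ with $|v|=1$ and $v_{n+1}\ge0$ and every real $t\ne0$, $$|I(tv)|\le C\,m\big(\{x\in S':\pi(x)\in\bar D,\ s(v)\le x\cdot v\le s(v)+|t|^{-1}\}\big)$$ $$\qquad+\,C\sum_{j=1}^{\infty}2^{-j}\,m\big(\{x\in S':\pi(x)\in\bar D,\ s(v)+2^{j-1}|t|^{-1}\le x\cdot v\le s(v)+2^{j}|t|^{-1}\}\big).$$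
   Context: Here $S'\subset\mathbb{R}^{n+1}$ is the hypersurface which, over the neighborhood of $\bar D$ on which $f$ is defined, is the graph $x_{n+1}=f(x_1,\dots,x_n)$; only the portion of $S'$ above $\bar D$ matters. $\pi:\mathbb{R}^{n+1}\to\mathbb{R}^n$ is the projection onto the first $n$ coordinates, and $m$ is Euclidean surface measure ($n$-dimensional) on $S'$. For $\lambda=(\lambda_1,\dots,\lambda_{n+1})\in\mathbb{R}^{n+1}$, $$I(\lambda)=\int_{\{x\in\mathbb{R}^n:\ g_i(x)<0\text{ for all }i\}}e^{-i\lambda_1x_1-\dots-i\lambda_nx_n-i\lambda_{n+1}f(x_1,\dots,x_n)}\,\phi(x_1,\dots,x_n)\,dx_1\cdots dx_n ,$$ where, since $\phi$ is supported in $D$, only points $x\in D$ contribute. For $v\in\mathbb{R}^{n+1}$ with $|v|=1$ and $v_{n+1}\ge0$, $$s(v)=\min\{x\cdot v : x\in S',\ \pi(x)\in\bar D\}.$$ *)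

theory Defs
  imports "HOL-Analysis.Analysis"
begin

text \<open>
  \<open>\<real>\<^sup>n\<close> is \<open>real ^ 'n\<close> and \<open>\<real>\<^sup>n\<^sup>+\<^sup>1\<close> is \<open>(real ^ 'n) \<times> real\<close>, whose library norm and inner
  product are the Euclidean ones; the projection \<open>\<pi>\<close> is \<^term>\<open>fst\<close> and the last coordinate
  is \<^term>\<open>snd\<close>. Functions on a neighborhood \<open>U\<close> are total functions of which only
  the values on \<open>U\<close> matter.
\<close>

definition C1_on :: "'a::real_normed_vector set \<Rightarrow> ('a \<Rightarrow> 'b::real_normed_vector) \<Rightarrow> bool" where
  "C1_on U f \<longleftrightarrow>
     (\<exists>f' :: 'a \<Rightarrow> 'a \<Rightarrow>\<^sub>L 'b.
        (\<forall>x\<in>U. (f has_derivative blinfun_apply (f' x)) (at x)) \<and> continuous_on U f')"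

definition C2_on :: "'a::real_normed_vector set \<Rightarrow> ('a \<Rightarrow> 'b::real_normed_vector) \<Rightarrow> bool" where
  "C2_on U f \<longleftrightarrow>
     (\<exists>f' :: 'a \<Rightarrow> 'a \<Rightarrow>\<^sub>L 'b.
        (\<forall>x\<in>U. (f has_derivative blinfun_apply (f' x)) (at x)) \<and> C1_on U f')"

text \<open>Local expansion in a multi-index power series; \<open>has_sum\<close> is unconditional, hence
  absolute, convergence. To be used for open \<open>U\<close>.\<close>

definition real_analytic_on :: "(real ^ 'n) set \<Rightarrow> (real ^ 'n \<Rightarrow> real) \<Rightarrow> bool" where
  "real_analytic_on U g \<longleftrightarrow>
     (\<forall>a\<in>U. \<exists>c :: ('n \<Rightarrow> nat) \<Rightarrow> real. \<exists>e>0. \<forall>x\<in>ball a e.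
        ((\<lambda>\<alpha>. c \<alpha> * (\<Prod>i\<in>UNIV. (x $ i - a $ i) ^ \<alpha> i)) has_sum g x) UNIV)"

definition grad :: "('a::real_inner \<Rightarrow> real) \<Rightarrow> 'a \<Rightarrow> 'a" where
  "grad f x = (THE D. GDERIV f x :> D)"

definition graph_over :: "'a set \<Rightarrow> ('a \<Rightarrow> real) \<Rightarrow> ('a \<times> real) set" where
  "graph_over U f = {p. fst p \<in> U \<and> snd p = f (fst p)}"

text \<open>Euclidean surface measure on the graph of \<open>f\<close> over \<open>U\<close>, as a measure on the ambient
  space: the area element of a graph is \<open>sqrt (1 + |\<nabla>f|\<^sup>2) dx\<close>, pushed forward along
  \<open>x \<mapsto> (x, f x)\<close>.\<close>

definition surface_measure ::
    "(real ^ 'n) set \<Rightarrow> (real ^ 'n \<Rightarrow> real) \<Rightarrow> ((real ^ 'n) \<times> real) measure" where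
  "surface_measure U f =
     distr (density (restrict_space lborel U) (\<lambda>x. ennreal (sqrt (1 + (norm (grad f x))\<^sup>2))))
           borel (\<lambda>x. (x, f x))"

text \<open>The domain of integration is cut down to the ball \<open>D = ball 0 r\<close> containing the support
  of \<open>\<phi>\<close>, since \<open>f\<close> and the \<open>g i\<close> are only meaningful near the closure of \<open>D\<close>.\<close>

definition osc_integral ::
    "real \<Rightarrow> (real ^ 'n \<Rightarrow> real) \<Rightarrow> (real ^ 'n \<Rightarrow> real) \<Rightarrow> nat \<Rightarrow> (nat \<Rightarrow> real ^ 'n \<Rightarrow> real) \<Rightarrow>
     (real ^ 'n) \<times> real \<Rightarrow> complex" where
  "osc_integral r f \<phi> q g \<xi> =
     (LINT x:{x \<in> ball 0 r. \<forall>i\<in>{1..q}. g i x < 0}|lborel.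
        exp (- \<i> * complex_of_real ((\<Sum>k\<in>UNIV. fst \<xi> $ k * x $ k) + snd \<xi> * f x))
          * complex_of_real (\<phi> x))"

definition min_dot :: "real \<Rightarrow> ((real ^ 'n) \<times> real) set \<Rightarrow> (real ^ 'n) \<times> real \<Rightarrow> real" where
  "min_dot r S v = (LEAST y. y \<in> {x \<bullet> v | x. x \<in> S \<and> fst x \<in> cball 0 r})"

end

theory Submission
  imports Defs "HOL-Computational_Algebra.Primes" "HOL-Library.Function_Algebras"
begin

text \<open>
  With \<open>F x = (x, f x) \<bullet> v\<close> convex and minimal on the closed ball at \<open>x0\<close>, the integral is averaged over
  the dilations centred at \<open>x0\<close> with ratio \<open>s \<in> [1/2, 1]\<close>; this replaces polar coordinates. On each
  segment \<open>s \<mapsto> x0 + s y\<close> convexity gives \<open>F' \<ge> F (x0 + y/2) - F x0\<close>, so van der Corput's first derivative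
  estimate bounds the inner integral by a constant times \<open>min 1 (1 / (|t| (F (x0 + y/2) - F x0)))\<close>, and
  integrating over \<open>y\<close> and decomposing dyadically in \<open>F - F x0\<close> gives the claim.

  This needs that the sets \<open>{g i < 0}\<close> cut every line into a bounded number of intervals. Locally
  \<open>g (a + p + \<tau> w) = (\<Sum>k. a_k(p, w) \<tau>^k)\<close> with \<open>a_k\<close> power series in \<open>(p, w)\<close>. Reducing with respect to
  finitely many elements whose leading monomials generate all leading monomials of the ideal
  \<open>(a_0, a_1, ...)\<close> shows \<open>|a_k(p, w)| \<le> C (|a_0(p, w)| + ... + |a_{N-1}(p, w)|)\<close> for all \<open>k\<close>, which by Rolle's theorem
  leaves at most \<open>N\<close> zeros in \<open>\<tau>\<close> unless all \<open>a_k(p, w)\<close> vanish.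
\<close>

section \<open>Dominance in families of convergent power series\<close>

text \<open>The constant may depend neither on v nor on t, while the centre \<open>x0\<close> moves
  with v and may lie on the boundary of the ball, where it need not be a critical point of F. So
  only minimality and convexity are used along segments from \<open>x0\<close>, and the interval
  count has to be uniform over all lines. Near a line on which \<open>g i\<close> does not vanish
  identically, a finite order of vanishing gives such a count. Lines on which it does vanish are the
  obstacle, since compactness of the set of lines then gives no bound. What survives there is an
  inequality among the \<open>a_k\<close> that holds at every parameter, including those where all
  of them vanish.

  The ratio stays above 1/2 so that the single value of F at \<open>x0 + y/2\<close> controls the
  derivative from below on the whole segment. The resulting bound is free of s, and one more
  dilation turns it into an integral over the ball. The Jacobian of the dilation is a power of s,
  bounded together with its derivative on [1/2, 1], and simply joins the amplitude.\<close>

lemma incseq_subseq_on_finite_set: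
  fixes s :: "nat \<Rightarrow> 'v \<Rightarrow> nat"
  assumes "finite A"
  shows "\<exists>f::nat \<Rightarrow> nat. strict_mono f \<and> (\<forall>v\<in>A. incseq (\<lambda>n. s (f n) v))"
  using assms
proof (induction A rule: finite_induct)
  case empty
  then show ?case using strict_mono_id by auto
next
  case (insert v A)
  then obtain f :: "nat \<Rightarrow> nat" where f: "strict_mono f" "\<forall>w\<in>A. incseq (\<lambda>n. s (f n) w)" by blast
  have "\<exists>h::nat\<Rightarrow>nat. strict_mono h \<and> incseq (\<lambda>n. s (f (h n)) v)"
  \<comment> \<open>A bounded sequence of naturals repeats some value infinitely often. In an
    unbounded one every term is matched or exceeded by a later one, so a weakly increasing
    subsequence can be chosen recursively.\<close>
  proof (cases "bdd_above (range (\<lambda>n. s (f n) v))")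
    case True
    then have "finite (range (\<lambda>n. s (f n) v))" using bdd_above_nat by blast
    then obtain c where "infinite {n. s (f n) v = c}"
      using pigeonhole_infinite[of UNIV "\<lambda>n. s (f n) v"] by auto
    then have *: "strict_mono (enumerate {n. s (f n) v = c})"
      "\<And>n. enumerate {n. s (f n) v = c} n \<in> {n. s (f n) v = c}"
      by (auto simp: strict_mono_enumerate intro: enumerate_in_set[of "{n. s (f n) v = c}", simplified])
    then show ?thesis by (intro exI[of _ "enumerate {n. s (f n) v = c}"]) (auto simp: incseq_def)
  next
    case False
    have ex: "\<exists>m>n. s (f m) v \<ge> s (f n) v" for n
    proof (rule ccontr)
      assume "\<not> ?thesis"
      then have *: "s (f m) v < s (f n) v" if "m > n" for m using that by (auto simp: not_le)
      then have "s (f m) v \<le> Max ((\<lambda>n. s (f n) v) ` {..n})" for m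
      proof (cases "m \<le> n")
        case False
        then have "s (f m) v \<le> s (f n) v" using * by (simp add: less_imp_le)
        also have "\<dots> \<le> Max ((\<lambda>n. s (f n) v) ` {..n})" by (intro Max_ge) auto
        finally show ?thesis .
      qed (auto intro: Max_ge)
      then show False using False unfolding bdd_above_def by blast
    qed
    define h where "h = rec_nat 0 (\<lambda>_ n. SOME m. m > n \<and> s (f m) v \<ge> s (f n) v)"
    have "h (Suc k) > h k \<and> s (f (h (Suc k))) v \<ge> s (f (h k)) v" for k
      unfolding h_def using someI_ex[OF ex] by simp
    then show ?thesis by (intro exI[of _ h]) (auto simp: strict_mono_Suc_iff incseq_Suc_iff)
  qed
  then obtain h :: "nat \<Rightarrow> nat" where h: "strict_mono h" "incseq (\<lambda>n. s (f (h n)) v)" by blast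
  then show ?case
    using f by (intro exI[of _ "f \<circ> h"])
      (auto simp: strict_mono_def incseq_def strict_mono_less_eq)
qed

text \<open>Dickson's lemma, with F the minimal elements of D. These form an antichain, whereas an
  infinite set of exponents contains a sequence increasing in every coordinate. Descent to a minimal
  element terminates because the total degree drops.\<close>

lemma dickson:
  fixes D :: "('v::finite \<Rightarrow> nat) set"
  shows "\<exists>F. finite F \<and> F \<subseteq> D \<and> (\<forall>\<alpha>\<in>D. \<exists>\<phi>\<in>F. \<phi> \<le> \<alpha>)"
proof -
  define F where "F = {\<alpha>\<in>D. \<forall>\<beta>\<in>D. \<beta> \<le> \<alpha> \<longrightarrow> \<beta> = \<alpha>}"
  have "finite F"
  proof (rule ccontr)
    assume "infinite F"
    then obtain s :: "nat \<Rightarrow> 'v \<Rightarrow> nat" where s: "inj s" "range s \<subseteq> F"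
      using infinite_countable_subset by blast
    obtain f :: "nat \<Rightarrow> nat" where f: "strict_mono f" "\<forall>v. incseq (\<lambda>n. s (f n) v)"
      using incseq_subseq_on_finite_set[of UNIV s] by auto
    have "s (f 0) \<le> s (f 1)" using f(2) by (auto simp: le_fun_def incseq_def)
    then have "s (f 0) = s (f 1)" using s(2) unfolding F_def by blast
    then show False using s(1) f(1) by (simp add: inj_eq strict_mono_eq)
  qed
  moreover have "\<exists>\<phi>\<in>F. \<phi> \<le> \<alpha>" if "\<alpha> \<in> D" for \<alpha>
    using that
  proof (induction "\<Sum>v\<in>UNIV. \<alpha> v" arbitrary: \<alpha> rule: less_induct)
    case less
    show ?case
    proof (cases "\<alpha> \<in> F")
      case False
      then obtain \<beta> where \<beta>: "\<beta> \<in> D" "\<beta> \<le> \<alpha>" "\<beta> \<noteq> \<alpha>" using less.prems F_def by auto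
      then obtain v where "\<beta> v < \<alpha> v" by (metis ext le_fun_def le_neq_implies_less)
      then have "(\<Sum>v\<in>UNIV. \<beta> v) < (\<Sum>v\<in>UNIV. \<alpha> v)"
        using \<beta>(2) by (intro sum_strict_mono_ex1) (auto simp: le_fun_def)
      then show ?thesis using less.hyps \<beta> order.trans by blast
    qed auto
  qed
  ultimately show ?thesis by (intro exI[of _ F]) (auto simp: F_def)
qed

section \<open>Power series in finitely many variables: evaluation, weights and norms\<close>

definition mono_pow :: "('v::finite \<Rightarrow> real) \<Rightarrow> ('v \<Rightarrow> nat) \<Rightarrow> real" where
  "mono_pow u \<alpha> = (\<Prod>v\<in>UNIV. u v ^ \<alpha> v)"

lemma mono_pow_add: "mono_pow u (\<alpha> + \<beta>) = mono_pow u \<alpha> * mono_pow u \<beta>"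
  by (simp add: mono_pow_def power_add prod.distrib)

definition ps_eval :: "(('v::finite \<Rightarrow> nat) \<Rightarrow> real) \<Rightarrow> ('v \<Rightarrow> real) \<Rightarrow> real" where
  "ps_eval h u = (\<Sum>\<^sub>\<infinity>\<alpha>. h \<alpha> * mono_pow u \<alpha>)"

text \<open>The coefficients of the product of the series h with the monomial of exponent
  \<beta>.\<close>

definition ps_shift :: "('v \<Rightarrow> nat) \<Rightarrow> (('v \<Rightarrow> nat) \<Rightarrow> real) \<Rightarrow> ('v \<Rightarrow> nat) \<Rightarrow> real" where
  "ps_shift \<beta> h \<alpha> = (if \<beta> \<le> \<alpha> then h (\<alpha> - \<beta>) else 0)"

text \<open>Only finite sums and monomial multiples are allowed, so these are the combinations of
  the \<open>a k\<close> with polynomial coefficients, not with power series as coefficients. Each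
  element thus involves finitely many generators, which is what gives it a bound by finitely many
  \<open>a i\<close>. Infinite reductions are reached by a limit of estimates instead.\<close>

inductive_set ps_ideal :: "(nat \<Rightarrow> ('v \<Rightarrow> nat) \<Rightarrow> real) \<Rightarrow> (('v \<Rightarrow> nat) \<Rightarrow> real) set"
  for a :: "nat \<Rightarrow> ('v \<Rightarrow> nat) \<Rightarrow> real" where
  gen: "a k \<in> ps_ideal a"
| add: "h \<in> ps_ideal a \<Longrightarrow> h' \<in> ps_ideal a \<Longrightarrow> (\<lambda>\<alpha>. h \<alpha> + h' \<alpha>) \<in> ps_ideal a"
| scale: "h \<in> ps_ideal a \<Longrightarrow> (\<lambda>\<alpha>. c * h \<alpha>) \<in> ps_ideal a"
| shift: "h \<in> ps_ideal a \<Longrightarrow> ps_shift \<beta> h \<in> ps_ideal a"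

lemma add_le_fun: "(\<beta>::'v\<Rightarrow>nat) \<le> \<beta> + \<alpha>" by (simp add: le_fun_def)

lemma diff_add_fun: "(\<beta>::'v\<Rightarrow>nat) \<le> \<alpha> \<Longrightarrow> \<beta> + (\<alpha> - \<beta>) = \<alpha>"
  by (auto simp: le_fun_def fun_eq_iff)

text \<open>Stated for an arbitrary weight w so that it serves both the evaluation, with
  \<open>w = mono_pow u\<close>, and the norm, with \<open>w = weight \<sigma>\<close>.\<close>

lemma has_sum_ps_shift:
  fixes h w :: "('v \<Rightarrow> nat) \<Rightarrow> real"
  assumes "((\<lambda>\<alpha>. h \<alpha> * w (\<beta> + \<alpha>)) has_sum s) UNIV"
  shows "((\<lambda>\<alpha>. ps_shift \<beta> h \<alpha> * w \<alpha>) has_sum s) UNIV"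
proof -
  have inj: "inj (\<lambda>\<alpha>. \<beta> + \<alpha>)" by (auto simp: inj_def fun_eq_iff)
  have "\<And>\<alpha>. \<beta> + \<alpha> - \<beta> = \<alpha>" by (auto simp: fun_eq_iff)
  then have "((\<lambda>\<alpha>. ps_shift \<beta> h (\<beta> + \<alpha>) * w (\<beta> + \<alpha>)) has_sum s) UNIV"
    using assms by (simp add: ps_shift_def add_le_fun)
  then have "((\<lambda>\<alpha>. ps_shift \<beta> h \<alpha> * w \<alpha>) has_sum s) (range (\<lambda>\<alpha>. \<beta> + \<alpha>))"
    by (subst has_sum_reindex[OF inj]) (simp add: comp_def)
  moreover have "\<alpha> \<in> range (\<lambda>\<alpha>. \<beta> + \<alpha>)" if "\<beta> \<le> \<alpha>" for \<alpha>
    using that by (metis diff_add_fun rangeI)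
  ultimately show ?thesis
    by (elim has_sum_cong_neutral[THEN iffD1, rotated -1]) (auto simp: ps_shift_def)
qed

text \<open>Indexing the variables by distinct primes makes the weight of a monomial multiplicative and
  injective, so it is at once a monomial order and a choice of polyradii: shrinking the polydisc
  (increasing \<open>\<sigma>\<close>) makes the leading term of any given series dominate the rest.\<close>

locale prime_weights =
  fixes P :: "'v::finite \<Rightarrow> nat"
  assumes inj_P: "inj P" and prime_P: "prime (P v)"
begin

definition wt :: "('v \<Rightarrow> nat) \<Rightarrow> nat" where
  "wt \<alpha> = (\<Prod>v\<in>UNIV. P v ^ \<alpha> v)"

lemma wt_add: "wt (\<alpha> + \<beta>) = wt \<alpha> * wt \<beta>"
  by (simp add: wt_def power_add prod.distrib)

lemma wt_pos: "wt \<alpha> > 0"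
  by (auto simp: wt_def intro!: prod_pos prime_gt_0_nat prime_P)

lemma wt_multiplicity: "multiplicity (P v) (wt \<alpha>) = \<alpha> v"
proof -
  have wt: "wt \<alpha> = P v ^ \<alpha> v * (\<Prod>w\<in>UNIV - {v}. P w ^ \<alpha> w)"
    unfolding wt_def by (rule prod.remove) auto
  have "\<not> P v dvd (\<Prod>w\<in>UNIV - {v}. P w ^ \<alpha> w)"
  proof
    assume "P v dvd (\<Prod>w\<in>UNIV - {v}. P w ^ \<alpha> w)"
    then obtain w where w: "w \<noteq> v" "P v dvd P w ^ \<alpha> w"
      using prime_dvd_prod_iff[of "UNIV - {v}" "P v"] prime_P[of v] by auto
    then have "P v = P w" using prime_P by (metis prime_dvd_power_nat primes_dvd_imp_eq)
    then show False using w inj_P by (simp add: inj_eq)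
  qed
  then show ?thesis unfolding wt by (rule multiplicity_decomposeI[OF refl]) (use prime_P[of v] in auto)
qed

lemma inj_wt: "inj wt"
  by (rule injI) (metis wt_multiplicity ext)

text \<open>The value of the monomial at the corner of the polydisc with radii
  \<open>1 / P v ^ \<sigma>\<close>, written through \<open>wt\<close> so that the monomial order
  can be read off from it.\<close>

definition weight :: "nat \<Rightarrow> ('v \<Rightarrow> nat) \<Rightarrow> real" where
  "weight \<sigma> \<alpha> = 1 / real (wt \<alpha>) ^ \<sigma>"

lemma weight_pos: "weight \<sigma> \<alpha> > 0"
  using wt_pos[of \<alpha>] by (simp add: weight_def)

lemma weight_add: "weight \<sigma> (\<alpha> + \<beta>) = weight \<sigma> \<alpha> * weight \<sigma> \<beta>"
  by (simp add: weight_def wt_add power_mult_distrib)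

lemma weight_antimono: "\<sigma> \<le> \<sigma>' \<Longrightarrow> weight \<sigma>' \<alpha> \<le> weight \<sigma> \<alpha>"
  using wt_pos[of \<alpha>] by (auto simp: weight_def intro!: divide_left_mono power_increasing)

definition ps_summable :: "nat \<Rightarrow> (('v \<Rightarrow> nat) \<Rightarrow> real) \<Rightarrow> bool" where
  "ps_summable \<sigma> h \<longleftrightarrow> (\<lambda>\<alpha>. \<bar>h \<alpha>\<bar> * weight \<sigma> \<alpha>) summable_on UNIV"

text \<open>A weighted l1 norm of the coefficients. It majorises the series on
  \<open>polydisc \<sigma>\<close>, and it splits exactly when a single coefficient is removed,
  which makes the bookkeeping of the reduction possible.\<close>

definition ps_norm :: "nat \<Rightarrow> (('v \<Rightarrow> nat) \<Rightarrow> real) \<Rightarrow> real" where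
  "ps_norm \<sigma> h = (\<Sum>\<^sub>\<infinity>\<alpha>. \<bar>h \<alpha>\<bar> * weight \<sigma> \<alpha>)"

definition polydisc :: "nat \<Rightarrow> ('v \<Rightarrow> real) set" where
  "polydisc \<sigma> = {u. \<forall>v. \<bar>u v\<bar> \<le> 1 / real (P v) ^ \<sigma>}"

lemma mono_pow_polydisc: "u \<in> polydisc \<sigma> \<Longrightarrow> \<bar>mono_pow u \<alpha>\<bar> \<le> weight \<sigma> \<alpha>"
proof -
  assume u: "u \<in> polydisc \<sigma>"
  have "\<bar>mono_pow u \<alpha>\<bar> = (\<Prod>v\<in>UNIV. \<bar>u v\<bar> ^ \<alpha> v)"
    by (simp add: mono_pow_def abs_prod power_abs)
  also have "\<dots> \<le> (\<Prod>v\<in>UNIV. (1 / real (P v) ^ \<sigma>) ^ \<alpha> v)"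
    using u by (intro prod_mono) (auto simp: polydisc_def intro!: power_mono)
  also have "\<dots> = weight \<sigma> \<alpha>"
    by (simp add: weight_def wt_def power_divide prod_dividef prod_power_distrib flip: power_mult)
      (simp add: mult.commute)
  finally show ?thesis .
qed

lemma ps_summable_mono: "ps_summable \<sigma> h \<Longrightarrow> \<sigma> \<le> \<sigma>' \<Longrightarrow> ps_summable \<sigma>' h"
  unfolding ps_summable_def
  by (erule summable_on_comparison_test) (simp_all add: mult_left_mono weight_antimono less_imp_le[OF weight_pos])

lemma polydisc_antimono: "\<sigma> \<le> \<sigma>' \<Longrightarrow> polydisc \<sigma>' \<subseteq> polydisc \<sigma>"
proof -
  assume "\<sigma> \<le> \<sigma>'"
  then have "1 / real (P v) ^ \<sigma>' \<le> 1 / real (P v) ^ \<sigma>" for v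
    using prime_gt_0_nat[OF prime_P[of v]] by (auto intro!: divide_left_mono power_increasing)
  then show ?thesis unfolding polydisc_def by (blast intro: order.trans)
qed

lemma ps_eval_abs_summable:
  assumes "ps_summable \<sigma> h" "u \<in> polydisc \<sigma>"
  shows "(\<lambda>\<alpha>. norm (h \<alpha> * mono_pow u \<alpha>)) summable_on UNIV"
  using assms(1) unfolding ps_summable_def
  by (rule summable_on_comparison_test)
    (auto simp: abs_mult intro!: mult_left_mono mono_pow_polydisc assms)

lemmas ps_eval_summable = ps_eval_abs_summable[THEN abs_summable_summable]

lemma ps_norm_nonneg: "ps_norm \<sigma> h \<ge> 0"
  unfolding ps_norm_def by (intro infsum_nonneg) (simp add: less_imp_le[OF weight_pos])

lemma ps_eval_le:
  assumes "ps_summable \<sigma> h" "u \<in> polydisc \<sigma>"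
  shows "\<bar>ps_eval h u\<bar> \<le> ps_norm \<sigma> h"
  unfolding ps_norm_def ps_eval_def real_norm_def[symmetric]
proof (rule norm_infsum_le)
  show "((\<lambda>\<alpha>. h \<alpha> * mono_pow u \<alpha>) has_sum (\<Sum>\<^sub>\<infinity>\<alpha>. h \<alpha> * mono_pow u \<alpha>)) UNIV"
    using ps_eval_summable[OF assms] by simp
  show "((\<lambda>\<alpha>. norm (h \<alpha>) * weight \<sigma> \<alpha>) has_sum (\<Sum>\<^sub>\<infinity>\<alpha>. norm (h \<alpha>) * weight \<sigma> \<alpha>)) UNIV"
    using assms(1) by (simp add: ps_summable_def)
qed (auto simp: abs_mult intro!: mult_left_mono mono_pow_polydisc assms)

lemma ps_eval_shift:
  assumes "ps_summable \<sigma> h" "u \<in> polydisc \<sigma>"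
  shows "ps_eval (ps_shift \<beta> h) u = mono_pow u \<beta> * ps_eval h u"
proof -
  have "((\<lambda>\<alpha>. mono_pow u \<beta> * (h \<alpha> * mono_pow u \<alpha>)) has_sum (mono_pow u \<beta> * ps_eval h u)) UNIV"
    using ps_eval_summable[OF assms] unfolding ps_eval_def by (intro has_sum_cmult_right) simp
  then have "((\<lambda>\<alpha>. h \<alpha> * mono_pow u (\<beta> + \<alpha>)) has_sum (mono_pow u \<beta> * ps_eval h u)) UNIV"
    by (simp add: mono_pow_add ac_simps)
  then show ?thesis unfolding ps_eval_def by (intro infsumI has_sum_ps_shift)
qed

lemma has_sum_norm_shift:
  assumes "ps_summable \<sigma> h"
  shows "((\<lambda>\<alpha>. \<bar>ps_shift \<beta> h \<alpha>\<bar> * weight \<sigma> \<alpha>) has_sum (weight \<sigma> \<beta> * ps_norm \<sigma> h)) UNIV"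
proof -
  have "((\<lambda>\<alpha>. weight \<sigma> \<beta> * (\<bar>h \<alpha>\<bar> * weight \<sigma> \<alpha>)) has_sum (weight \<sigma> \<beta> * ps_norm \<sigma> h)) UNIV"
    using assms unfolding ps_norm_def ps_summable_def by (intro has_sum_cmult_right) simp
  then have "((\<lambda>\<alpha>. \<bar>h \<alpha>\<bar> * weight \<sigma> (\<beta> + \<alpha>)) has_sum (weight \<sigma> \<beta> * ps_norm \<sigma> h)) UNIV"
    by (simp add: weight_add ac_simps)
  from has_sum_ps_shift[of "\<lambda>\<alpha>. \<bar>h \<alpha>\<bar>", OF this]
  show ?thesis by (simp add: ps_shift_def if_distrib cong: if_cong)
qed

lemma ps_summable_shift: "ps_summable \<sigma> h \<Longrightarrow> ps_summable \<sigma> (ps_shift \<beta> h)"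
  using has_sum_norm_shift unfolding ps_summable_def by (blast intro: has_sum_imp_summable)

lemma ps_summable_scale: "ps_summable \<sigma> h \<Longrightarrow> ps_summable \<sigma> (\<lambda>\<alpha>. c * h \<alpha>)"
  unfolding ps_summable_def abs_mult mult.assoc by (rule summable_on_cmult_right)

lemma ps_eval_scale: "ps_eval (\<lambda>\<alpha>. c * h \<alpha>) u = c * ps_eval h u"
  unfolding ps_eval_def by (simp add: mult.assoc infsum_cmult_right')

lemma ps_summable_add:
  assumes "ps_summable \<sigma> h" "ps_summable \<sigma> h'"
  shows "ps_summable \<sigma> (\<lambda>\<alpha>. h \<alpha> + h' \<alpha>)"
  using summable_on_add[OF assms[unfolded ps_summable_def]] unfolding ps_summable_def
  by (rule summable_on_comparison_test)
    (auto simp: less_imp_le[OF weight_pos] simp flip: distrib_right intro!: mult_right_mono abs_triangle_ineq)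

lemma ps_eval_add:
  assumes "ps_summable \<sigma> h" "ps_summable \<sigma> h'" "u \<in> polydisc \<sigma>"
  shows "ps_eval (\<lambda>\<alpha>. h \<alpha> + h' \<alpha>) u = ps_eval h u + ps_eval h' u"
  using assms unfolding ps_eval_def distrib_right by (intro infsum_add ps_eval_summable)

lemma ps_ideal_summable:
  assumes "\<And>k. ps_summable \<sigma> (a k)" "h \<in> ps_ideal a"
  shows "ps_summable \<sigma> h"
  using assms(2)
proof induction
  case (gen k)
  show ?case by (rule assms)
next
  case (add h h')
  show ?case by (rule ps_summable_add[OF add.IH])
next
  case (scale h c)
  show ?case by (rule ps_summable_scale[OF scale.IH])
next
  case (shift h \<beta>)
  show ?case by (rule ps_summable_shift[OF shift.IH])
qed

text \<open>Induction over the generation of h: sums add the constants and take the larger N, while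
  scalars and monomials only multiply C by a bound for their size on the polydisc.\<close>

lemma ps_ideal_eval_le:
  assumes a: "\<And>k. ps_summable \<sigma> (a k)" and "h \<in> ps_ideal a"
  shows "\<exists>N C. C \<ge> 0 \<and> (\<forall>u\<in>polydisc \<sigma>. \<bar>ps_eval h u\<bar> \<le> C * (\<Sum>i<N. \<bar>ps_eval (a i) u\<bar>))"
  using assms(2)
proof induction
  case (gen k)
  show ?case by (intro exI[of _ "Suc k"] exI[of _ 1]) (auto intro: sum_nonneg)
next
  case (add h h')
  then obtain N C N' C' where
    C: "C \<ge> 0" "\<And>u. u\<in>polydisc \<sigma> \<Longrightarrow> \<bar>ps_eval h u\<bar> \<le> C * (\<Sum>i<N. \<bar>ps_eval (a i) u\<bar>)" and
    C': "C' \<ge> 0" "\<And>u. u\<in>polydisc \<sigma> \<Longrightarrow> \<bar>ps_eval h' u\<bar> \<le> C' * (\<Sum>i<N'. \<bar>ps_eval (a i) u\<bar>)"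
    by blast
  have "\<bar>ps_eval (\<lambda>\<alpha>. h \<alpha> + h' \<alpha>) u\<bar> \<le> (C + C') * (\<Sum>i<max N N'. \<bar>ps_eval (a i) u\<bar>)"
    if u: "u \<in> polydisc \<sigma>" for u
  proof -
    have "ps_eval (\<lambda>\<alpha>. h \<alpha> + h' \<alpha>) u = ps_eval h u + ps_eval h' u"
      by (rule ps_eval_add[OF ps_ideal_summable[OF a add.hyps(1)] ps_ideal_summable[OF a add.hyps(2)] u])
    moreover have "C * (\<Sum>i<N. \<bar>ps_eval (a i) u\<bar>) \<le> C * (\<Sum>i<max N N'. \<bar>ps_eval (a i) u\<bar>)"
      using C(1) by (intro mult_left_mono sum_mono2) auto
    moreover have "C' * (\<Sum>i<N'. \<bar>ps_eval (a i) u\<bar>) \<le> C' * (\<Sum>i<max N N'. \<bar>ps_eval (a i) u\<bar>)"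
      using C'(1) by (intro mult_left_mono sum_mono2) auto
    ultimately show ?thesis using C(2)[OF u] C'(2)[OF u] unfolding distrib_right by linarith
  qed
  then show ?case using C(1) C'(1) by (intro exI[of _ "max N N'"] exI[of _ "C + C'"]) auto
next
  case (scale h c)
  then obtain N C where "C \<ge> 0" "\<And>u. u\<in>polydisc \<sigma> \<Longrightarrow> \<bar>ps_eval h u\<bar> \<le> C * (\<Sum>i<N. \<bar>ps_eval (a i) u\<bar>)"
    by blast
  then show ?case
    by (intro exI[of _ N] exI[of _ "\<bar>c\<bar> * C"]) (auto simp: ps_eval_scale abs_mult mult.assoc intro!: mult_left_mono)
next
  case (shift h \<beta>)
  then obtain N C where C: "C \<ge> 0" "\<And>u. u\<in>polydisc \<sigma> \<Longrightarrow> \<bar>ps_eval h u\<bar> \<le> C * (\<Sum>i<N. \<bar>ps_eval (a i) u\<bar>)"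
    by blast
  have "\<bar>ps_eval (ps_shift \<beta> h) u\<bar> \<le> weight \<sigma> \<beta> * C * (\<Sum>i<N. \<bar>ps_eval (a i) u\<bar>)" if u: "u \<in> polydisc \<sigma>" for u
    using ps_eval_shift[OF ps_ideal_summable[OF a shift.hyps] u] C(2)[OF u] mono_pow_polydisc[OF u, of \<beta>]
    by (auto simp: abs_mult mult.assoc intro!: mult_mono less_imp_le[OF weight_pos])
  then show ?case using C(1) less_imp_le[OF weight_pos] by (intro exI[of _ N] exI[of _ "weight \<sigma> \<beta> * C"]) auto
qed

section \<open>Division by leading monomials, with norm control\<close>

lemma ps_norm_mono:
  assumes "ps_summable \<sigma> h" "ps_summable \<sigma> h'" "\<And>\<alpha>. \<bar>h \<alpha>\<bar> \<le> \<bar>h' \<alpha>\<bar>"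
  shows "ps_norm \<sigma> h \<le> ps_norm \<sigma> h'"
  using assms unfolding ps_norm_def ps_summable_def
  by (intro infsum_mono mult_right_mono less_imp_le[OF weight_pos])

lemma ps_norm_delete:
  assumes "ps_summable \<sigma> h"
  shows "ps_summable \<sigma> (h(\<alpha> := 0))" "ps_norm \<sigma> (h(\<alpha> := 0)) = ps_norm \<sigma> h - \<bar>h \<alpha>\<bar> * weight \<sigma> \<alpha>"
proof -
  let ?f = "\<lambda>\<beta>. \<bar>h \<beta>\<bar> * weight \<sigma> \<beta>"
  have "(?f has_sum (\<bar>h \<alpha>\<bar> * weight \<sigma> \<alpha>)) {\<alpha>}" by (rule has_sum_finiteI) auto
  moreover have "(?f has_sum ps_norm \<sigma> h) UNIV"
    using assms unfolding ps_norm_def ps_summable_def by simp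
  ultimately have "(?f has_sum (ps_norm \<sigma> h - \<bar>h \<alpha>\<bar> * weight \<sigma> \<alpha>)) (UNIV - {\<alpha>})"
    by (intro has_sum_Diff) auto
  then have "((\<lambda>\<beta>. \<bar>(h(\<alpha> := 0)) \<beta>\<bar> * weight \<sigma> \<beta>) has_sum (ps_norm \<sigma> h - \<bar>h \<alpha>\<bar> * weight \<sigma> \<alpha>)) UNIV"
    by (elim has_sum_cong_neutral[THEN iffD1, rotated -1]) auto
  then show "ps_summable \<sigma> (h(\<alpha> := 0))" "ps_norm \<sigma> (h(\<alpha> := 0)) = ps_norm \<sigma> h - \<bar>h \<alpha>\<bar> * weight \<sigma> \<alpha>"
    unfolding ps_summable_def by (auto intro: has_sum_imp_summable) (simp add: ps_norm_def infsumI)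
qed

text \<open>Since \<open>wt\<close> is injective and integer valued, every other monomial of b has
  \<open>wt\<close> at least \<open>wt \<phi> + 1\<close>. Raising \<sigma> by k therefore shrinks
  the tail, relative to the leading weight, by the factor
  \<open>(wt \<phi> / (wt \<phi> + 1)) ^ k\<close>.\<close>

lemma eventually_lead_dominates:
  assumes b: "ps_summable \<sigma>0 b" "\<And>\<alpha>. wt \<alpha> < wt \<phi> \<Longrightarrow> b \<alpha> = 0"
  shows "\<forall>\<^sub>F \<sigma> in sequentially. ps_norm \<sigma> (b(\<phi> := 0)) \<le> weight \<sigma> \<phi> / 2"
proof -
  let ?b = "b(\<phi> := 0)" and ?w = "real (wt \<phi>)"
  have bs: "ps_summable \<sigma>0 ?b" by (rule ps_norm_delete[OF b(1)])
  have w: "?w > 0" using wt_pos by simp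
  have "(\<lambda>k. ps_norm \<sigma>0 ?b * (?w / (?w + 1)) ^ k) \<longlonglongrightarrow> ps_norm \<sigma>0 ?b * 0"
    using w by (intro tendsto_intros LIMSEQ_power_zero) simp
  then have "\<forall>\<^sub>F k in sequentially. ps_norm \<sigma>0 ?b * (?w / (?w + 1)) ^ k < weight \<sigma>0 \<phi> / 2"
    using weight_pos[of \<sigma>0 \<phi>] by (intro order_tendstoD(2)[where y = "ps_norm \<sigma>0 ?b * 0"]) auto
  then have "\<forall>\<^sub>F k in sequentially. ps_norm (k + \<sigma>0) ?b \<le> weight (k + \<sigma>0) \<phi> / 2"
  proof eventually_elim
    case (elim k)
    have "ps_norm (k + \<sigma>0) ?b \<le> (\<Sum>\<^sub>\<infinity>\<alpha>. (1 / (?w + 1) ^ k) * (\<bar>?b \<alpha>\<bar> * weight \<sigma>0 \<alpha>))"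
      unfolding ps_norm_def
    proof (rule infsum_mono)
      show "(\<lambda>\<alpha>. \<bar>?b \<alpha>\<bar> * weight (k + \<sigma>0) \<alpha>) summable_on UNIV"
        using ps_summable_mono[OF bs, of "k + \<sigma>0"] by (simp add: ps_summable_def)
      show "(\<lambda>\<alpha>. (1 / (?w + 1) ^ k) * (\<bar>?b \<alpha>\<bar> * weight \<sigma>0 \<alpha>)) summable_on UNIV"
        using bs unfolding ps_summable_def by (intro summable_on_cmult_right)
      show "\<bar>?b \<alpha>\<bar> * weight (k + \<sigma>0) \<alpha> \<le> (1 / (?w + 1) ^ k) * (\<bar>?b \<alpha>\<bar> * weight \<sigma>0 \<alpha>)" for \<alpha>
      proof (cases "?b \<alpha> = 0")
        case False
        then have "wt \<alpha> \<noteq> wt \<phi>" "\<not> wt \<alpha> < wt \<phi>" using b(2) inj_wt by (auto simp: inj_eq split: if_splits)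
        then have "?w + 1 \<le> real (wt \<alpha>)" by linarith
        then have "1 / real (wt \<alpha>) ^ k \<le> 1 / (?w + 1) ^ k"
          using w by (intro divide_left_mono power_mono mult_pos_pos) auto
        then have "(\<bar>?b \<alpha>\<bar> * weight \<sigma>0 \<alpha>) * (1 / real (wt \<alpha>) ^ k) \<le> (\<bar>?b \<alpha>\<bar> * weight \<sigma>0 \<alpha>) * (1 / (?w + 1) ^ k)"
          by (intro mult_left_mono) (auto simp: less_imp_le[OF weight_pos])
        then show ?thesis by (simp add: weight_def power_add mult_ac)
      qed simp
    qed
    also have "\<dots> = (1 / (?w + 1) ^ k) * ps_norm \<sigma>0 ?b" unfolding ps_norm_def by (rule infsum_cmult_right')
    also have "\<dots> = (1 / ?w ^ k) * (ps_norm \<sigma>0 ?b * (?w / (?w + 1)) ^ k)"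
      using w by (simp add: power_divide)
    also have "\<dots> \<le> (1 / ?w ^ k) * (weight \<sigma>0 \<phi> / 2)"
      using elim w by (intro mult_left_mono) auto
    also have "\<dots> = weight (k + \<sigma>0) \<phi> / 2" by (simp add: weight_def power_add)
    finally show ?case .
  qed
  then show ?thesis by (rule eventually_sequentially_seg[THEN iffD1])
qed

text \<open>Multiplicativity of the weight carries the domination over from b to its shift: the tail
  of the shifted b has norm at most \<open>weight \<sigma> \<alpha> / 2\<close>. The cancellation
  removes \<open>\<bar>h \<alpha>\<bar> * weight \<sigma> \<alpha>\<close> and puts back at most
  half of it. It creates nothing of smaller \<open>wt\<close>, because multiplying by a monomial
  preserves the order, and \<alpha> is the only exponent with its value of
  \<open>wt\<close>.\<close>

lemma reduction_step:
  assumes h: "ps_summable \<sigma> h" "\<And>\<beta>. wt \<beta> < wt \<alpha> \<Longrightarrow> h \<beta> = 0"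
    and b: "ps_summable \<sigma> b" "b \<phi> = 1" "\<And>\<beta>. wt \<beta> < wt \<phi> \<Longrightarrow> b \<beta> = 0"
    and dom: "ps_norm \<sigma> (b(\<phi> := 0)) \<le> weight \<sigma> \<phi> / 2"
    and le: "\<phi> \<le> \<alpha>"
  defines "h' \<equiv> \<lambda>\<beta>. h \<beta> + - h \<alpha> * ps_shift (\<alpha> - \<phi>) b \<beta>"
  shows "ps_norm \<sigma> h' \<le> ps_norm \<sigma> h - \<bar>h \<alpha>\<bar> * weight \<sigma> \<alpha> / 2"
    and "\<And>\<beta>. wt \<beta> < Suc (wt \<alpha>) \<Longrightarrow> h' \<beta> = 0"
proof -
  let ?b = "b(\<phi> := 0)" and ?\<delta> = "\<alpha> - \<phi>"
  have \<alpha>: "?\<delta> + \<phi> = \<alpha>" using diff_add_fun[OF le] by (simp add: fun_eq_iff add.commute)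
  \<comment> \<open>The coefficient of b at \<phi> lands at \<alpha> and nowhere else, so deleting
    it from b changes the shift only at \<alpha>, where \<open>h'\<close> vanishes anyway.\<close>
  have shift_eq: "\<beta> - ?\<delta> = \<phi> \<longleftrightarrow> \<beta> = \<alpha>" if "?\<delta> \<le> \<beta>" for \<beta>
    using diff_add_fun[OF that] \<alpha> le by (auto simp: fun_eq_iff le_fun_def)
  have \<delta>: "?\<delta> \<le> \<alpha>" by (simp add: le_fun_def)
  have h'\<alpha>: "h' \<alpha> = 0" using b(2) shift_eq[OF \<delta>] \<delta> by (simp add: h'_def ps_shift_def)
  show "h' \<beta> = 0" if "wt \<beta> < Suc (wt \<alpha>)" for \<beta>
  proof (cases "\<beta> = \<alpha>")
    case False
    then have lt: "wt \<beta> < wt \<alpha>" using that inj_wt by (auto simp: less_Suc_eq inj_eq)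
    have "ps_shift ?\<delta> b \<beta> = 0"
    proof (cases "?\<delta> \<le> \<beta>")
      case True
      have "wt ?\<delta> * wt (\<beta> - ?\<delta>) < wt ?\<delta> * wt \<phi>"
        using lt diff_add_fun[OF True] \<alpha> by (simp flip: wt_add)
      then show ?thesis using b(3) by (simp add: ps_shift_def)
    qed (simp add: ps_shift_def)
    then show ?thesis using h(2)[OF lt] by (simp add: h'_def)
  qed (use h'\<alpha> in simp)
  have bs: "ps_summable \<sigma> ?b" and hs: "ps_summable \<sigma> (h(\<alpha> := 0))"
    using ps_norm_delete b h by blast+
  let ?g = "\<lambda>\<beta>. \<bar>(h(\<alpha> := 0)) \<beta>\<bar> * weight \<sigma> \<beta> + \<bar>h \<alpha>\<bar> * (\<bar>ps_shift ?\<delta> ?b \<beta>\<bar> * weight \<sigma> \<beta>)"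
  have "(?g has_sum (ps_norm \<sigma> (h(\<alpha> := 0)) + \<bar>h \<alpha>\<bar> * (weight \<sigma> ?\<delta> * ps_norm \<sigma> ?b))) UNIV"
    using hs unfolding ps_summable_def ps_norm_def[of _ "h(\<alpha> := 0)"]
    by (intro has_sum_add has_sum_cmult_right has_sum_norm_shift bs) simp
  moreover have "\<bar>h' \<beta>\<bar> * weight \<sigma> \<beta> \<le> ?g \<beta>" for \<beta>
  proof -
    have "\<bar>h' \<beta>\<bar> \<le> \<bar>(h(\<alpha> := 0)) \<beta>\<bar> + \<bar>h \<alpha>\<bar> * \<bar>ps_shift ?\<delta> ?b \<beta>\<bar>"
    proof (cases "\<beta> = \<alpha>")
      case False
      then have "ps_shift ?\<delta> ?b \<beta> = ps_shift ?\<delta> b \<beta>" using shift_eq by (auto simp: ps_shift_def)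
      then show ?thesis using False by (simp add: h'_def abs_mult[symmetric])
    qed (use h'\<alpha> in simp)
    then have "\<bar>h' \<beta>\<bar> * weight \<sigma> \<beta> \<le> (\<bar>(h(\<alpha> := 0)) \<beta>\<bar> + \<bar>h \<alpha>\<bar> * \<bar>ps_shift ?\<delta> ?b \<beta>\<bar>) * weight \<sigma> \<beta>"
      by (intro mult_right_mono less_imp_le[OF weight_pos])
    then show ?thesis by (simp add: algebra_simps)
  qed
  moreover have "ps_summable \<sigma> h'"
    unfolding h'_def by (intro ps_summable_add ps_summable_scale ps_summable_shift h b)
  ultimately have "ps_norm \<sigma> h' \<le> ps_norm \<sigma> (h(\<alpha> := 0)) + \<bar>h \<alpha>\<bar> * (weight \<sigma> ?\<delta> * ps_norm \<sigma> ?b)"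
    unfolding ps_norm_def[of _ h'] ps_summable_def by (intro has_sum_mono[OF has_sum_infsum]) auto
  also have "\<dots> \<le> ps_norm \<sigma> (h(\<alpha> := 0)) + \<bar>h \<alpha>\<bar> * (weight \<sigma> ?\<delta> * (weight \<sigma> \<phi> / 2))"
    using dom less_imp_le[OF weight_pos] by (intro add_mono mult_left_mono order.refl) auto
  also have "weight \<sigma> ?\<delta> * (weight \<sigma> \<phi> / 2) = weight \<sigma> \<alpha> / 2" using weight_add[of \<sigma> ?\<delta> \<phi>] \<alpha> by simp
  finally show "ps_norm \<sigma> h' \<le> ps_norm \<sigma> h - \<bar>h \<alpha>\<bar> * weight \<sigma> \<alpha> / 2"
    using ps_norm_delete(2)[OF h(1), of \<alpha>] by (simp del: fun_upd_apply)
qed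

text \<open>This is why one smaller polydisc is used: passing from \<sigma> to
  \<open>Suc \<sigma>\<close> multiplies the weight of \<alpha> by \<open>1 / wt \<alpha>\<close>,
  at most \<open>1 / m\<close> for every monomial that is left. Remainders of high order become
  negligible there.\<close>

lemma high_order_eval_le:
  assumes h: "ps_summable \<sigma> h" "\<And>\<beta>. wt \<beta> < m \<Longrightarrow> h \<beta> = 0" and u: "u \<in> polydisc (Suc \<sigma>)" and m: "m > 0"
  shows "\<bar>ps_eval h u\<bar> \<le> ps_norm \<sigma> h / real m"
proof -
  have "\<bar>ps_eval h u\<bar> \<le> ps_norm (Suc \<sigma>) h" by (intro ps_eval_le ps_summable_mono[OF h(1)] u) simp
  also have "\<dots> \<le> (\<Sum>\<^sub>\<infinity>\<alpha>. (\<bar>h \<alpha>\<bar> * weight \<sigma> \<alpha>) * (1 / real m))"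
    unfolding ps_norm_def
  proof (rule infsum_mono)
    show "(\<lambda>\<alpha>. \<bar>h \<alpha>\<bar> * weight (Suc \<sigma>) \<alpha>) summable_on UNIV"
      using ps_summable_mono[OF h(1), of "Suc \<sigma>"] by (simp add: ps_summable_def)
    show "(\<lambda>\<alpha>. (\<bar>h \<alpha>\<bar> * weight \<sigma> \<alpha>) * (1 / real m)) summable_on UNIV"
      using h(1) unfolding ps_summable_def by (intro summable_on_cmult_left)
    show "\<bar>h \<alpha>\<bar> * weight (Suc \<sigma>) \<alpha> \<le> (\<bar>h \<alpha>\<bar> * weight \<sigma> \<alpha>) * (1 / real m)" for \<alpha>
    proof (cases "wt \<alpha> < m")
      case False
      then have "1 / real (wt \<alpha>) \<le> 1 / real m" using m by (intro divide_left_mono) auto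
      then have "(\<bar>h \<alpha>\<bar> * weight \<sigma> \<alpha>) * (1 / real (wt \<alpha>)) \<le> (\<bar>h \<alpha>\<bar> * weight \<sigma> \<alpha>) * (1 / real m)"
        by (intro mult_left_mono) (auto simp: less_imp_le[OF weight_pos])
      then show ?thesis by (simp add: weight_def mult_ac)
    qed (simp add: h(2))
  qed
  also have "\<dots> = ps_norm \<sigma> h / real m" unfolding ps_norm_def by (subst infsum_cmult_left') simp
  finally show ?thesis .
qed

text \<open>Cancelling leading terms one weight at a time, each step lowers the norm by half of the term it
  removes, so the multiples of the generators used up have bounded total size.\<close>

theorem ps_family_dominated:
  fixes a :: "nat \<Rightarrow> ('v \<Rightarrow> nat) \<Rightarrow> real"
  assumes a: "\<And>k. ps_summable \<sigma>0 (a k)"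
  shows "\<exists>N \<sigma> K. \<sigma> \<ge> \<sigma>0 \<and> K \<ge> 0 \<and> (\<forall>k. \<forall>u\<in>polydisc (Suc \<sigma>).
    \<bar>ps_eval (a k) u\<bar> \<le> K * ps_norm \<sigma> (a k) * (\<Sum>i<N. \<bar>ps_eval (a i) u\<bar>))"
proof -
  \<comment> \<open>D consists of the exponents of leading monomials of the ideal, leading meaning
    smallest in \<open>wt\<close>. Dickson's lemma picks finitely many that divide all of
    them.\<close>
  define D where "D = {\<alpha>. \<exists>h\<in>ps_ideal a. h \<alpha> \<noteq> 0 \<and> (\<forall>\<beta>. wt \<beta> < wt \<alpha> \<longrightarrow> h \<beta> = 0)}"
  obtain F where F: "finite F" "F \<subseteq> D" "\<And>\<alpha>. \<alpha> \<in> D \<Longrightarrow> \<exists>\<phi>\<in>F. \<phi> \<le> \<alpha>"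
    using dickson[of D] by blast
  have "\<exists>b\<in>ps_ideal a. b \<phi> = 1 \<and> (\<forall>\<beta>. wt \<beta> < wt \<phi> \<longrightarrow> b \<beta> = 0)" if \<phi>: "\<phi> \<in> F" for \<phi>
  proof -
    from \<phi> F(2) obtain h where h: "h \<in> ps_ideal a" "h \<phi> \<noteq> 0" "\<forall>\<beta>. wt \<beta> < wt \<phi> \<longrightarrow> h \<beta> = 0"
      unfolding D_def by blast
    then show ?thesis
      by (intro bexI[of _ "\<lambda>\<beta>. (1 / h \<phi>) * h \<beta>"] ps_ideal.scale) auto
  qed
  then obtain b where b: "\<And>\<phi>. \<phi> \<in> F \<Longrightarrow> b \<phi> \<in> ps_ideal a" "\<And>\<phi>. \<phi> \<in> F \<Longrightarrow> b \<phi> \<phi> = 1"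
    "\<And>\<phi> \<beta>. \<phi> \<in> F \<Longrightarrow> wt \<beta> < wt \<phi> \<Longrightarrow> b \<phi> \<beta> = 0"
    by metis
  \<comment> \<open>Finiteness of F gives one polydisc on which the leading terms of all chosen
    elements dominate.\<close>
  have "\<forall>\<^sub>F \<sigma> in sequentially. \<forall>\<phi>\<in>F. ps_norm \<sigma> ((b \<phi>)(\<phi> := 0)) \<le> weight \<sigma> \<phi> / 2"
    using F(1)
    by (rule eventually_ball_finite)
      (blast intro: eventually_lead_dominates[OF ps_ideal_summable[OF a b(1)] b(3)])
  then obtain \<sigma> where \<sigma>: "\<sigma> \<ge> \<sigma>0" "\<And>\<phi>. \<phi> \<in> F \<Longrightarrow> ps_norm \<sigma> ((b \<phi>)(\<phi> := 0)) \<le> weight \<sigma> \<phi> / 2"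
    unfolding eventually_sequentially by (meson nle_le)
  have a\<sigma>: "ps_summable \<sigma> (a k)" for k using a \<sigma>(1) by (rule ps_summable_mono)
  note ideal\<sigma> = ps_ideal_summable[OF a\<sigma>]
  have "\<forall>\<phi>\<in>F. \<exists>N C. C \<ge> 0 \<and> (\<forall>u\<in>polydisc \<sigma>. \<bar>ps_eval (b \<phi>) u\<bar> \<le> C * (\<Sum>i<N. \<bar>ps_eval (a i) u\<bar>))"
    using ps_ideal_eval_le[OF a\<sigma> b(1)] by blast
  then obtain N\<phi> C\<phi> where NC: "\<And>\<phi>. \<phi> \<in> F \<Longrightarrow> C\<phi> \<phi> \<ge> 0"
    "\<And>\<phi> u. \<phi> \<in> F \<Longrightarrow> u \<in> polydisc \<sigma> \<Longrightarrow> \<bar>ps_eval (b \<phi>) u\<bar> \<le> C\<phi> \<phi> * (\<Sum>i<N\<phi> \<phi>. \<bar>ps_eval (a i) u\<bar>)"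
    by metis
  define N where "N = (\<Sum>\<phi>\<in>F. N\<phi> \<phi>)"
  \<comment> \<open>Dividing by the weight bounds \<open>b \<phi>\<close> by a multiple of
    \<open>weight \<sigma> \<phi>\<close>. Its shift to \<alpha> is then bounded by the same
    multiple of \<open>weight \<sigma> \<alpha>\<close>, the unit in which a reduction step lowers
    the norm.\<close>
  define K where "K = (\<Sum>\<phi>\<in>F. C\<phi> \<phi> / weight \<sigma> \<phi>)"
  define A where "A u = (\<Sum>i<N. \<bar>ps_eval (a i) u\<bar>)" for u
  have A0: "A u \<ge> 0" for u unfolding A_def by (intro sum_nonneg) auto
  have K0: "K \<ge> 0" unfolding K_def using NC(1) by (intro sum_nonneg divide_nonneg_pos weight_pos) auto
  have b_le: "\<bar>ps_eval (b \<phi>) u\<bar> \<le> weight \<sigma> \<phi> * K * A u" if \<phi>: "\<phi> \<in> F" and u: "u \<in> polydisc \<sigma>" for \<phi> u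
  proof -
    have "\<bar>ps_eval (b \<phi>) u\<bar> \<le> C\<phi> \<phi> * (\<Sum>i<N\<phi> \<phi>. \<bar>ps_eval (a i) u\<bar>)" using NC \<phi> u by blast
    also have "\<dots> \<le> C\<phi> \<phi> * A u"
      unfolding A_def N_def using F(1) \<phi> by (intro mult_left_mono NC sum_mono2) (auto intro: order.strict_trans2 member_le_sum)
    also have "C\<phi> \<phi> / weight \<sigma> \<phi> \<le> K"
      unfolding K_def using F(1) \<phi> NC(1) less_imp_le[OF weight_pos]
      by (intro member_le_sum[of _ _ "\<lambda>\<phi>. C\<phi> \<phi> / weight \<sigma> \<phi>"]) auto
    then have "C\<phi> \<phi> * A u \<le> weight \<sigma> \<phi> * K * A u"
      using weight_pos[of \<sigma> \<phi>] A0 by (intro mult_right_mono) (auto simp: field_simps)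
    finally show ?thesis .
  qed
  \<comment> \<open>The drop of the norm pays for the multiples of the \<open>b \<phi>\<close> that
    have been subtracted. The payments telescope, so their total does not grow with the number of
    steps. The factor 2 appears because a step gains only half of the term it removes.\<close>
  define red where "red h h' \<longleftrightarrow> ps_norm \<sigma> h' \<le> ps_norm \<sigma> h \<and> (\<forall>u\<in>polydisc (Suc \<sigma>).
      \<bar>ps_eval h u\<bar> \<le> 2 * K * (ps_norm \<sigma> h - ps_norm \<sigma> h') * A u + \<bar>ps_eval h' u\<bar>)" for h h'
  have red: "\<exists>h'\<in>ps_ideal a. (\<forall>\<beta>. wt \<beta> < m \<longrightarrow> h' \<beta> = 0) \<and> red h h'"
    if h: "h \<in> ps_ideal a" for h m
  proof (induction m)
    case 0
    show ?case using h by (intro bexI[of _ h]) (auto simp: red_def)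
  next
    case (Suc m)
    then obtain h' where h': "h' \<in> ps_ideal a" "\<And>\<beta>. wt \<beta> < m \<Longrightarrow> h' \<beta> = 0" "red h h'" by blast
    show ?case
    proof (cases "\<forall>\<beta>. wt \<beta> < Suc m \<longrightarrow> h' \<beta> = 0")
      case True
      then show ?thesis using h' by blast
    next
      case False
      \<comment> \<open>At most one exponent has \<open>wt\<close> equal to m, so a single
        cancellation suffices to pass from m to \<open>Suc m\<close>.\<close>
      then obtain \<alpha> where \<alpha>: "wt \<alpha> = m" "h' \<alpha> \<noteq> 0" using h'(2) less_Suc_eq by auto
      then have "\<alpha> \<in> D" using h' unfolding D_def by auto
      then obtain \<phi> where \<phi>: "\<phi> \<in> F" "\<phi> \<le> \<alpha>" using F by blast
      define B where "B = ps_shift (\<alpha> - \<phi>) (b \<phi>)"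
      define h'' where "h'' = (\<lambda>\<beta>. h' \<beta> + - h' \<alpha> * B \<beta>)"
      have B: "B \<in> ps_ideal a" unfolding B_def by (intro ps_ideal.shift b \<phi>)
      have h'': "h'' \<in> ps_ideal a"
        unfolding h''_def by (rule ps_ideal.add[OF h'(1) ps_ideal.scale[OF B]])
      note step = reduction_step[where h = h' and b = "b \<phi>" and \<phi> = \<phi> and \<alpha> = \<alpha> and \<sigma> = \<sigma>,
          OF ideal\<sigma>[OF h'(1)] h'(2) ideal\<sigma>[OF b(1)] b(2) b(3) \<sigma>(2) \<phi>(2),
          unfolded \<alpha>(1), OF _ \<phi>(1) \<phi>(1) \<phi>(1) _ \<phi>(1), folded B_def h''_def]
      have norm: "ps_norm \<sigma> h'' \<le> ps_norm \<sigma> h' - \<bar>h' \<alpha>\<bar> * weight \<sigma> \<alpha> / 2"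
        and zero: "\<And>\<beta>. wt \<beta> < Suc m \<Longrightarrow> h'' \<beta> = 0"
        using step unfolding h''_def by auto
      have wpos: "\<bar>h' \<alpha>\<bar> * weight \<sigma> \<alpha> \<ge> 0" using weight_pos[of \<sigma> \<alpha>] by simp
      have "\<bar>ps_eval h u\<bar> \<le> 2 * K * (ps_norm \<sigma> h - ps_norm \<sigma> h'') * A u + \<bar>ps_eval h'' u\<bar>"
        if u: "u \<in> polydisc (Suc \<sigma>)" for u
      proof -
        have u': "u \<in> polydisc \<sigma>" using u polydisc_antimono[of \<sigma> "Suc \<sigma>"] by auto
        have "ps_eval h'' u = ps_eval h' u + - h' \<alpha> * ps_eval B u"
          unfolding h''_def ps_eval_scale[symmetric]
          by (rule ps_eval_add[OF ideal\<sigma>[OF h'(1)] ps_summable_scale[OF ideal\<sigma>[OF B]] u'])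
        then have "\<bar>ps_eval h' u\<bar> \<le> \<bar>ps_eval h'' u\<bar> + \<bar>h' \<alpha>\<bar> * \<bar>ps_eval B u\<bar>"
          by (simp flip: abs_mult)
        moreover have "\<bar>ps_eval B u\<bar> \<le> weight \<sigma> (\<alpha> - \<phi>) * (weight \<sigma> \<phi> * K * A u)"
          unfolding B_def ps_eval_shift[OF ideal\<sigma>[OF b(1)[OF \<phi>(1)]] u'] abs_mult
          by (intro mult_mono mono_pow_polydisc u' b_le \<phi> less_imp_le[OF weight_pos]) simp
        then have "\<bar>ps_eval B u\<bar> \<le> weight \<sigma> \<alpha> * K * A u"
          using diff_add_fun[OF \<phi>(2)] weight_add[of \<sigma> \<phi> "\<alpha> - \<phi>"] by (simp add: mult_ac)
        then have "\<bar>h' \<alpha>\<bar> * \<bar>ps_eval B u\<bar> \<le> \<bar>h' \<alpha>\<bar> * (weight \<sigma> \<alpha> * K * A u)"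
          by (intro mult_left_mono) auto
        moreover have "\<bar>h' \<alpha>\<bar> * (weight \<sigma> \<alpha> * K * A u) \<le> 2 * K * (ps_norm \<sigma> h' - ps_norm \<sigma> h'') * A u"
        proof -
          have "K * A u * (\<bar>h' \<alpha>\<bar> * weight \<sigma> \<alpha>) \<le> K * A u * (2 * (ps_norm \<sigma> h' - ps_norm \<sigma> h''))"
            using norm K0 A0 by (intro mult_left_mono) auto
          then show ?thesis by (simp add: mult_ac)
        qed
        moreover have "\<bar>ps_eval h u\<bar> \<le> 2 * K * (ps_norm \<sigma> h - ps_norm \<sigma> h') * A u + \<bar>ps_eval h' u\<bar>"
          using h'(3) u unfolding red_def by blast
        ultimately show ?thesis by (simp add: algebra_simps)
      qed
      then show ?thesis using h'(3) h'' norm wpos zero unfolding red_def by (intro bexI[of _ h'']) auto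
    qed
  qed
  have "\<bar>ps_eval h u\<bar> \<le> 2 * K * ps_norm \<sigma> h * A u" if h: "h \<in> ps_ideal a" and u: "u \<in> polydisc (Suc \<sigma>)" for h u
  \<comment> \<open>The reduction may go on forever; stopping at order m leaves an error of at most
    \<open>ps_norm \<sigma> h / m\<close>, and m is then sent to infinity.\<close>
  proof (rule LIMSEQ_le_const)
    show "(\<lambda>m. 2 * K * ps_norm \<sigma> h * A u + ps_norm \<sigma> h / real m) \<longlonglongrightarrow> 2 * K * ps_norm \<sigma> h * A u"
      using tendsto_add[OF tendsto_const lim_const_over_n[of "ps_norm \<sigma> h"]] by simp
    have "\<bar>ps_eval h u\<bar> \<le> 2 * K * ps_norm \<sigma> h * A u + ps_norm \<sigma> h / real m" if m: "m \<ge> 1" for m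
    proof -
      obtain h' where h': "h' \<in> ps_ideal a" "\<And>\<beta>. wt \<beta> < m \<Longrightarrow> h' \<beta> = 0" "red h h'"
        using red[OF h] by blast
      have "\<bar>ps_eval h' u\<bar> \<le> ps_norm \<sigma> h' / real m"
        using m by (intro high_order_eval_le ideal\<sigma>[OF h'(1)] h'(2) u) auto
      also have "\<dots> \<le> ps_norm \<sigma> h / real m"
        using h'(3) unfolding red_def by (intro divide_right_mono) auto
      finally have "\<bar>ps_eval h' u\<bar> \<le> ps_norm \<sigma> h / real m" .
      moreover have "2 * K * (ps_norm \<sigma> h - ps_norm \<sigma> h') * A u \<le> 2 * K * ps_norm \<sigma> h * A u"
        using K0 A0 ps_norm_nonneg by (intro mult_right_mono mult_left_mono) auto
      moreover have "\<bar>ps_eval h u\<bar> \<le> 2 * K * (ps_norm \<sigma> h - ps_norm \<sigma> h') * A u + \<bar>ps_eval h' u\<bar>"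
        using h'(3) u unfolding red_def by blast
      ultimately show ?thesis by linarith
    qed
    then show "\<exists>M. \<forall>m\<ge>M. \<bar>ps_eval h u\<bar> \<le> 2 * K * ps_norm \<sigma> h * A u + ps_norm \<sigma> h / real m" by blast
  qed
  then show ?thesis
    using \<sigma>(1) K0 ps_ideal.gen unfolding A_def
    by (intro exI[of _ N] exI[of _ \<sigma>] exI[of _ "2 * K"]) auto
qed

end

section \<open>Zeros of analytic functions along lines\<close>

text \<open>Rolle's theorem between each zero and the next: the open gaps are disjoint, so the
  points found are distinct and at most one fewer than the zeros. The conclusion exhibits a finite
  set because \<open>f'\<close> may have infinitely many zeros.\<close>

lemma rolle_card:
  fixes f f' :: "real \<Rightarrow> real"
  assumes "finite Z" "\<And>z. z \<in> Z \<Longrightarrow> \<bar>z\<bar> < \<eta>" "\<And>z. z \<in> Z \<Longrightarrow> f z = 0"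
    and f': "\<And>x. \<bar>x\<bar> < \<eta> \<Longrightarrow> (f has_real_derivative f' x) (at x)"
  shows "\<exists>Z'. finite Z' \<and> card Z \<le> Suc (card Z') \<and> (\<forall>z\<in>Z'. \<bar>z\<bar> < \<eta> \<and> f' z = 0)"
proof (cases "Z = {}")
  case True
  then show ?thesis by (intro exI[of _ "{}"]) auto
next
  case False
  define nxt where "nxt z = Min {w\<in>Z. z < w}" for z
  let ?Y = "Z - {Max Z}"
  have nxt: "nxt z \<in> Z" "z < nxt z" "\<And>w. w \<in> Z \<Longrightarrow> z < w \<Longrightarrow> nxt z \<le> w" if "z \<in> ?Y" for z
  proof -
    have "z < Max Z" using that assms(1) by (simp add: order.not_eq_order_implies_strict)
    then have "{w\<in>Z. z < w} \<noteq> {}" using Max_in[OF assms(1) False] by blast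
    then have "nxt z \<in> {w\<in>Z. z < w}" unfolding nxt_def using assms(1) by (intro Min_in) auto
    then show "nxt z \<in> Z" "z < nxt z" by auto
    show "nxt z \<le> w" if "w \<in> Z" "z < w" for w
      unfolding nxt_def using assms(1) that by (intro Min_le) auto
  qed
  have "\<exists>\<xi>. z < \<xi> \<and> \<xi> < nxt z \<and> f' \<xi> = 0" if z: "z \<in> ?Y" for z
  proof -
    have in_int: "\<bar>x\<bar> < \<eta>" if "z \<le> x" "x \<le> nxt z" for x
      using that assms(2)[of z] assms(2)[OF nxt(1)[OF z]] z by auto
    have "f z = f (nxt z)" using assms(3) z nxt(1)[OF z] by simp
    then have "\<exists>\<xi>. z < \<xi> \<and> \<xi> < nxt z \<and> (\<lambda>y. f' \<xi> * y) = (\<lambda>v. 0)"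
      using f'[OF in_int] nxt(2)[OF z]
      by (intro Rolle_deriv[where f = f and f' = "\<lambda>x y. f' x * y"])
        (auto simp: has_field_derivative_def intro!: DERIV_continuous_on[of _ _ f'] in_int
          has_field_derivative_at_within[OF f'])
    then show ?thesis by (metis mult.right_neutral)
  qed
  then obtain \<xi> where \<xi>: "\<And>z. z \<in> ?Y \<Longrightarrow> z < \<xi> z \<and> \<xi> z < nxt z \<and> f' (\<xi> z) = 0" by metis
  have "\<xi> z < \<xi> w" if "z \<in> ?Y" "w \<in> ?Y" "z < w" for z w
    using \<xi>[OF that(1)] \<xi>[OF that(2)] nxt(3)[OF that(1) _ that(3)] that(2) by auto
  then have inj: "inj_on \<xi> ?Y" by (intro inj_onI) (metis less_irrefl linorder_less_linear)
  have "\<bar>\<xi> z\<bar> < \<eta>" if "z \<in> ?Y" for z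
    using \<xi>[OF that] assms(2)[of z] assms(2)[OF nxt(1)[OF that]] that by auto
  moreover have "card Z = Suc (card ?Y)" by (rule card.remove[OF assms(1) Max_in[OF assms(1) False]])
  ultimately show ?thesis
    using assms(1) \<xi> by (intro exI[of _ "\<xi> ` ?Y"]) (auto simp: card_image[OF inj])
qed

lemma dominated_power_series_summable:
  fixes a :: "nat \<Rightarrow> real"
  assumes "R > 0" "\<And>k. \<bar>a k\<bar> \<le> B * R ^ k" "\<bar>\<tau>\<bar> * R < 1"
  shows "summable (\<lambda>k. a k * \<tau> ^ k)"
proof (rule summable_comparison_test)
  show "summable (\<lambda>k. B * (\<bar>\<tau>\<bar> * R) ^ k)" using assms by (intro summable_mult summable_geometric) simp
  have "\<bar>a k\<bar> * \<bar>\<tau> ^ k\<bar> \<le> B * R ^ k * \<bar>\<tau> ^ k\<bar>" for k using assms(2) by (intro mult_right_mono) auto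
  then show "\<exists>N. \<forall>k\<ge>N. norm (a k * \<tau> ^ k) \<le> B * (\<bar>\<tau>\<bar> * R) ^ k"
    by (auto simp: abs_mult power_mult_distrib power_abs mult_ac)
qed

lemma dominated_power_series_DERIV:
  fixes a :: "nat \<Rightarrow> real"
  assumes "R > 0" "\<And>k. \<bar>a k\<bar> \<le> B * R ^ k" "\<bar>z\<bar> * R < 1"
  shows "((\<lambda>z. \<Sum>k. a k * z ^ k) has_real_derivative (\<Sum>k. diffs a k * z ^ k)) (at z)"
proof (rule termdiffs_strong'[where K = "1 / R"])
  show "summable (\<lambda>k. a k * w ^ k)" if "norm w < 1 / R" for w
    using that assms(1) by (intro dominated_power_series_summable[OF assms(1,2)]) (auto simp: pos_less_divide_eq)
qed (use assms in \<open>auto simp: pos_less_divide_eq\<close>)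

text \<open>The radius \<eta> is fixed before the series, hence uniform over all series with these
  constants. For \<open>i = 0\<close> the constant term outweighs the rest near 0. Otherwise
  differentiation moves the dominating coefficient from \<open>Suc i\<close> to i and costs at most
  one zero by Rolle. It also multiplies coefficients by \<open>k + 1 \<le> 2 ^ k\<close>, so the
  growth rate R must be allowed to change: (C, R) becomes (C R, 2 R).\<close>

lemma dominated_power_series_zeros:
  assumes "C \<ge> 0" "R > 0"
  shows "\<exists>\<eta>>0. \<forall>a::nat \<Rightarrow> real. a i \<noteq> 0 \<longrightarrow> (\<forall>k. \<bar>a k\<bar> \<le> C * R ^ k * \<bar>a i\<bar>) \<longrightarrow>
    (\<forall>Z. finite Z \<longrightarrow> (\<forall>z\<in>Z. \<bar>z\<bar> < \<eta> \<and> (\<Sum>k. a k * z ^ k) = 0) \<longrightarrow> card Z \<le> i)"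
  using assms
proof (induction i arbitrary: C R)
  case 0
  \<comment> \<open>With \<open>q = \<bar>z\<bar> * R\<close> this gives
    \<open>2 * (C + 1) * q < 1\<close>, so that the tail, at most \<open>C * q / (1 - q)\<close>
    times \<open>\<bar>a 0\<bar>\<close>, stays below \<open>\<bar>a 0\<bar>\<close>. Using C + 1
    covers C = 0.\<close>
  define \<eta> where "\<eta> = 1 / (2 * (C + 1) * R)"
  have \<eta>: "\<eta> > 0" using 0 by (simp add: \<eta>_def)
  have "(\<Sum>k. a k * z ^ k) \<noteq> 0"
    if a: "a 0 \<noteq> 0" "\<And>k. \<bar>a k\<bar> \<le> C * R ^ k * \<bar>a 0\<bar>" and z: "\<bar>z\<bar> < \<eta>" for a :: "nat \<Rightarrow> real" and z
  proof -
    define q where "q = \<bar>z\<bar> * R"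
    have "q < \<eta> * R" using z 0 unfolding q_def by (intro mult_strict_right_mono) auto
    also have "\<eta> * R = 1 / (2 * (C + 1))" using 0 by (simp add: \<eta>_def)
    finally have q2: "q * (2 * (C + 1)) < 1" using 0 by (simp add: pos_less_divide_eq)
    have q0: "q \<ge> 0" using 0 by (simp add: q_def)
    have q1: "2 * q < 1" "q < 1" using q2 q0 0 by (auto simp: algebra_simps) (smt (verit) mult_nonneg_nonneg)+
    have le: "\<bar>a (Suc k) * z ^ Suc k\<bar> \<le> (C * \<bar>a 0\<bar> * q) * q ^ k" for k
    proof -
      have "\<bar>a (Suc k)\<bar> * \<bar>z ^ Suc k\<bar> \<le> C * R ^ Suc k * \<bar>a 0\<bar> * \<bar>z ^ Suc k\<bar>"
        by (intro mult_right_mono a) auto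
      then show ?thesis by (simp add: abs_mult q_def power_mult_distrib power_abs mult_ac)
    qed
    have sum: "summable (\<lambda>k. a k * z ^ k)"
      using a(2) 0 q1 by (intro dominated_power_series_summable[where B = "C * \<bar>a 0\<bar>" and R = R])
        (auto simp: q_def mult_ac)
    then have eq: "(\<Sum>k. a k * z ^ k) = (\<Sum>k. a (Suc k) * z ^ Suc k) + a 0"
      by (subst suminf_split_head) auto
    have gs: "summable (\<lambda>k. (C * \<bar>a 0\<bar> * q) * q ^ k)" using q0 q1 by (intro summable_mult summable_geometric) simp
    have "\<bar>\<Sum>k. a (Suc k) * z ^ Suc k\<bar> \<le> (\<Sum>k. (C * \<bar>a 0\<bar> * q) * q ^ k)"
      using norm_suminf_le[of "\<lambda>k. a (Suc k) * z ^ Suc k", OF _ gs] le by simp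
    also have "\<dots> = C * \<bar>a 0\<bar> * q / (1 - q)" using q0 q1
      by (subst suminf_mult[OF summable_geometric]) (auto simp: suminf_geometric)
    also have "\<dots> < \<bar>a 0\<bar>"
    proof -
      have "(C + 1) * q < 1" using q2 0 q0 by (simp add: algebra_simps)
      then have "C * q < 1 - q" by (simp add: algebra_simps)
      then have "\<bar>a 0\<bar> * (C * q) < \<bar>a 0\<bar> * (1 - q)" using a(1) by (intro mult_strict_left_mono) auto
      then show ?thesis using q1 by (simp add: field_simps)
    qed
    finally show ?thesis using eq by auto
  qed
  then have "Z = {}" if "a 0 \<noteq> 0" "\<forall>k. \<bar>a k\<bar> \<le> C * R ^ k * \<bar>a 0\<bar>"
    "\<forall>z\<in>Z. \<bar>z\<bar> < \<eta> \<and> (\<Sum>k. a k * z ^ k) = 0" for a :: "nat \<Rightarrow> real" and Z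
    using that by blast
  then have "card Z \<le> 0" if "a 0 \<noteq> 0" "\<forall>k. \<bar>a k\<bar> \<le> C * R ^ k * \<bar>a 0\<bar>"
    "\<forall>z\<in>Z. \<bar>z\<bar> < \<eta> \<and> (\<Sum>k. a k * z ^ k) = 0" for a :: "nat \<Rightarrow> real" and Z
    using that by (metis card.empty le_refl)
  then show ?case using \<eta> by blast
next
  case (Suc i)
  have "C * R \<ge> 0" "2 * R > 0" using Suc.prems by auto
  then obtain \<eta>' where \<eta>'0: "\<eta>' > 0" and "\<forall>b. b i \<noteq> 0 \<longrightarrow> (\<forall>k. \<bar>b k\<bar> \<le> C * R * (2 * R) ^ k * \<bar>b i\<bar>) \<longrightarrow>
      (\<forall>Z. finite Z \<longrightarrow> (\<forall>z\<in>Z. \<bar>z\<bar> < \<eta>' \<and> (\<Sum>k. b k * z ^ k) = 0) \<longrightarrow> card Z \<le> i)"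
    using Suc.IH[of "C * R" "2 * R"] by blast
  then have \<eta>': "\<And>b Z. b i \<noteq> 0 \<Longrightarrow> (\<And>k. \<bar>b k\<bar> \<le> C * R * (2 * R) ^ k * \<bar>b i\<bar>) \<Longrightarrow>
      finite Z \<Longrightarrow> (\<And>z. z\<in>Z \<Longrightarrow> \<bar>z\<bar> < \<eta>' \<and> (\<Sum>k. b k * z ^ k) = 0) \<Longrightarrow> card Z \<le> i"
    by blast
  \<comment> \<open>The second bound keeps z inside the disc of radius \<open>1 / R\<close>, where
    termwise differentiation is justified.\<close>
  define \<eta> where "\<eta> = min \<eta>' (1 / (2 * R))"
  have "card Z \<le> Suc i" if a: "a (Suc i) \<noteq> 0" "\<And>k. \<bar>a k\<bar> \<le> C * R ^ k * \<bar>a (Suc i)\<bar>"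
    and Z: "finite Z" "\<And>z. z\<in>Z \<Longrightarrow> \<bar>z\<bar> < \<eta> \<and> (\<Sum>k. a k * z ^ k) = 0" for a :: "nat \<Rightarrow> real" and Z
  proof -
    have "((\<lambda>z. \<Sum>k. a k * z ^ k) has_real_derivative (\<Sum>k. diffs a k * z ^ k)) (at z)" if "\<bar>z\<bar> < \<eta>" for z
      using a(2) Suc.prems that
      by (intro dominated_power_series_DERIV[where B = "C * \<bar>a (Suc i)\<bar>" and R = R])
        (auto simp: mult_ac \<eta>_def pos_less_divide_eq)
    then obtain Z' where Z': "finite Z'" "card Z \<le> Suc (card Z')"
      "\<And>z. z \<in> Z' \<Longrightarrow> \<bar>z\<bar> < \<eta> \<and> (\<Sum>k. diffs a k * z ^ k) = 0"
      using rolle_card[OF Z(1), of \<eta> "\<lambda>z. \<Sum>k. a k * z ^ k" "\<lambda>z. \<Sum>k. diffs a k * z ^ k"] Z(2) by blast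
    have "card Z' \<le> i"
    proof (rule \<eta>'[OF _ _ Z'(1)])
      show "diffs a i \<noteq> 0" using a(1) by (simp add: diffs_def)
      have "\<bar>a (Suc i)\<bar> \<le> \<bar>diffs a i\<bar>" by (simp add: diffs_def abs_mult mult_le_cancel_right1)
      moreover have "\<bar>diffs a k\<bar> \<le> C * R * (2 * R) ^ k * \<bar>a (Suc i)\<bar>" for k
      proof -
        have "\<bar>diffs a k\<bar> = real (Suc k) * \<bar>a (Suc k)\<bar>" by (simp add: diffs_def abs_mult)
        also have "\<dots> \<le> 2 ^ k * (C * R ^ Suc k * \<bar>a (Suc i)\<bar>)"
        proof (rule mult_mono[OF _ a(2)])
          have "Suc k \<le> 2 ^ k" by (induction k) auto
          then show "real (Suc k) \<le> 2 ^ k" by (metis of_nat_le_iff of_nat_numeral of_nat_power)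
        qed auto
        finally show ?thesis by (simp add: power_mult_distrib mult_ac)
      qed
      moreover have "C * R * (2 * R) ^ k * \<bar>a (Suc i)\<bar> \<le> C * R * (2 * R) ^ k * \<bar>diffs a i\<bar>" for k
        using Suc.prems calculation(1) by (intro mult_left_mono) auto
      ultimately show "\<bar>diffs a k\<bar> \<le> C * R * (2 * R) ^ k * \<bar>diffs a i\<bar>" for k by (meson order.trans)
    qed (use Z'(3) \<eta>_def in auto)
    then show ?thesis using Z'(2) by simp
  qed
  then show ?case using \<eta>'0 Suc.prems by (intro exI[of _ \<eta>]) (auto simp: \<eta>_def)
qed

section \<open>Sets cut out of a line by boundedly many break points\<close>

text \<open>Break points are counted instead of intervals. Intersecting conditions then amounts to
  uniting the break sets, and nothing is claimed at the break points themselves, where membership in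
  Q is arbitrary.\<close>

definition few_pieces :: "nat \<Rightarrow> real set \<Rightarrow> real set \<Rightarrow> bool" where
  "few_pieces N X Q \<longleftrightarrow> (\<exists>T. finite T \<and> card T \<le> N \<and>
    (\<forall>J. convex J \<longrightarrow> J \<subseteq> X \<longrightarrow> J \<inter> T = {} \<longrightarrow> J \<subseteq> Q \<or> J \<inter> Q = {}))"

lemma few_pieces_mono: "few_pieces N X Q \<Longrightarrow> N \<le> M \<Longrightarrow> Y \<subseteq> X \<Longrightarrow> few_pieces M Y Q"
  unfolding few_pieces_def by (meson order.trans)

lemma few_pieces_const: "(\<And>s. s \<in> X \<Longrightarrow> s \<in> Q \<longleftrightarrow> b) \<Longrightarrow> few_pieces N X Q"
  unfolding few_pieces_def by (intro exI[of _ "{}"]) (cases b; auto)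

lemma few_pieces_Int:
  assumes "few_pieces N X Q" "few_pieces M X R"
  shows "few_pieces (N + M) X (Q \<inter> R)"
proof -
  from assms obtain S T where
    S: "finite S" "card S \<le> N" "\<And>J. convex J \<Longrightarrow> J \<subseteq> X \<Longrightarrow> J \<inter> S = {} \<Longrightarrow> J \<subseteq> Q \<or> J \<inter> Q = {}" and
    T: "finite T" "card T \<le> M" "\<And>J. convex J \<Longrightarrow> J \<subseteq> X \<Longrightarrow> J \<inter> T = {} \<Longrightarrow> J \<subseteq> R \<or> J \<inter> R = {}"
    unfolding few_pieces_def by metis
  have "J \<subseteq> Q \<inter> R \<or> J \<inter> (Q \<inter> R) = {}" if "convex J" "J \<subseteq> X" "J \<inter> (S \<union> T) = {}" for J
  proof -
    have "J \<subseteq> Q \<or> J \<inter> Q = {}" using that by (intro S(3)) auto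
    moreover have "J \<subseteq> R \<or> J \<inter> R = {}" using that by (intro T(3)) auto
    ultimately show ?thesis by auto
  qed
  moreover have "card (S \<union> T) \<le> N + M" using S(2) T(2) card_Un_le[of S T] by linarith
  ultimately show ?thesis
    unfolding few_pieces_def using S(1) T(1) by (intro exI[of _ "S \<union> T"]) simp
qed

lemma few_pieces_INT:
  assumes "finite I" "\<And>i. i \<in> I \<Longrightarrow> few_pieces (N i) X (Q i)"
  shows "few_pieces (\<Sum>i\<in>I. N i) X (\<Inter>i\<in>I. Q i)"
  using assms
proof (induction I rule: finite_induct)
  case empty
  show ?case by (rule few_pieces_const[where b = True]) simp
next
  case (insert i I)
  then show ?case using few_pieces_Int[of "N i" X "Q i"] by simp
qed

lemma few_pieces_affine:
  assumes "few_pieces N X Q" "\<beta> \<noteq> 0"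
  shows "few_pieces N {s. (s - \<alpha>) / \<beta> \<in> X} {s. (s - \<alpha>) / \<beta> \<in> Q}"
proof -
  from assms(1) obtain T where T: "finite T" "card T \<le> N"
    "\<And>J. convex J \<Longrightarrow> J \<subseteq> X \<Longrightarrow> J \<inter> T = {} \<Longrightarrow> J \<subseteq> Q \<or> J \<inter> Q = {}"
    unfolding few_pieces_def by metis
  let ?h = "\<lambda>s. (s - \<alpha>) / \<beta>" and ?T = "(\<lambda>t. \<alpha> + \<beta> * t) ` T"
  have "J \<subseteq> {s. ?h s \<in> Q} \<or> J \<inter> {s. ?h s \<in> Q} = {}"
    if J: "convex J" "J \<subseteq> {s. ?h s \<in> X}" "J \<inter> ?T = {}" for J
  proof -
    have "?h ` J = (\<lambda>s. - \<alpha> / \<beta> + (1 / \<beta>) *\<^sub>R s) ` J"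
      by (simp add: diff_divide_distrib)
    then have "convex (?h ` J)" by (simp only: convex_affinity[OF J(1)])
    moreover have "?h ` J \<inter> T = {}"
    proof (rule ccontr)
      assume "?h ` J \<inter> T \<noteq> {}"
      then obtain s where s: "s \<in> J" "?h s \<in> T" by auto
      then have "\<alpha> + \<beta> * ?h s \<in> ?T" by blast
      then show False using s J(3) assms(2) by auto
    qed
    ultimately have "?h ` J \<subseteq> Q \<or> ?h ` J \<inter> Q = {}" using J(2) by (intro T(3)) auto
    then show ?thesis by blast
  qed
  moreover have "card ?T \<le> N" using card_image_le[OF T(1)] T(2) order.trans by blast
  ultimately show ?thesis unfolding few_pieces_def using T(1) by (intro exI[of _ ?T]) blast
qed

text \<open>The break points are the zeros of f. A uniform bound on finite sets of zeros excludes
  infinitely many, and on an interval without zeros the intermediate value theorem fixes the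
  sign.\<close>

lemma few_pieces_negative:
  fixes f :: "real \<Rightarrow> real"
  assumes f: "continuous_on X f" and Z: "\<And>Z. finite Z \<Longrightarrow> Z \<subseteq> {t\<in>X. f t = 0} \<Longrightarrow> card Z \<le> N"
  shows "few_pieces N X {t. f t < 0}"
proof -
  let ?T = "{t\<in>X. f t = 0}"
  have fin: "finite ?T"
  proof (rule ccontr)
    assume "infinite ?T"
    then obtain Y where "finite Y" "card Y = Suc N" "Y \<subseteq> ?T" using infinite_arbitrarily_large by blast
    then show False using Z by fastforce
  qed
  have "J \<subseteq> {t. f t < 0} \<or> J \<inter> {t. f t < 0} = {}" if J: "convex J" "J \<subseteq> X" "J \<inter> ?T = {}" for J
  proof (rule ccontr)
    assume "\<not> ?thesis"
    then obtain s t where st: "s \<in> J" "t \<in> J" "f s < 0" "f t \<ge> 0" by force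
    have "is_interval (f ` J)"
      using J f by (intro connected_continuous_image[THEN is_interval_connected_1[THEN iffD2]])
        (auto intro: continuous_on_subset convex_connected)
    then have "0 \<in> f ` J" using st unfolding is_interval_1 by (meson image_eqI less_imp_le)
    then show False using J by auto
  qed
  then show ?thesis unfolding few_pieces_def using fin Z[OF fin] by (intro exI[of _ ?T]) blast
qed

text \<open>The two end points of each \<open>I l\<close> are added to the break points. An interval
  J that avoids them and meets \<open>I l\<close> cannot leave it, so the break points of that one
  \<open>I l\<close> decide the matter.\<close>

lemma few_pieces_cover:
  assumes "finite L" "\<And>l. l \<in> L \<Longrightarrow> few_pieces (N l) (I l) Q"
    and I: "\<And>l. l \<in> L \<Longrightarrow> convex (I l)" "\<And>l. l \<in> L \<Longrightarrow> bounded (I l)" and X: "X \<subseteq> (\<Union>l\<in>L. I l)"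
  shows "few_pieces (\<Sum>l\<in>L. N l + 2) X Q"
proof -
  from assms(2) obtain T where T: "\<And>l. l \<in> L \<Longrightarrow> finite (T l)" "\<And>l. l \<in> L \<Longrightarrow> card (T l) \<le> N l"
    "\<And>l J. l \<in> L \<Longrightarrow> convex J \<Longrightarrow> J \<subseteq> I l \<Longrightarrow> J \<inter> T l = {} \<Longrightarrow> J \<subseteq> Q \<or> J \<inter> Q = {}"
    unfolding few_pieces_def by metis
  define S where "S = (\<Union>l\<in>L. T l \<union> {Inf (I l), Sup (I l)})"
  have "J \<subseteq> Q \<or> J \<inter> Q = {}" if J: "convex J" "J \<subseteq> X" "J \<inter> S = {}" for J
  proof (cases "J = {}")
    case False
    then obtain s l where s: "s \<in> J" "l \<in> L" "s \<in> I l" using J(2) X by blast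
    have iv: "is_interval (I l)" "is_interval J" using I(1) J(1) s(2) is_interval_convex_1 by auto
    have bd: "bdd_above (I l)" "bdd_below (I l)"
      using I(2)[OF s(2)] bounded_imp_bdd_above bounded_imp_bdd_below by auto
    have "t \<in> I l" if t: "t \<in> J" for t
    proof (rule ccontr)
      assume nt: "t \<notin> I l"
      then consider "s < t" | "t < s" using s by (metis linorder_neqE)
      then show False
      proof cases
        case 1
        have "w \<le> t" if "w \<in> I l" for w
          using that nt s(3) 1 iv(1) unfolding is_interval_1 by (meson less_imp_le linear)
        then have "Sup (I l) \<le> t" using s(3) by (intro cSup_least) auto
        moreover have "s \<le> Sup (I l)" using s(3) bd by (intro cSup_upper)
        ultimately have "Sup (I l) \<in> J" using s(1) t iv(2) unfolding is_interval_1 by blast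
        then show False using J(3) s(2) unfolding S_def by blast
      next
        case 2
        have "t \<le> w" if "w \<in> I l" for w
          using that nt s(3) 2 iv(1) unfolding is_interval_1 by (meson less_imp_le linear)
        then have "t \<le> Inf (I l)" using s(3) by (intro cInf_greatest) auto
        moreover have "Inf (I l) \<le> s" using s(3) bd by (intro cInf_lower)
        ultimately have "Inf (I l) \<in> J" using s(1) t iv(2) unfolding is_interval_1 by blast
        then show False using J(3) s(2) unfolding S_def by blast
      qed
    qed
    moreover have "J \<inter> T l = {}" using J(3) s(2) unfolding S_def by blast
    ultimately show ?thesis using T(3)[OF s(2) J(1)] by blast
  qed simp
  moreover have "card S \<le> (\<Sum>l\<in>L. N l + 2)"
    unfolding S_def
  proof (rule order.trans[OF card_UN_le[OF assms(1)] sum_mono])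
    fix l assume l: "l \<in> L"
    have "card {Inf (I l), Sup (I l)} \<le> 2" by (simp add: card_insert_if)
    then show "card (T l \<union> {Inf (I l), Sup (I l)}) \<le> N l + 2"
      using card_Un_le[of "T l" "{Inf (I l), Sup (I l)}"] T(2)[OF l] by linarith
  qed
  moreover have "finite S" unfolding S_def using assms(1) T(1) by auto
  ultimately show ?thesis unfolding few_pieces_def by blast
qed

section \<open>Expanding an analytic function along lines\<close>

lemma has_sum_fibers:
  fixes f :: "'a \<Rightarrow> real" and \<pi> :: "'a \<Rightarrow> 'b"
  assumes "(f has_sum S) UNIV" "\<And>b. (f has_sum g b) {x. \<pi> x = b}"
  shows "(g has_sum S) UNIV"
proof (rule has_sum_SigmaD)
  show "((\<lambda>(b, x). f x) has_sum S) (Sigma UNIV (\<lambda>b. {x. \<pi> x = b}))"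
    using assms(1) by (rule has_sum_reindex_bij_witness[where i = "\<lambda>x. (\<pi> x, x)" and j = snd, THEN iffD2, rotated -1]) auto
qed (use assms(2) in simp)

lemma summable_on_fibers:
  fixes f :: "'a \<Rightarrow> real" and \<pi> :: "'a \<Rightarrow> 'b"
  assumes "g summable_on UNIV" "\<And>b. (f has_sum g b) {x. \<pi> x = b}" "\<And>x. f x \<ge> 0"
  shows "f summable_on UNIV"
proof -
  have "(\<lambda>(b, x). f x) summable_on (Sigma UNIV (\<lambda>b. {x. \<pi> x = b}))"
    using assms by (intro summable_on_SigmaI[where g = g]) auto
  then show ?thesis
    by (rule summable_on_reindex_bij_witness[where i = "\<lambda>x. (\<pi> x, x)" and j = snd, THEN iffD1, rotated -1]) auto
qed

text \<open>If \<open>g (a + x) = (\<Sum>\<gamma>. c \<gamma> x^\<gamma>)\<close>, then \<open>line_coeff c\<close> is the power series of \<open>g (a + p + w)\<close> in the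
  components of \<open>p\<close> (indexed by \<^term>\<open>Inl\<close>) and \<open>w\<close> (indexed by \<^term>\<open>Inr\<close>).\<close>

definition line_coeff :: "(('n::finite \<Rightarrow> nat) \<Rightarrow> real) \<Rightarrow> ('n + 'n \<Rightarrow> nat) \<Rightarrow> real" where
  "line_coeff c \<alpha> = c (\<lambda>i. \<alpha> (Inl i) + \<alpha> (Inr i)) *
     (\<Prod>i\<in>UNIV. real ((\<alpha> (Inl i) + \<alpha> (Inr i)) choose \<alpha> (Inr i)))"

lemma mono_pow_case_sum:
  "mono_pow (case_sum p w) \<alpha> = (\<Prod>i\<in>UNIV. p i ^ \<alpha> (Inl i) * w i ^ \<alpha> (Inr i))"
  unfolding mono_pow_def UNIV_Plus_UNIV[symmetric]
  by (subst prod.Plus) (auto simp: prod.distrib)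

text \<open>The multivariate binomial theorem: the fibre over \<gamma> consists of its splittings
  into \<open>\<gamma> - \<delta>\<close>, the exponent of p, and \<delta>, the exponent of
  w.\<close>

lemma binomial_fiber:
  fixes \<gamma> :: "'n::finite \<Rightarrow> nat" and p w :: "'n \<Rightarrow> real"
  shows "((\<lambda>\<alpha>. (\<Prod>i\<in>UNIV. real ((\<alpha> (Inl i) + \<alpha> (Inr i)) choose \<alpha> (Inr i))) * mono_pow (case_sum p w) \<alpha>)
    has_sum (\<Prod>i\<in>UNIV. (p i + w i) ^ \<gamma> i)) {\<alpha>. (\<lambda>i. \<alpha> (Inl i) + \<alpha> (Inr i)) = \<gamma>}"
proof -
  let ?F = "{\<alpha>. (\<lambda>i. \<alpha> (Inl i) + \<alpha> (Inr i)) = \<gamma>}"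
  let ?t = "\<lambda>i k. real (\<gamma> i choose k) * w i ^ k * p i ^ (\<gamma> i - k)"
  have bij: "bij_betw (\<lambda>\<delta>. case_sum (\<lambda>i. \<gamma> i - \<delta> i) \<delta>) (PiE UNIV (\<lambda>i. {..\<gamma> i})) ?F"
    by (rule bij_betw_byWitness[where f' = "\<lambda>\<alpha> i. \<alpha> (Inr i)"])
      (auto simp: fun_eq_iff PiE_def Pi_def split: sum.split intro: le_add2 dest: spec, metis add_diff_cancel_right', metis le_add2)
  have fin: "finite ?F"
    using bij_betw_finite[OF bij] by (simp add: finite_PiE)
  have "(\<Prod>i\<in>UNIV. (p i + w i) ^ \<gamma> i) = (\<Prod>i\<in>UNIV. \<Sum>k\<le>\<gamma> i. ?t i k)"
    by (simp add: binomial_ring add.commute[of "p _"])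
  also have "\<dots> = (\<Sum>\<delta>\<in>PiE UNIV (\<lambda>i. {..\<gamma> i}). \<Prod>i\<in>UNIV. ?t i (\<delta> i))"
    by (rule prod_sum_PiE) auto
  also have "\<dots> = (\<Sum>\<alpha>\<in>?F. (\<Prod>i\<in>UNIV. real ((\<alpha> (Inl i) + \<alpha> (Inr i)) choose \<alpha> (Inr i))) * mono_pow (case_sum p w) \<alpha>)"
    by (subst sum.reindex_bij_betw[OF bij, symmetric], rule sum.cong)
      (auto simp: mono_pow_case_sum PiE_def Pi_def prod.distrib[symmetric] mult_ac intro!: prod.cong)
  finally show ?thesis by (intro has_sum_finiteI[OF fin])
qed

lemma line_coeff_fiber:
  fixes \<gamma> :: "'n::finite \<Rightarrow> nat" and p w :: "'n \<Rightarrow> real"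
  shows "((\<lambda>\<alpha>. line_coeff c \<alpha> * mono_pow (case_sum p w) \<alpha>) has_sum (c \<gamma> * (\<Prod>i\<in>UNIV. (p i + w i) ^ \<gamma> i)))
    {\<alpha>. (\<lambda>i. \<alpha> (Inl i) + \<alpha> (Inr i)) = \<gamma>}"
proof -
  have "((\<lambda>\<alpha>. c \<gamma> * ((\<Prod>i\<in>UNIV. real ((\<alpha> (Inl i) + \<alpha> (Inr i)) choose \<alpha> (Inr i))) * mono_pow (case_sum p w) \<alpha>))
    has_sum (c \<gamma> * (\<Prod>i\<in>UNIV. (p i + w i) ^ \<gamma> i))) {\<alpha>. (\<lambda>i. \<alpha> (Inl i) + \<alpha> (Inr i)) = \<gamma>}"
    by (rule has_sum_cmult_right[OF binomial_fiber])
  then show ?thesis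
    by (rule has_sum_cong[THEN iffD1, rotated]) (auto simp: line_coeff_def)
qed

lemma line_coeff_abs: "\<bar>line_coeff c \<alpha>\<bar> = line_coeff (\<lambda>\<gamma>. \<bar>c \<gamma>\<bar>) \<alpha>"
  by (simp add: line_coeff_def abs_mult abs_prod)

text \<open>The part of \<open>line_coeff c\<close> that is homogeneous of degree k in w. Replacing
  w by \<tau> w multiplies it by \<open>\<tau> ^ k\<close>, so these series are the coefficients
  \<open>a_k\<close> of the expansion in \<tau>.\<close>

definition line_taylor :: "(('n::finite \<Rightarrow> nat) \<Rightarrow> real) \<Rightarrow> nat \<Rightarrow> ('n + 'n \<Rightarrow> nat) \<Rightarrow> real" where
  "line_taylor c k \<alpha> = (if (\<Sum>i\<in>UNIV. \<alpha> (Inr i)) = k then line_coeff c \<alpha> else 0)"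

context prime_weights
begin

lemma weight_eq_mono_pow: "weight \<sigma> \<alpha> = mono_pow (\<lambda>v. 1 / real (P v) ^ \<sigma>) \<alpha>"
  by (simp add: mono_pow_def weight_def wt_def power_divide prod_dividef prod_power_distrib flip: power_mult)
    (simp add: mult.commute)

end

text \<open>One absolutely convergent sum is grouped in two ways: by the combined exponent \<gamma>
  it gives the value G, by the degree in w it gives the power series in \<tau>. The bound on \<tau>
  keeps the scaled point in the polydisc.\<close>

lemma line_taylor_expansion:
  fixes P :: "'n::finite + 'n \<Rightarrow> nat"
  assumes "prime_weights P" and c: "prime_weights.ps_summable P \<sigma> (line_coeff c)"
    and u: "case_sum p w \<in> prime_weights.polydisc P \<sigma>" and \<tau>: "\<bar>\<tau>\<bar> \<le> 1"
    and g: "((\<lambda>\<gamma>. c \<gamma> * (\<Prod>i\<in>UNIV. (p i + \<tau> * w i) ^ \<gamma> i)) has_sum G) UNIV"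
  shows "(\<lambda>k. ps_eval (line_taylor c k) (case_sum p w) * \<tau> ^ k) sums G"
proof -
  interpret prime_weights P by fact
  let ?u = "case_sum p w" and ?u' = "case_sum p (\<lambda>i. \<tau> * w i)"
  let ?deg = "\<lambda>\<alpha>::'n + 'n \<Rightarrow> nat. \<Sum>i\<in>UNIV. \<alpha> (Inr i)"
  have ur: "\<bar>w i\<bar> \<le> 1 / real (P (Inr i)) ^ \<sigma>" for i
    using u unfolding polydisc_def by (auto dest: spec[of _ "Inr i"])
  have "\<bar>\<tau> * w i\<bar> \<le> 1 / real (P (Inr i)) ^ \<sigma>" for i
    using mult_mono[OF \<tau> ur[of i]] by (simp add: abs_mult)
  moreover have "\<bar>p i\<bar> \<le> 1 / real (P (Inl i)) ^ \<sigma>" for i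
    using u unfolding polydisc_def by (auto dest: spec[of _ "Inl i"])
  ultimately have u': "?u' \<in> polydisc \<sigma>" unfolding polydisc_def by (auto split: sum.split)
  define F where "F \<alpha> = line_coeff c \<alpha> * mono_pow ?u' \<alpha>" for \<alpha>
  have "F summable_on UNIV" unfolding F_def by (rule ps_eval_summable[OF c u'])
  then have F: "(F has_sum infsum F UNIV) UNIV" by simp
  have "((\<lambda>\<gamma>. c \<gamma> * (\<Prod>i\<in>UNIV. (p i + \<tau> * w i) ^ \<gamma> i)) has_sum infsum F UNIV) UNIV"
    by (rule has_sum_fibers[OF F, where \<pi> = "\<lambda>\<alpha> i. \<alpha> (Inl i) + \<alpha> (Inr i)"])
      (unfold F_def, rule line_coeff_fiber)
  then have G: "infsum F UNIV = G" using g by (rule has_sum_unique)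
  have scale: "mono_pow ?u' \<alpha> = \<tau> ^ ?deg \<alpha> * mono_pow ?u \<alpha>" for \<alpha>
    by (simp add: mono_pow_case_sum power_mult_distrib prod.distrib power_sum mult_ac)
  have "(F has_sum (ps_eval (line_taylor c k) ?u * \<tau> ^ k)) {\<alpha>. ?deg \<alpha> = k}" for k
  proof -
    have "ps_summable \<sigma> (line_taylor c k)"
      using c unfolding ps_summable_def
      by (rule summable_on_comparison_test) (auto simp: line_taylor_def less_imp_le[OF weight_pos])
    then have "((\<lambda>\<alpha>. line_taylor c k \<alpha> * mono_pow ?u \<alpha>) has_sum ps_eval (line_taylor c k) ?u) UNIV"
      unfolding ps_eval_def using ps_eval_summable[OF _ u] by simp
    then have "((\<lambda>\<alpha>. line_taylor c k \<alpha> * mono_pow ?u \<alpha> * \<tau> ^ k) has_sum (ps_eval (line_taylor c k) ?u * \<tau> ^ k)) UNIV"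
      by (rule has_sum_cmult_left)
    then show ?thesis
      by (rule has_sum_cong_neutral[THEN iffD1, rotated -1])
        (auto simp: line_taylor_def F_def scale)
  qed
  from has_sum_fibers[OF F this] show ?thesis unfolding G by (rule has_sum_imp_sums)
qed

lemma ex_prime_weights: "\<exists>P :: 'v::finite \<Rightarrow> nat. prime_weights P"
proof -
  obtain T where T: "finite T" "card T = CARD('v)" "T \<subseteq> {p::nat. prime p}"
    using infinite_arbitrarily_large[OF primes_infinite] by blast
  then obtain P where P: "bij_betw P (UNIV :: 'v set) T"
    using finite_same_card_bij[of "UNIV :: 'v set" T] by auto
  then have "P v \<in> T" for v using bij_betwE by blast
  then show ?thesis using P T(3) by (intro exI[of _ P] prime_weights.intro) (auto simp: bij_betw_def)
qed

text \<open>The expansion of g is used at the point z whose coordinates are sums of two polyradii;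
  as primes are at least 2, these are small for large \<sigma>. Convergence there is absolute and z
  has nonnegative coordinates, so expanding the powers by the binomial theorem involves only
  nonnegative terms and yields exactly the weighted sum of \<open>line_coeff c\<close>.\<close>

lemma line_coeff_summable:
  fixes c :: "('n::finite \<Rightarrow> nat) \<Rightarrow> real" and a :: "real ^ 'n"
  assumes "prime_weights P" and e: "e > 0"
    and g: "\<And>x. x \<in> ball a e \<Longrightarrow> ((\<lambda>\<alpha>. c \<alpha> * (\<Prod>i\<in>UNIV. (x $ i - a $ i) ^ \<alpha> i)) has_sum g x) UNIV"
  shows "\<exists>\<sigma>. prime_weights.ps_summable P \<sigma> (line_coeff c)"
proof -
  interpret prime_weights P by fact
  have "(\<lambda>\<sigma>. real CARD('n) * (2 * (1 / 2) ^ \<sigma>)) \<longlonglongrightarrow> real CARD('n) * (2 * 0)"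
    by (intro tendsto_intros LIMSEQ_power_zero) simp
  then have "\<forall>\<^sub>F \<sigma> in sequentially. real CARD('n) * (2 * (1 / 2) ^ \<sigma>) < e"
    using e by (intro order_tendstoD) auto
  then obtain \<sigma> where \<sigma>: "real CARD('n) * (2 * (1 / 2) ^ \<sigma>) < e" unfolding eventually_sequentially by blast
  let ?U = "\<lambda>v. 1 / real (P v) ^ \<sigma>"
  define z :: "real ^ 'n" where "z = (\<chi> i. ?U (Inl i) + ?U (Inr i))"
  have U: "0 \<le> ?U v" "?U v \<le> (1 / 2) ^ \<sigma>" for v
    using prime_ge_2_nat[OF prime_P[of v]]
    by (auto simp: power_one_over intro!: divide_left_mono power_mono)
  have "norm z \<le> (\<Sum>i\<in>UNIV. \<bar>z $ i\<bar>)" by (rule norm_le_l1_cart)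
  also have "\<dots> \<le> (\<Sum>i\<in>(UNIV::'n set). 2 * (1 / 2) ^ \<sigma>)"
  proof (rule sum_mono)
    show "\<bar>z $ i\<bar> \<le> 2 * (1 / 2) ^ \<sigma>" for i
      using add_mono[OF U(2)[of "Inl i"] U(2)[of "Inr i"]] U(1)[of "Inl i"] U(1)[of "Inr i"]
      by (simp add: z_def)
  qed
  also have "\<dots> < e" using \<sigma> by simp
  finally have "a + z \<in> ball a e" by (simp add: dist_norm)
  from g[OF this] have "(\<lambda>\<gamma>. c \<gamma> * (\<Prod>i\<in>UNIV. (?U (Inl i) + ?U (Inr i)) ^ \<gamma> i)) summable_on UNIV"
    by (auto simp: z_def intro: has_sum_imp_summable)
  then have "(\<lambda>\<gamma>. \<bar>c \<gamma>\<bar> * (\<Prod>i\<in>UNIV. (?U (Inl i) + ?U (Inr i)) ^ \<gamma> i)) summable_on UNIV"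
    unfolding summable_on_iff_abs_summable_on_real[of "\<lambda>\<gamma>. c \<gamma> * _ \<gamma>"]
    using U(1) by (simp add: abs_mult abs_prod power_abs abs_of_nonneg)
  moreover have "case_sum (\<lambda>i. ?U (Inl i)) (\<lambda>i. ?U (Inr i)) = ?U"
    by (auto simp: fun_eq_iff split: sum.split)
  ultimately have "(\<lambda>\<alpha>. line_coeff (\<lambda>\<gamma>. \<bar>c \<gamma>\<bar>) \<alpha> * mono_pow ?U \<alpha>) summable_on UNIV"
    using summable_on_fibers[OF _ line_coeff_fiber[of "\<lambda>\<gamma>. \<bar>c \<gamma>\<bar>" "\<lambda>i. ?U (Inl i)" "\<lambda>i. ?U (Inr i)"]]
    by (simp add: weight_eq_mono_pow[symmetric] less_imp_le[OF weight_pos] line_coeff_abs[symmetric])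
  then show ?thesis
    unfolding ps_summable_def by (intro exI[of _ \<sigma>]) (simp add: weight_eq_mono_pow line_coeff_abs)
qed

text \<open>The largest of the first N coefficients dominates every coefficient with the constant C
  N. Which one it is depends on b, so \<eta> is the minimum of the radii for all
  \<open>i < N\<close>. If the first N coefficients vanish, so does the whole series. The bound 1/2
  keeps \<tau> inside the interval of convergence.\<close>

lemma few_pieces_power_series_family:
  assumes "C \<ge> 0"
  shows "\<exists>\<eta>>0. \<eta> < 1 \<and> (\<forall>b f. (\<forall>k. \<bar>b k\<bar> \<le> C * (\<Sum>i<N. \<bar>b i\<bar>)) \<longrightarrow>
    (\<forall>\<tau>. \<bar>\<tau>\<bar> < 1 \<longrightarrow> (\<lambda>k. b k * \<tau> ^ k) sums f \<tau>) \<longrightarrow>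
    few_pieces N {-\<eta><..<\<eta>} {\<tau>. f \<tau> < (0::real)})"
proof -
  define D where "D i \<eta> \<longleftrightarrow> (\<forall>a::nat \<Rightarrow> real. a i \<noteq> 0 \<longrightarrow> (\<forall>k. \<bar>a k\<bar> \<le> C * N * 1 ^ k * \<bar>a i\<bar>) \<longrightarrow>
    (\<forall>Z. finite Z \<longrightarrow> (\<forall>z\<in>Z. \<bar>z\<bar> < \<eta> \<and> (\<Sum>k. a k * z ^ k) = 0) \<longrightarrow> card Z \<le> i))" for i \<eta>
  have "\<exists>\<eta>>0. D i \<eta>" for i
    unfolding D_def by (rule dominated_power_series_zeros[of "C * real N" 1 i]) (use assms in auto)
  then obtain \<eta>i where \<eta>i: "\<And>i. \<eta>i i > 0" "\<And>i. D i (\<eta>i i)" by metis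
  define \<eta> where "\<eta> = Min (insert (1 / 2) (\<eta>i ` {..<N}))"
  have \<eta>0: "\<eta> > 0" unfolding \<eta>_def using \<eta>i(1) by (subst Min_gr_iff) auto
  have "\<eta> \<le> 1 / 2" unfolding \<eta>_def by (intro Min_le) auto
  then have \<eta>1: "\<eta> < 1" by simp
  have \<eta>_le: "\<eta> \<le> \<eta>i i" if "i < N" for i unfolding \<eta>_def using that by (intro Min_le) auto
  have "few_pieces N {-\<eta><..<\<eta>} {\<tau>. f \<tau> < 0}"
    if b: "\<And>k. \<bar>b k\<bar> \<le> C * (\<Sum>i<N. \<bar>b i\<bar>)" and f: "\<And>\<tau>. \<bar>\<tau>\<bar> < 1 \<Longrightarrow> (\<lambda>k. b k * \<tau> ^ k) sums f \<tau>" for b f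
  proof (cases "\<exists>i<N. b i \<noteq> 0")
    case False
    then have "b k = 0" for k using b[of k] by simp
    then have "f \<tau> = 0" if "\<bar>\<tau>\<bar> < 1" for \<tau> using f[OF that] by (simp add: sums_iff)
    then show ?thesis using \<eta>1 by (intro few_pieces_const[where b = False]) auto
  next
    case True
    define S where "S = (\<lambda>i. \<bar>b i\<bar>) ` {..<N}"
    have S: "finite S" "S \<noteq> {}" using True by (auto simp: S_def)
    then obtain i where i0: "i < N" "Max S = \<bar>b i\<bar>" using Max_in[OF S] unfolding S_def by fastforce
    have i: "i < N" "\<And>j. j < N \<Longrightarrow> \<bar>b j\<bar> \<le> \<bar>b i\<bar>"
      using i0 Max_ge[OF S(1)] unfolding i0(2)[symmetric] by (auto simp: S_def)
    have bi: "b i \<noteq> 0" using True i(2) by force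
    have "(\<Sum>i<N. \<bar>b i\<bar>) \<le> (\<Sum>j<N. \<bar>b i\<bar>)" by (intro sum_mono i) auto
    then have "C * (\<Sum>i<N. \<bar>b i\<bar>) \<le> C * (real N * \<bar>b i\<bar>)" using assms by (intro mult_left_mono) auto
    then have dom: "\<bar>b k\<bar> \<le> C * real N * 1 ^ k * \<bar>b i\<bar>" for k using b[of k] by (simp add: mult_ac)
    have fs: "f \<tau> = (\<Sum>k. b k * \<tau> ^ k)" if "\<bar>\<tau>\<bar> < 1" for \<tau> using f[OF that] by (simp add: sums_iff)
    have "continuous_on {-\<eta><..<\<eta>} (\<lambda>\<tau>. \<Sum>k. b k * \<tau> ^ k)"
    proof (rule DERIV_continuous_on)
      fix \<tau> assume "\<tau> \<in> {-\<eta><..<\<eta>}"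
      then show "((\<lambda>\<tau>. \<Sum>k. b k * \<tau> ^ k) has_real_derivative (\<Sum>k. diffs b k * \<tau> ^ k)) (at \<tau> within {-\<eta><..<\<eta>})"
        using dom \<eta>1 by (intro has_field_derivative_at_within[OF
            dominated_power_series_DERIV[where R = 1 and B = "C * real N * \<bar>b i\<bar>"]]) auto
    qed
    then have "continuous_on {-\<eta><..<\<eta>} f"
      by (rule continuous_on_eq) (use fs \<eta>1 in auto)
    then have "few_pieces i {-\<eta><..<\<eta>} {\<tau>. f \<tau> < 0}"
    proof (rule few_pieces_negative)
      fix Z assume Z: "finite Z" "Z \<subseteq> {\<tau> \<in> {-\<eta><..<\<eta>}. f \<tau> = 0}"
      have "\<bar>z\<bar> < \<eta>i i \<and> (\<Sum>k. b k * z ^ k) = 0" if "z \<in> Z" for z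
        using that Z(2) \<eta>_le[OF i(1)] \<eta>1 fs[of z] by auto
      then show "card Z \<le> i" using \<eta>i(2)[of i] bi dom Z(1) unfolding D_def by blast
    qed
    then show ?thesis using i(1) by (elim few_pieces_mono) auto
  qed
  note key = this
  show ?thesis by (intro exI[of _ \<eta>] conjI allI impI, rule \<eta>0, rule \<eta>1, rule key) auto
qed

text \<open>A line meeting the small ball is reparametrised with base point p near a and direction w
  of fixed length, so that (p, w) ranges over a polydisc on which one domination inequality holds.
  This is what makes N and \<epsilon> independent of the line.\<close>

lemma few_pieces_analytic_local:
  fixes g :: "real ^ 'n \<Rightarrow> real"
  assumes g: "real_analytic_on W g" and a: "a \<in> W"
  shows "\<exists>\<epsilon>>0. \<exists>N. \<forall>x y. few_pieces N {s. x + s *\<^sub>R y \<in> ball a \<epsilon>} {s. g (x + s *\<^sub>R y) < 0}"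
proof -
  obtain c e where e: "e > 0" and ce: "\<forall>x\<in>ball a e.
      ((\<lambda>\<alpha>. c \<alpha> * (\<Prod>i\<in>UNIV. (x $ i - a $ i) ^ \<alpha> i)) has_sum g x) UNIV"
    using bspec[OF g[unfolded real_analytic_on_def] a] by (elim exE conjE)
  have c: "\<And>x. x \<in> ball a e \<Longrightarrow>
      ((\<lambda>\<alpha>. c \<alpha> * (\<Prod>i\<in>UNIV. (x $ i - a $ i) ^ \<alpha> i)) has_sum g x) UNIV"
    by (rule bspec[OF ce])
  obtain P :: "'n + 'n \<Rightarrow> nat" where P: "prime_weights P" using ex_prime_weights by blast
  interpret prime_weights P by fact
  obtain \<sigma>0 where \<sigma>0: "ps_summable \<sigma>0 (line_coeff c)" using line_coeff_summable[OF P e c] by blast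
  have lt: "\<bar>line_taylor c k \<alpha>\<bar> \<le> \<bar>line_coeff c \<alpha>\<bar>" for k \<alpha> by (simp add: line_taylor_def)
  have sum: "ps_summable \<sigma> (line_taylor c k)" if "\<sigma> \<ge> \<sigma>0" for k \<sigma>
    using ps_summable_mono[OF \<sigma>0 that] unfolding ps_summable_def
    by (rule summable_on_comparison_test) (auto intro!: mult_right_mono lt less_imp_le[OF weight_pos] simp: less_imp_le[OF weight_pos])
  obtain N \<sigma> K where \<sigma>: "\<sigma> \<ge> \<sigma>0" and K: "K \<ge> 0" "\<forall>k. \<forall>u\<in>polydisc (Suc \<sigma>).
      \<bar>ps_eval (line_taylor c k) u\<bar> \<le> K * ps_norm \<sigma> (line_taylor c k) * (\<Sum>i<N. \<bar>ps_eval (line_taylor c i) u\<bar>)"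
    using ps_family_dominated[of \<sigma>0 "line_taylor c", OF sum[OF order.refl]] by (elim exE conjE)
  \<comment> \<open>Each \<open>line_taylor c k\<close> is a part of \<open>line_coeff c\<close>, so
    its norm is bounded independently of k.\<close>
  define M where "M = K * ps_norm \<sigma> (line_coeff c)"
  have M0: "M \<ge> 0" unfolding M_def using K(1) ps_norm_nonneg by simp
  have dom: "\<bar>ps_eval (line_taylor c k) u\<bar> \<le> M * (\<Sum>i<N. \<bar>ps_eval (line_taylor c i) u\<bar>)"
    if "u \<in> polydisc (Suc \<sigma>)" for k u
  proof -
    have "ps_norm \<sigma> (line_taylor c k) \<le> ps_norm \<sigma> (line_coeff c)"
      using \<sigma> by (intro ps_norm_mono sum ps_summable_mono[OF \<sigma>0] lt)
    then have "K * ps_norm \<sigma> (line_taylor c k) * (\<Sum>i<N. \<bar>ps_eval (line_taylor c i) u\<bar>) \<le>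
        M * (\<Sum>i<N. \<bar>ps_eval (line_taylor c i) u\<bar>)"
      unfolding M_def using K(1) by (intro mult_right_mono mult_left_mono sum_nonneg) auto
    then show ?thesis using bspec[OF spec[OF K(2)] that, of k] by linarith
  qed
  obtain \<eta> where \<eta>: "\<eta> > 0" "\<eta> < 1" "\<forall>b f. (\<forall>k. \<bar>b k\<bar> \<le> M * (\<Sum>i<N. \<bar>b i\<bar>)) \<longrightarrow>
      (\<forall>\<tau>. \<bar>\<tau>\<bar> < 1 \<longrightarrow> (\<lambda>k. b k * \<tau> ^ k) sums f \<tau>) \<longrightarrow> few_pieces N {-\<eta><..<\<eta>} {\<tau>. f \<tau> < (0::real)}"
    using few_pieces_power_series_family[OF M0, of N] by (elim exE conjE)
  \<comment> \<open>The half of e is for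
    \<open>norm p + \<bar>\<tau>\<bar> * norm w < 2 * \<theta> \<le> e\<close>; the other bounds put
    the coordinates of p and w into the polydisc.\<close>
  define \<theta> where "\<theta> = Min (insert (e / 2) (range (\<lambda>v. 1 / real (P v) ^ Suc \<sigma>)))"
  have \<theta>0: "\<theta> > 0" unfolding \<theta>_def using e prime_gt_0_nat[OF prime_P] by (subst Min_gr_iff) auto
  have \<theta>e: "\<theta> \<le> e / 2" unfolding \<theta>_def by (intro Min_le) auto
  have \<theta>P: "\<theta> \<le> 1 / real (P v) ^ Suc \<sigma>" for v unfolding \<theta>_def by (intro Min_le) auto
  \<comment> \<open>Two points of the ball are less than
    \<open>2 * \<epsilon> = \<theta> * \<eta>\<close> apart. Measured in units of
    \<open>norm w = \<theta>\<close>, the line therefore stays in the ball only for parameters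
    within \<eta> of the base point.\<close>
  define \<epsilon> where "\<epsilon> = \<theta> * \<eta> / 2"
  have \<epsilon>: "\<epsilon> > 0" "\<epsilon> \<le> \<theta>" unfolding \<epsilon>_def using \<theta>0 \<eta>(1,2) by (auto simp: field_simps)
  have "few_pieces N {s. x + s *\<^sub>R y \<in> ball a \<epsilon>} {s. g (x + s *\<^sub>R y) < 0}" for x y
  proof (cases "y = 0 \<or> {s. x + s *\<^sub>R y \<in> ball a \<epsilon>} = {}")
    case True
    then show ?thesis by (intro few_pieces_const[where b = "g x < 0"]) auto
  next
    case False
    then have y: "norm y > 0" by simp
    obtain s0 where s0: "x + s0 *\<^sub>R y \<in> ball a \<epsilon>" using False by blast
    define p where "p = x + s0 *\<^sub>R y - a"
    define \<beta> where "\<beta> = \<theta> / norm y"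
    define w where "w = \<beta> *\<^sub>R y"
    have \<beta>: "\<beta> > 0" unfolding \<beta>_def using y \<theta>0 by simp
    have norms: "norm p < \<epsilon>" "norm w = \<theta>"
      using s0 y \<theta>0 by (auto simp: p_def w_def \<beta>_def dist_norm norm_minus_commute)
    define u where "u = case_sum (\<lambda>i. p $ i) (\<lambda>i. w $ i)"
    have "\<bar>p $ i\<bar> \<le> \<theta>" "\<bar>w $ i\<bar> \<le> \<theta>" for i
      using component_le_norm_cart[of p i] component_le_norm_cart[of w i] norms \<epsilon>(2) by auto
    then have u: "u \<in> polydisc (Suc \<sigma>)"
      unfolding polydisc_def u_def using \<theta>P by (auto split: sum.split intro: order.trans)
    have "few_pieces N {-\<eta><..<\<eta>} {\<tau>. g (a + p + \<tau> *\<^sub>R w) < 0}"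
    proof (rule \<eta>(3)[rule_format])
      show "\<bar>ps_eval (line_taylor c k) u\<bar> \<le> M * (\<Sum>i<N. \<bar>ps_eval (line_taylor c i) u\<bar>)" for k
        using u by (rule dom)
      fix \<tau> :: real assume \<tau>: "\<bar>\<tau>\<bar> < 1"
      have "norm (- p - \<tau> *\<^sub>R w) \<le> norm p + \<bar>\<tau>\<bar> * norm w" using norm_triangle_ineq4[of "- p" "\<tau> *\<^sub>R w"] by simp
      also have "\<dots> < \<theta> + 1 * \<theta>" using norms \<epsilon>(2) \<tau> \<theta>0
        by (intro add_less_le_mono mult_mono) auto
      finally have "a + p + \<tau> *\<^sub>R w \<in> ball a e" using \<theta>e by (simp add: dist_norm add.assoc)
      from c[OF this] have "((\<lambda>\<alpha>. c \<alpha> * (\<Prod>i\<in>UNIV. (p $ i + \<tau> * w $ i) ^ \<alpha> i)) has_sum g (a + p + \<tau> *\<^sub>R w)) UNIV"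
        by (simp add: algebra_simps)
      then show "(\<lambda>k. ps_eval (line_taylor c k) u * \<tau> ^ k) sums g (a + p + \<tau> *\<^sub>R w)"
        unfolding u_def using \<tau> polydisc_antimono[of \<sigma> "Suc \<sigma>"] u[unfolded u_def]
        by (intro line_taylor_expansion[OF P ps_summable_mono[OF \<sigma>0 \<sigma>]]) auto
    qed
    from few_pieces_affine[OF this, of \<beta> s0] \<beta>
    have "few_pieces N {s. (s - s0) / \<beta> \<in> {-\<eta><..<\<eta>}} {s. g (a + p + ((s - s0) / \<beta>) *\<^sub>R w) < 0}" by simp
    moreover have "a + p + ((s - s0) / \<beta>) *\<^sub>R w = x + s *\<^sub>R y" for s
    proof -
      have "((s - s0) / \<beta>) *\<^sub>R w = s *\<^sub>R y - s0 *\<^sub>R y"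
        using \<beta> by (simp add: w_def flip: scaleR_diff_left)
      then show ?thesis by (simp add: p_def)
    qed
    moreover have "(s - s0) / \<beta> \<in> {-\<eta><..<\<eta>}" if "x + s *\<^sub>R y \<in> ball a \<epsilon>" for s
    proof -
      have "\<bar>s - s0\<bar> * norm y = dist (x + s *\<^sub>R y) (x + s0 *\<^sub>R y)"
        by (simp add: dist_norm flip: norm_scaleR scaleR_diff_left)
      also have "\<dots> < 2 * \<epsilon>" using that s0 by (metis dist_commute dist_triangle_less_add mem_ball mult_2)
      finally have "\<bar>s - s0\<bar> * norm y < \<theta> * \<eta>" by (simp add: \<epsilon>_def)
      then have "\<bar>(s - s0) / \<beta>\<bar> < \<eta>" using y \<theta>0 by (simp add: \<beta>_def abs_mult pos_divide_less_eq mult_ac)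
      then show ?thesis by (simp only: abs_less_iff greaterThanLessThan_iff minus_less_iff)
    qed
    ultimately show ?thesis by (auto elim!: few_pieces_mono)
  qed
  then show ?thesis using \<epsilon>(1) by blast
qed

theorem few_pieces_analytic:
  fixes g :: "real ^ 'n \<Rightarrow> real"
  assumes g: "real_analytic_on W g" and W: "cball 0 r \<subseteq> W"
  shows "\<exists>N. \<forall>x y. few_pieces N {s. x + s *\<^sub>R y \<in> cball 0 r} {s. g (x + s *\<^sub>R y) < 0}"
proof -
  have "\<forall>a\<in>cball 0 r. \<exists>\<epsilon> N. \<epsilon> > 0 \<and> (\<forall>x y. few_pieces N {s. x + s *\<^sub>R y \<in> ball a \<epsilon>} {s. g (x + s *\<^sub>R y) < 0})"
    using few_pieces_analytic_local[OF g] W by blast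
  then obtain \<epsilon> N where \<epsilon>: "\<And>a. a \<in> cball 0 r \<Longrightarrow> \<epsilon> a > 0"
    and N: "\<And>a x y. a \<in> cball 0 r \<Longrightarrow> few_pieces (N a) {s. x + s *\<^sub>R y \<in> ball a (\<epsilon> a)} {s. g (x + s *\<^sub>R y) < 0}"
    by metis
  obtain L where L: "L \<subseteq> cball 0 r" "finite L" "cball 0 r \<subseteq> (\<Union>a\<in>L. ball a (\<epsilon> a))"
    using compactE_image[OF compact_cball[of 0 r], of "cball 0 r" "\<lambda>a. ball a (\<epsilon> a)"] \<epsilon>
    by (metis (no_types, lifting) UN_I centre_in_ball open_ball subsetI)
  have "few_pieces (\<Sum>a\<in>L. N a + 2) {s. x + s *\<^sub>R y \<in> cball 0 r} {s. g (x + s *\<^sub>R y) < 0}" for x y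
  proof (cases "y = 0")
    case True
    then show ?thesis by (intro few_pieces_const[where b = "g x < 0"]) auto
  next
    case False
    show ?thesis
    proof (rule few_pieces_cover[where I = "\<lambda>a. {s. x + s *\<^sub>R y \<in> ball a (\<epsilon> a)}"])
      show "few_pieces (N a) {s. x + s *\<^sub>R y \<in> ball a (\<epsilon> a)} {s. g (x + s *\<^sub>R y) < 0}" if "a \<in> L" for a
        using that L N by blast
      show "convex {s. x + s *\<^sub>R y \<in> ball a (\<epsilon> a)}" for a
      proof (rule convexI)
        fix s t u v :: real assume *: "s \<in> {s. x + s *\<^sub>R y \<in> ball a (\<epsilon> a)}" "t \<in> {s. x + s *\<^sub>R y \<in> ball a (\<epsilon> a)}"
          "0 \<le> u" "0 \<le> v" "u + v = 1"
        have "u *\<^sub>R (x + s *\<^sub>R y) + v *\<^sub>R (x + t *\<^sub>R y) \<in> ball a (\<epsilon> a)"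
          using * convexD[OF convex_ball] by blast
        moreover have "u *\<^sub>R (x + s *\<^sub>R y) + v *\<^sub>R (x + t *\<^sub>R y) = (u + v) *\<^sub>R x + (u *\<^sub>R s + v *\<^sub>R t) *\<^sub>R y"
          by (simp add: algebra_simps)
        ultimately show "u *\<^sub>R s + v *\<^sub>R t \<in> {s. x + s *\<^sub>R y \<in> ball a (\<epsilon> a)}" using *(5) by simp
      qed
      show "bounded {s. x + s *\<^sub>R y \<in> ball a (\<epsilon> a)}" for a
      proof (rule boundedI)
        fix s assume "s \<in> {s. x + s *\<^sub>R y \<in> ball a (\<epsilon> a)}"
        then have "norm (x + s *\<^sub>R y - a) < \<epsilon> a" by (simp add: dist_norm norm_minus_commute)
        moreover have "s *\<^sub>R y = (x + s *\<^sub>R y - a) + (a - x)" by simp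
        ultimately have "\<bar>s\<bar> * norm y \<le> \<epsilon> a + norm (a - x)"
          by (metis add_mono less_imp_le norm_scaleR norm_triangle_le order.refl)
        then show "norm s \<le> (\<epsilon> a + norm (a - x)) / norm y" using False by (simp add: field_simps)
      qed
      show "{s. x + s *\<^sub>R y \<in> cball 0 r} \<subseteq> (\<Union>a\<in>L. {s. x + s *\<^sub>R y \<in> ball a (\<epsilon> a)})"
        using L(3) by blast
    qed (rule L)
  qed
  then show ?thesis by blast
qed

section \<open>Oscillatory integrals along segments\<close>

text \<open>Integration by parts against \<open>\<psi> / F'\<close>. As \<open>F''\<close> has a
  sign, the integral of \<open>F'' / F'^2\<close> is a difference of values of \<open>1 / F'\<close>
  and at most \<open>1 / \<kappa>\<close>, so the size of \<open>F''\<close> does not enter the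
  bound. Of the three copies of M, two come from the boundary terms and one from this
  integral.\<close>

lemma van_der_corput_first_derivative:
  fixes F F' F'' \<psi> \<psi>' :: "real \<Rightarrow> real"
  assumes "\<alpha> \<le> \<beta>" and t: "t \<noteq> 0" and \<kappa>: "\<kappa> > 0"
    and F: "\<And>s. s \<in> {\<alpha>..\<beta>} \<Longrightarrow> (F has_real_derivative F' s) (at s within {\<alpha>..\<beta>})"
    and F': "\<And>s. s \<in> {\<alpha>..\<beta>} \<Longrightarrow> (F' has_real_derivative F'' s) (at s within {\<alpha>..\<beta>})"
    and \<psi>: "\<And>s. s \<in> {\<alpha>..\<beta>} \<Longrightarrow> (\<psi> has_real_derivative \<psi>' s) (at s within {\<alpha>..\<beta>})"
    and cont: "continuous_on {\<alpha>..\<beta>} F''" "continuous_on {\<alpha>..\<beta>} \<psi>'"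
    and F'_ge: "\<And>s. s \<in> {\<alpha>..\<beta>} \<Longrightarrow> F' s \<ge> \<kappa>" and F''_ge: "\<And>s. s \<in> {\<alpha>..\<beta>} \<Longrightarrow> F'' s \<ge> 0"
    and M: "\<And>s. s \<in> {\<alpha>..\<beta>} \<Longrightarrow> \<bar>\<psi> s\<bar> \<le> M" and M': "\<And>s. s \<in> {\<alpha>..\<beta>} \<Longrightarrow> \<bar>\<psi>' s\<bar> \<le> M'"
  shows "norm (integral {\<alpha>..\<beta>} (\<lambda>s. exp (- \<i> * of_real (t * F s)) * of_real (\<psi> s)))
    \<le> (3 * M + M' * (\<beta> - \<alpha>)) / (\<bar>t\<bar> * \<kappa>)"
proof -
  let ?I = "{\<alpha>..\<beta>}"
  define E where "E s = exp (- \<i> * of_real (t * F s))" for s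
  define Q where "Q s = \<psi> s / F' s" for s
  define Q' where "Q' s = \<psi>' s / F' s - \<psi> s * F'' s / (F' s)\<^sup>2" for s
  have pos: "F' s > 0" if "s \<in> ?I" for s using F'_ge[OF that] \<kappa> by linarith
  have M0: "M \<ge> 0" using M[of \<alpha>] assms(1) by auto
  have M'0: "M' \<ge> 0" using M'[of \<alpha>] assms(1) by auto
  have Q: "(Q has_real_derivative Q' s) (at s within ?I)" if "s \<in> ?I" for s
    unfolding Q_def Q'_def using pos[OF that]
    by (auto intro!: derivative_eq_intros \<psi> F' that simp: field_simps power2_eq_square)
  have E: "(E has_vector_derivative (- \<i> * of_real (t * F' s) * E s)) (at s within ?I)" if "s \<in> ?I" for s
  proof -
    have "((\<lambda>s. - \<i> * complex_of_real (t * F s)) has_vector_derivative (- \<i> * of_real (t * F' s))) (at s within ?I)"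
      by (intro has_vector_derivative_mult_right has_vector_derivative_of_real DERIV_cmult F that)
    from field_vector_diff_chain_within[OF this DERIV_subset[OF DERIV_exp]]
    show ?thesis by (simp add: E_def[abs_def] comp_def)
  qed
  have contF: "continuous_on ?I F" "continuous_on ?I F'" "continuous_on ?I \<psi>"
    by (rule DERIV_continuous_on, erule F F' \<psi>)+
  have contE: "continuous_on ?I E" unfolding E_def by (intro continuous_intros contF)
  have contQ': "continuous_on ?I Q'" unfolding Q'_def using pos
    by (intro continuous_intros contF cont) (auto simp: less_imp_neq[symmetric])
  \<comment> \<open>From \<open>E' = - \<i> * t * F' * E\<close> follows
    \<open>E * \<psi> = (\<i> / t) * E' * Q\<close>, so G is the boundary term of the integration by
    parts.\<close>
  define G where "G s = (\<i> / of_real t) * (E s * of_real (Q s))" for s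
  have "(G has_vector_derivative (E s * of_real (\<psi> s) + (\<i> / of_real t) * (E s * of_real (Q' s)))) (at s within ?I)"
    if s: "s \<in> ?I" for s
  proof -
    have "(G has_vector_derivative ((\<i> / of_real t) * (E s * of_real (Q' s) + (- \<i> * of_real (t * F' s) * E s) * of_real (Q s)))) (at s within ?I)"
      unfolding G_def
      by (intro has_vector_derivative_mult_right has_vector_derivative_mult has_vector_derivative_of_real Q E s)
    moreover have "(\<i> / of_real t) * ((- \<i> * of_real (t * F' s) * E s) * of_real (Q s)) = E s * of_real (\<psi> s)"
      using t pos[OF s] by (simp add: Q_def field_simps)
    ultimately show ?thesis by (simp only: distrib_left add.commute)
  qed
  then have FTC: "((\<lambda>s. E s * of_real (\<psi> s) + (\<i> / of_real t) * (E s * of_real (Q' s))) has_integral (G \<beta> - G \<alpha>)) ?I"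
    by (rule fundamental_theorem_of_calculus[OF assms(1)])
  have int: "(\<lambda>s. (\<i> / of_real t) * (E s * of_real (Q' s))) integrable_on ?I"
    by (intro integrable_continuous_interval continuous_intros contE contQ')
  have "((\<lambda>s. E s * of_real (\<psi> s)) has_integral
      (G \<beta> - G \<alpha> - integral ?I (\<lambda>s. (\<i> / of_real t) * (E s * of_real (Q' s))))) ?I"
    using has_integral_diff[OF FTC integrable_integral[OF int]] by simp
  then have eq: "integral ?I (\<lambda>s. E s * of_real (\<psi> s)) =
      G \<beta> - G \<alpha> - integral ?I (\<lambda>s. (\<i> / of_real t) * (E s * of_real (Q' s)))"
    by (rule integral_unique)
  have normE: "norm (E s) = 1" for s unfolding E_def by (simp add: norm_exp_eq_Re)
  have G_le: "norm (G s) \<le> M / (\<bar>t\<bar> * \<kappa>)" if s: "s \<in> ?I" for s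
  proof -
    have "\<bar>\<psi> s\<bar> / F' s \<le> M / \<kappa>" using M[OF s] F'_ge[OF s] \<kappa> M0 by (intro frac_le) auto
    then have "(1 / \<bar>t\<bar>) * (\<bar>\<psi> s\<bar> / F' s) \<le> (1 / \<bar>t\<bar>) * (M / \<kappa>)" by (intro mult_left_mono) auto
    then show ?thesis using pos[OF s] by (simp add: G_def norm_mult normE norm_divide Q_def)
  qed
  define B where "B s = (1 / \<bar>t\<bar>) * (M' / \<kappa> + M * (F'' s / (F' s)\<^sup>2))" for s
  have B: "(B has_integral ((1 / \<bar>t\<bar>) * (M' / \<kappa> * \<beta> - M / F' \<beta>) - (1 / \<bar>t\<bar>) * (M' / \<kappa> * \<alpha> - M / F' \<alpha>))) ?I"
  proof (rule fundamental_theorem_of_calculus[OF assms(1)])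
    fix s assume s: "s \<in> ?I"
    show "((\<lambda>s. (1 / \<bar>t\<bar>) * (M' / \<kappa> * s - M / F' s)) has_vector_derivative B s) (at s within ?I)"
      unfolding B_def
    proof (rule has_vector_derivative_mult_right)
      show "((\<lambda>s. M' / \<kappa> * s - M / F' s) has_vector_derivative M' / \<kappa> + M * (F'' s / (F' s)\<^sup>2)) (at s within ?I)"
        unfolding has_real_derivative_iff_has_vector_derivative[symmetric]
        using pos[OF s] \<kappa> by (auto intro!: derivative_eq_intros F' s simp: power2_eq_square)
    qed
  qed
  have "norm (integral ?I (\<lambda>s. (\<i> / of_real t) * (E s * of_real (Q' s)))) \<le> integral ?I B"
  proof (rule Henstock_Kurzweil_Integration.integral_norm_bound_integral[OF int])
    show "B integrable_on ?I" using B by blast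
    fix s assume s: "s \<in> ?I"
    have "\<bar>\<psi>' s / F' s\<bar> \<le> M' / \<kappa>" using M'[OF s] F'_ge[OF s] \<kappa> M'0 by (auto simp: abs_divide intro!: frac_le)
    moreover have "\<bar>\<psi> s\<bar> * (F'' s / (F' s)\<^sup>2) \<le> M * (F'' s / (F' s)\<^sup>2)"
      using M[OF s] F''_ge[OF s] by (intro mult_right_mono) auto
    then have "\<bar>\<psi> s * F'' s / (F' s)\<^sup>2\<bar> \<le> M * (F'' s / (F' s)\<^sup>2)"
      using F''_ge[OF s] by (simp add: abs_mult abs_divide)
    ultimately have "\<bar>Q' s\<bar> \<le> M' / \<kappa> + M * (F'' s / (F' s)\<^sup>2)" unfolding Q'_def by linarith
    then have "(1 / \<bar>t\<bar>) * \<bar>Q' s\<bar> \<le> B s" unfolding B_def by (intro mult_left_mono) auto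
    then show "norm ((\<i> / of_real t) * (E s * of_real (Q' s))) \<le> B s"
      by (simp add: norm_mult normE norm_divide)
  qed
  also have "integral ?I B = (1 / \<bar>t\<bar>) * (M' / \<kappa> * (\<beta> - \<alpha>) + M / F' \<alpha> - M / F' \<beta>)"
    unfolding integral_unique[OF B] by (simp only: right_diff_distrib distrib_left)
  also have "\<dots> \<le> (1 / \<bar>t\<bar>) * (M' / \<kappa> * (\<beta> - \<alpha>) + M / \<kappa>)"
  proof (intro mult_left_mono)
    have "M / F' \<alpha> \<le> M / \<kappa>" using F'_ge[of \<alpha>] \<kappa> M0 assms(1) by (intro frac_le) auto
    moreover have "M / F' \<beta> \<ge> 0" using pos[of \<beta>] M0 assms(1) by auto
    ultimately show "M' / \<kappa> * (\<beta> - \<alpha>) + M / F' \<alpha> - M / F' \<beta> \<le> M' / \<kappa> * (\<beta> - \<alpha>) + M / \<kappa>" by linarith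
  qed simp
  also have "\<dots> = (M' * (\<beta> - \<alpha>) + M) / (\<bar>t\<bar> * \<kappa>)" using t \<kappa> by (simp add: field_simps)
  finally have R: "norm (integral ?I (\<lambda>s. (\<i> / of_real t) * (E s * of_real (Q' s)))) \<le> (M' * (\<beta> - \<alpha>) + M) / (\<bar>t\<bar> * \<kappa>)" .
  have "norm (integral ?I (\<lambda>s. E s * of_real (\<psi> s))) \<le>
      norm (G \<beta>) + norm (G \<alpha>) + norm (integral ?I (\<lambda>s. (\<i> / of_real t) * (E s * of_real (Q' s))))"
    unfolding eq using norm_triangle_ineq4[of "G \<beta>" "G \<alpha>"]
      norm_triangle_ineq4[of "G \<beta> - G \<alpha>" "integral ?I (\<lambda>s. (\<i> / of_real t) * (E s * of_real (Q' s)))"]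
    by linarith
  also have "\<dots> \<le> M / (\<bar>t\<bar> * \<kappa>) + M / (\<bar>t\<bar> * \<kappa>) + (M' * (\<beta> - \<alpha>) + M) / (\<bar>t\<bar> * \<kappa>)"
    using assms(1) by (intro add_mono G_le R) auto
  also have "\<dots> = (3 * M + M' * (\<beta> - \<alpha>)) / (\<bar>t\<bar> * \<kappa>)" by (simp flip: add_divide_distrib)
  finally show ?thesis unfolding E_def .
qed

text \<open>Splitting at an interior break point c leaves the remaining ones to the left and right
  pieces, hence one more interval than break points. Without interior break points the open interval
  lies in Q, where B applies, or misses Q, where u vanishes up to the end points.\<close>

lemma integral_few_pieces_bound:
  fixes u :: "real \<Rightarrow> complex"
  assumes "finite T" "a \<le> b" and u: "u integrable_on {a..b}" "\<And>s. s \<notin> Q \<Longrightarrow> u s = 0"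
    and T: "\<And>J. convex J \<Longrightarrow> J \<subseteq> {a<..<b} \<Longrightarrow> J \<inter> T = {} \<Longrightarrow> J \<subseteq> Q \<or> J \<inter> Q = {}"
    and B: "\<And>\<alpha> \<beta>. a \<le> \<alpha> \<Longrightarrow> \<alpha> \<le> \<beta> \<Longrightarrow> \<beta> \<le> b \<Longrightarrow> {\<alpha><..<\<beta>} \<subseteq> Q \<Longrightarrow> norm (integral {\<alpha>..\<beta>} u) \<le> B"
  shows "norm (integral {a..b} u) \<le> (real (card T) + 1) * B"
  using assms
proof (induction "card T" arbitrary: T a b rule: less_induct)
  case less
  \<comment> \<open>The degenerate interval satisfies the assumption on B vacuously, which yields
    that B is nonnegative.\<close>
  have "norm (integral {a..a} u) \<le> B" using less.prems(2) by (intro less.prems(6)) auto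
  then have B0: "B \<ge> 0" by simp
  show ?case
  proof (cases "T \<inter> {a<..<b} = {}")
    case True
    then consider "{a<..<b} \<subseteq> Q" | "{a<..<b} \<inter> Q = {}" using less.prems(5)[of "{a<..<b}"] by auto
    then have "norm (integral {a..b} u) \<le> B"
    proof cases
      case 1
      then show ?thesis using less.prems(2) by (intro less.prems(6)) auto
    next
      case 2
      have "u s = 0" if "s \<in> {a..b} - {a, b}" for s
      proof -
        have "s \<in> {a<..<b}" using that by auto
        then show ?thesis using 2 less.prems(4) by blast
      qed
      then have "integral {a..b} u = integral {a..b} (\<lambda>_. 0)"
        by (intro integral_spike[where S = "{a, b}"]) auto
      then show ?thesis using B0 by simp
    qed
    then show ?thesis using B0 by (simp add: distrib_right add_increasing)
  next
    case False
    then obtain c where c: "c \<in> T" "a < c" "c < b" by auto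
    let ?L = "{s\<in>T. s < c}" and ?R = "{s\<in>T. s > c}"
    have "T = insert c (?L \<union> ?R)" using c(1) by auto
    then have "card T = card (insert c (?L \<union> ?R))" by simp
    also have "\<dots> = Suc (card ?L + card ?R)"
      using less.prems(1) by (subst card_insert_disjoint) (auto intro!: card_Un_disjoint)
    finally have card: "card T = Suc (card ?L + card ?R)" .
    have "norm (integral {a..c} u) \<le> (real (card ?L) + 1) * B"
    proof (rule less.hyps)
      show "u integrable_on {a..c}" by (rule integrable_subinterval_real[OF less.prems(3)]) (use c in auto)
      show "J \<subseteq> Q \<or> J \<inter> Q = {}" if "convex J" "J \<subseteq> {a<..<c}" "J \<inter> ?L = {}" for J
        using that c by (intro less.prems(5)) force+
    qed (use less.prems c card in auto)
    moreover have "norm (integral {c..b} u) \<le> (real (card ?R) + 1) * B"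
    proof (rule less.hyps)
      show "u integrable_on {c..b}" by (rule integrable_subinterval_real[OF less.prems(3)]) (use c in auto)
      show "J \<subseteq> Q \<or> J \<inter> Q = {}" if "convex J" "J \<subseteq> {c<..<b}" "J \<inter> ?R = {}" for J
        using that c by (intro less.prems(5)) force+
    qed (use less.prems c card in auto)
    moreover have "integral {a..b} u = integral {a..c} u + integral {c..b} u"
      using c less.prems(3) by (simp add: Henstock_Kurzweil_Integration.integral_combine)
    ultimately have "norm (integral {a..b} u) \<le> (real (card ?L) + 1) * B + (real (card ?R) + 1) * B"
      by (simp only: norm_triangle_mono)
    also have "\<dots> = (real (card T) + 1) * B" unfolding card by (simp add: algebra_simps)
    finally show ?thesis .
  qed
qed

lemma has_vector_derivative_along_line:
  assumes "(h has_derivative D) (at (x + s *\<^sub>R y))"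
  shows "((\<lambda>s. h (x + s *\<^sub>R y)) has_vector_derivative D y) (at s)"
proof -
  have "((\<lambda>s. x + s *\<^sub>R y) has_derivative (\<lambda>h. h *\<^sub>R y)) (at s)"
    by (auto intro!: derivative_eq_intros)
  from has_derivative_compose[OF this assms]
  show ?thesis using linear_scale[OF has_derivative_linear[OF assms]] by (simp add: has_vector_derivative_def)
qed

text \<open>The tangent at s, evaluated at 0, gives \<open>s * q' s \<ge> q s - q 0\<close>.
  Convexity between 0 and s, with \<open>q 0 \<le> q s\<close>, gives
  \<open>q (1/2) \<le> q s\<close>. Finally \<open>s \<le> 1\<close> and \<open>q' s \<ge> 0\<close>
  allow the factor s to be dropped.\<close>

lemma convex_ray_derivatives:
  fixes q q' q'' :: "real \<Rightarrow> real"
  assumes A: "open A" "convex_on A q"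
    and q: "\<And>s. s \<in> A \<Longrightarrow> (q has_real_derivative q' s) (at s)"
    and q': "\<And>s. s \<in> A \<Longrightarrow> (q' has_real_derivative q'' s) (at s)"
  shows "s \<in> A \<Longrightarrow> q'' s \<ge> 0"
    and "0 \<in> A \<Longrightarrow> s \<in> A \<Longrightarrow> 1 / 2 \<le> s \<Longrightarrow> s \<le> 1 \<Longrightarrow> q 0 \<le> q s \<Longrightarrow> q 0 < q (1 / 2) \<Longrightarrow>
      q' s \<ge> q (1 / 2) - q 0"
proof -
  have tangent: "q x - q c \<ge> q' c * (x - c)" if "c \<in> A" "x \<in> A" for x c
    using that A by (intro convex_on_imp_above_tangent[of A] has_field_derivative_at_within[OF q])
      (auto simp: interior_open convex_on_imp_convex convex_connected)
  have "mono_on A q'"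
  proof (rule mono_onI)
    fix x c assume *: "x \<in> A" "c \<in> A" "x \<le> c"
    have "(q' c - q' x) * (c - x) \<ge> 0" using tangent[OF *(1,2)] tangent[OF *(2,1)] by (simp add: algebra_simps)
    then show "q' x \<le> q' c" using *(3) by (cases "x = c") (auto simp: zero_le_mult_iff)
  qed
  then show "q'' s \<ge> 0" if "s \<in> A"
    using mono_on_imp_deriv_nonneg[OF _ q'[OF that]] that A(1) by (simp add: interior_open)
  assume s: "0 \<in> A" "s \<in> A" "1 / 2 \<le> s" "s \<le> 1" "q 0 \<le> q s" "q 0 < q (1 / 2)"
  define \<theta> where "\<theta> = 1 / (2 * s)"
  have \<theta>: "0 \<le> \<theta>" "\<theta> \<le> 1" "\<theta> * s = 1 / 2" using s by (auto simp: \<theta>_def)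
  have "q ((1 - \<theta>) *\<^sub>R 0 + \<theta> *\<^sub>R s) \<le> (1 - \<theta>) * q 0 + \<theta> * q s"
    using \<theta> s by (intro convex_onD[OF A(2)]) auto
  also have "\<dots> \<le> (1 - \<theta>) * q s + \<theta> * q s" using \<theta> s by (intro add_mono mult_left_mono) auto
  finally have half: "q (1 / 2) \<le> q s" using \<theta>(3) by (simp add: algebra_simps)
  have "q' s * s \<ge> q s - q 0" using tangent[OF s(2,1)] by simp
  then have *: "q' s * s \<ge> q (1 / 2) - q 0" using half by linarith
  then have "q' s * s > 0" using s by linarith
  then have "q' s \<ge> 0" using s by (auto simp: zero_less_mult_iff)
  then have "q' s * s \<le> q' s * 1" using s by (intro mult_left_mono) auto
  then show "q' s \<ge> q (1 / 2) - q 0" using * by linarith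
qed

text \<open>The factor \<open>s ^ m\<close> will be the Jacobian of a dilation. The constant 4 r
  bounds \<open>norm y\<close>, since \<open>x0\<close> and \<open>x0 + y/2\<close> both lie in the
  ball. The lower bound \<kappa> for the derivative rests on minimality of \<open>x0\<close> among
  points of the ball, so \<open>x0\<close> may be a boundary point.\<close>

lemma segment_oscillation:
  fixes f \<phi> :: "'a::euclidean_space \<Rightarrow> real" and f' :: "'a \<Rightarrow> 'a \<Rightarrow>\<^sub>L real" and f'' :: "'a \<Rightarrow> 'a \<Rightarrow>\<^sub>L ('a \<Rightarrow>\<^sub>L real)"
    and \<phi>' :: "'a \<Rightarrow> 'a \<Rightarrow>\<^sub>L real"
  assumes U: "open U" "cball 0 r \<subseteq> U" "convex_on U f"
    and f: "\<And>x. x \<in> U \<Longrightarrow> (f has_derivative f' x) (at x)"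
      "\<And>x. x \<in> U \<Longrightarrow> (f' has_derivative f'' x) (at x)" "continuous_on U f''"
    and \<phi>: "\<And>x. (\<phi> has_derivative \<phi>' x) (at x)" "continuous_on UNIV \<phi>'"
    and M: "\<And>x. x \<in> cball 0 r \<Longrightarrow> \<bar>\<phi> x\<bar> \<le> M" "\<And>x. x \<in> cball 0 r \<Longrightarrow> norm (\<phi>' x) \<le> M'"
    and v1: "v1 \<ge> 0" and F_def: "F = (\<lambda>x. v' \<bullet> x + v1 * f x)"
    and x0: "x0 \<in> cball 0 r" "\<And>x. x \<in> cball 0 r \<Longrightarrow> F x0 \<le> F x"
    and y: "x0 + (1 / 2) *\<^sub>R y \<in> cball 0 r" and \<kappa>: "\<kappa> = F (x0 + (1 / 2) *\<^sub>R y) - F x0" "\<kappa> > 0"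
    and \<alpha>\<beta>: "1 / 2 \<le> \<alpha>" "\<alpha> \<le> \<beta>" "\<beta> \<le> 1" "\<And>s. s \<in> {\<alpha>..\<beta>} \<Longrightarrow> x0 + s *\<^sub>R y \<in> cball 0 r" and t: "t \<noteq> 0"
  shows "norm (integral {\<alpha>..\<beta>} (\<lambda>s. exp (- \<i> * of_real (t * F (x0 + s *\<^sub>R y))) * of_real (s ^ m * \<phi> (x0 + s *\<^sub>R y))))
    \<le> (3 * M + (real m * M + 4 * r * M')) / (\<bar>t\<bar> * \<kappa>)"
proof -
  define A where "A = {s. x0 + s *\<^sub>R y \<in> U}"
  have ball_A: "s \<in> A" if "x0 + s *\<^sub>R y \<in> cball 0 r" for s using that U(2) by (auto simp: A_def)
  have "open A"
    using open_vimage[OF U(1), of "\<lambda>s. x0 + s *\<^sub>R y"] unfolding A_def vimage_def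
    by (simp add: continuous_intros)
  have "convex_on U F"
    unfolding F_def
  proof (intro convex_on_add convex_on_cmul v1 U(3))
    show "convex_on U ((\<bullet>) v')"
      using convex_on_imp_convex[OF U(3)] by (simp add: convex_on_def inner_add_right)
  qed
  have line: "x0 + (u * a + w * b) *\<^sub>R y = u *\<^sub>R (x0 + a *\<^sub>R y) + w *\<^sub>R (x0 + b *\<^sub>R y)"
    if "u + w = 1" for u w a b
  proof -
    have "u *\<^sub>R (x0 + a *\<^sub>R y) + w *\<^sub>R (x0 + b *\<^sub>R y) = (u + w) *\<^sub>R x0 + (u * a + w * b) *\<^sub>R y"
      by (simp add: algebra_simps)
    then show ?thesis using that by simp
  qed
  define q where "q s = F (x0 + s *\<^sub>R y)" for s
  define q' where "q' s = v' \<bullet> y + v1 * f' (x0 + s *\<^sub>R y) y" for s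
  define q'' where "q'' s = v1 * f'' (x0 + s *\<^sub>R y) y y" for s
  have "convex_on A q"
    unfolding convex_on_def
  proof (intro conjI ballI allI impI)
    show "convex A"
      unfolding convex_def A_def using convexD[OF convex_on_imp_convex[OF U(3)]] line by auto
    fix a b u w :: real assume "a \<in> A" "b \<in> A" "0 \<le> u" "0 \<le> w" "u + w = 1"
    then show "q (u *\<^sub>R a + w *\<^sub>R b) \<le> u * q a + w * q b"
      using \<open>convex_on U F\<close> unfolding convex_on_def q_def A_def by (simp add: line)
  qed
  have q: "(q has_real_derivative q' s) (at s)" if "s \<in> A" for s
    unfolding has_real_derivative_iff_has_vector_derivative q_def F_def q'_def
    by (rule has_vector_derivative_along_line)
      (use that in \<open>auto simp: A_def intro!: derivative_eq_intros f\<close>)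
  have q': "(q' has_real_derivative q'' s) (at s)" if "s \<in> A" for s
  proof -
    have "((\<lambda>s. f' (x0 + s *\<^sub>R y)) has_vector_derivative f'' (x0 + s *\<^sub>R y) y) (at s)"
      using that by (intro has_vector_derivative_along_line f) (simp add: A_def)
    from bounded_linear.has_vector_derivative[OF blinfun.bounded_linear_left[of y] this]
    show ?thesis unfolding q'_def q''_def
      by (auto intro!: derivative_eq_intros simp: has_real_derivative_iff_has_vector_derivative[symmetric])
  qed
  define \<psi> where "\<psi> s = s ^ m * \<phi> (x0 + s *\<^sub>R y)" for s
  define \<psi>' where "\<psi>' s = real m * s ^ (m - 1) * \<phi> (x0 + s *\<^sub>R y) + s ^ m * \<phi>' (x0 + s *\<^sub>R y) y" for s
  have \<psi>: "(\<psi> has_real_derivative \<psi>' s) (at s)" for s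
  proof -
    have "((\<lambda>s. \<phi> (x0 + s *\<^sub>R y)) has_real_derivative \<phi>' (x0 + s *\<^sub>R y) y) (at s)"
      unfolding has_real_derivative_iff_has_vector_derivative
      by (rule has_vector_derivative_along_line[OF \<phi>(1)])
    then show ?thesis unfolding \<psi>_def \<psi>'_def by (auto intro!: derivative_eq_intros simp: algebra_simps)
  qed
  have r0: "r \<ge> 0" using x0(1) by (metis cball_eq_empty empty_iff not_le)
  have "norm y = 2 * norm ((x0 + (1 / 2) *\<^sub>R y) - x0)" by simp
  also have "\<dots> \<le> 2 * (r + r)" using norm_triangle_ineq4[of "x0 + (1 / 2) *\<^sub>R y" x0] x0(1) y by simp
  finally have ny: "norm y \<le> 4 * r" by simp
  have M0: "M \<ge> 0" "M' \<ge> 0" using M[OF x0(1)] by (auto intro: order.trans[OF norm_ge_zero])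
  let ?I = "{\<alpha>..\<beta>}"
  have IA: "s \<in> A" if "s \<in> ?I" for s using \<alpha>\<beta>(4)[OF that] by (rule ball_A)
  have s01: "0 \<le> s" "s \<le> 1" "1 / 2 \<le> s" if "s \<in> ?I" for s using that \<alpha>\<beta> by auto
  have line_cont: "continuous_on ?I (\<lambda>s. x0 + s *\<^sub>R y)" by (intro continuous_intros)
  have "norm (integral ?I (\<lambda>s. exp (- \<i> * of_real (t * q s)) * of_real (\<psi> s)))
    \<le> (3 * M + (real m * M + 4 * r * M') * (\<beta> - \<alpha>)) / (\<bar>t\<bar> * \<kappa>)"
  proof (rule van_der_corput_first_derivative[where F' = q' and F'' = q'' and \<psi>' = \<psi>'])
    show "continuous_on ?I q''" unfolding q''_def
      by (intro continuous_intros continuous_on_compose2[OF f(3) line_cont]) (use IA A_def in auto)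
    have "continuous_on UNIV \<phi>" using \<phi>(1) has_derivative_continuous by (simp add: continuous_on_eq_continuous_at) blast
    then have "continuous_on ?I (\<lambda>s. \<phi> (x0 + s *\<^sub>R y))" "continuous_on ?I (\<lambda>s. \<phi>' (x0 + s *\<^sub>R y))"
      using \<phi>(2) by (auto intro!: continuous_on_compose2[OF _ line_cont])
    then show "continuous_on ?I \<psi>'" unfolding \<psi>'_def by (intro continuous_intros)
    fix s assume s: "s \<in> ?I"
    show "q' s \<ge> \<kappa>"
      using convex_ray_derivatives(2)[OF \<open>open A\<close> \<open>convex_on A q\<close> q q', of s] \<alpha>\<beta>(4)[OF s] IA[OF s] s01[OF s]
        x0 \<kappa> ball_A[of 0] by (simp add: q_def)
    show "q'' s \<ge> 0"
      using convex_ray_derivatives(1)[OF \<open>open A\<close> \<open>convex_on A q\<close> q q' IA[OF s]] by simp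
    have phi: "\<bar>\<phi> (x0 + s *\<^sub>R y)\<bar> \<le> M" using M(1)[OF \<alpha>\<beta>(4)[OF s]] .
    have "s ^ m * \<bar>\<phi> (x0 + s *\<^sub>R y)\<bar> \<le> 1 * M"
      using s01[OF s] phi by (intro mult_mono power_le_one) auto
    then show "\<bar>\<psi> s\<bar> \<le> M" using s01[OF s] by (simp add: \<psi>_def abs_mult)
    have "real m * s ^ (m - 1) * \<bar>\<phi> (x0 + s *\<^sub>R y)\<bar> \<le> real m * 1 * M"
      using s01[OF s] phi by (intro mult_mono mult_left_mono power_le_one) auto
    moreover have "\<bar>\<phi>' (x0 + s *\<^sub>R y) y\<bar> \<le> M' * (4 * r)"
      using norm_blinfun[of "\<phi>' (x0 + s *\<^sub>R y)" y] mult_mono[OF M(2)[OF \<alpha>\<beta>(4)[OF s]] ny M0(2)] by simp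
    then have "s ^ m * \<bar>\<phi>' (x0 + s *\<^sub>R y) y\<bar> \<le> 1 * (M' * (4 * r))"
      using s01[OF s] by (intro mult_mono power_le_one) auto
    moreover have "\<bar>\<psi>' s\<bar> \<le> real m * s ^ (m - 1) * \<bar>\<phi> (x0 + s *\<^sub>R y)\<bar> + s ^ m * \<bar>\<phi>' (x0 + s *\<^sub>R y) y\<bar>"
      unfolding \<psi>'_def using s01[OF s] by (intro order.trans[OF abs_triangle_ineq]) (simp add: abs_mult)
    ultimately show "\<bar>\<psi>' s\<bar> \<le> real m * M + 4 * r * M'" by (simp add: mult_ac)
    show "(q has_real_derivative q' s) (at s within ?I)"
      by (rule has_field_derivative_at_within[OF q[OF IA[OF s]]])
    show "(q' has_real_derivative q'' s) (at s within ?I)"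
      by (rule has_field_derivative_at_within[OF q'[OF IA[OF s]]])
    show "(\<psi> has_real_derivative \<psi>' s) (at s within ?I)"
      by (rule has_field_derivative_at_within[OF \<psi>])
  qed (rule \<alpha>\<beta> t \<kappa>)+
  also have "\<dots> \<le> (3 * M + (real m * M + 4 * r * M') * 1) / (\<bar>t\<bar> * \<kappa>)"
    using \<alpha>\<beta> M0 r0 \<kappa>(2) by (intro divide_right_mono add_mono mult_left_mono) auto
  finally show ?thesis by (simp add: q_def \<psi>_def)
qed

section \<open>Averaging over dilations and the surface measure\<close>

lemma lborel_integral_affine:
  fixes h :: "'a::euclidean_space \<Rightarrow> 'b::{banach, second_countable_topology}"
  assumes [measurable]: "h \<in> borel_measurable borel" and c: "c \<noteq> 0"
  shows "(\<integral>x. h x \<partial>lborel) = \<bar>c\<bar> ^ DIM('a) *\<^sub>R (\<integral>y. h (a + c *\<^sub>R y) \<partial>lborel)"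
  by (subst lborel_affine[OF c, of a]) (simp add: integral_density integral_distr)

lemma lborel_integrable_affine:
  fixes h :: "'a::euclidean_space \<Rightarrow> 'b::{banach, second_countable_topology}"
  assumes h: "integrable lborel h" and c: "c \<noteq> 0"
  shows "integrable lborel (\<lambda>y. h (a + c *\<^sub>R y))"
proof -
  have [measurable]: "h \<in> borel_measurable borel" using h by (simp add: borel_measurable_integrable)
  have "integrable (density (distr lborel borel (\<lambda>x. a + c *\<^sub>R x)) (\<lambda>_. ennreal (\<bar>c\<bar> ^ DIM('a)))) h"
    using h lborel_affine[OF c, of a] by simp
  then have "integrable lborel (\<lambda>y. \<bar>c\<bar> ^ DIM('a) *\<^sub>R h (a + c *\<^sub>R y))"
    by (simp add: integrable_density integrable_distr_eq)
  then have "integrable lborel (\<lambda>y. (1 / \<bar>c\<bar> ^ DIM('a)) *\<^sub>R (\<bar>c\<bar> ^ DIM('a) *\<^sub>R h (a + c *\<^sub>R y)))"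
    by (rule integrable_scaleR_right)
  then show ?thesis using c by simp
qed

text \<open>For every fixed s the substitution \<open>x = x0 + s y\<close> expresses the integral of
  h with Jacobian \<open>s ^ n\<close>, n being the dimension. Averaging over an interval of length
  1/2 costs a factor 2, and Fubini brings the s integral inside. As G is taken at
  \<open>x0 + y/2\<close> whatever s is, substituting back costs \<open>2 ^ n\<close>. Since
  \<open>s \<ge> 1/2\<close>, only y with norm at most 4 r contribute, which makes the double
  integral finite.\<close>

lemma dilation_average_bound:
  fixes h :: "'a::euclidean_space \<Rightarrow> complex" and G :: "'a \<Rightarrow> real"
  assumes h: "integrable lborel h" "\<And>x. norm (h x) \<le> B" "\<And>x. x \<notin> ball 0 r \<Longrightarrow> h x = 0"
    and x0: "x0 \<in> cball 0 r" and G: "integrable lborel G"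
    and le: "\<And>y. norm (\<integral>s. indicator {1/2..1} s *\<^sub>R (s ^ DIM('a) *\<^sub>R h (x0 + s *\<^sub>R y)) \<partial>lborel)
      \<le> G (x0 + (1 / 2) *\<^sub>R y)"
  shows "norm (\<integral>x. h x \<partial>lborel) \<le> 2 ^ Suc DIM('a) * (\<integral>x. G x \<partial>lborel)"
proof -
  let ?n = "DIM('a)"
  have [measurable]: "h \<in> borel_measurable borel" "G \<in> borel_measurable borel"
    using h G by (simp_all add: borel_measurable_integrable)
  have B0: "B \<ge> 0" using h(2)[of 0] norm_ge_zero order.trans by blast
  define k where "k s y = indicator {1/2..1::real} s *\<^sub>R (s ^ ?n *\<^sub>R h (x0 + s *\<^sub>R y))" for s and y :: 'a
  have int: "integrable (lborel \<Otimes>\<^sub>M lborel) (\<lambda>(s, y). k s y)"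
  proof (rule integrableI_bounded_set[where A = "{1/2..1::real} \<times> cball 0 (4 * r)" and B = B])
    show "{1/2..1::real} \<times> cball 0 (4 * r) \<in> sets (lborel \<Otimes>\<^sub>M (lborel :: 'a measure))" by simp
    have "compact ({1/2..1::real} \<times> (cball 0 (4 * r) :: 'a set))" by (intro compact_Times) auto
    then show "emeasure (lborel \<Otimes>\<^sub>M lborel) ({1/2..1::real} \<times> (cball 0 (4 * r) :: 'a set)) < \<infinity>"
      unfolding lborel_prod using emeasure_compact_finite by simp
    have [measurable]: "(\<lambda>(s, y). x0 + s *\<^sub>R y) \<in> borel \<Otimes>\<^sub>M borel \<rightarrow>\<^sub>M (borel :: 'a measure)"
      by measurable
    show "(\<lambda>(s, y). k s y) \<in> borel_measurable (lborel \<Otimes>\<^sub>M lborel)"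
      unfolding k_def by measurable
    have bnd: "norm (k s y) \<le> B" for s y
    proof (cases "s \<in> {1/2..1}")
      case True
      then have "s ^ ?n * norm (h (x0 + s *\<^sub>R y)) \<le> 1 * B" using h(2) by (intro mult_mono power_le_one) auto
      then show ?thesis using True by (simp add: k_def)
    qed (simp add: k_def B0)
    then show "AE x in lborel \<Otimes>\<^sub>M lborel. x \<in> {1/2..1} \<times> cball 0 (4 * r) \<longrightarrow> norm (case x of (s, y) \<Rightarrow> k s y) \<le> B"
      by (intro AE_I2) auto
    have "k s y = 0" if "(s, y) \<notin> {1/2..1} \<times> cball 0 (4 * r)" for s y
    proof (rule ccontr)
      assume nz: "k s y \<noteq> 0"
      then have s: "1/2 \<le> s" "s \<le> 1" unfolding k_def by (auto split: split_indicator_asm)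
      have "x0 + s *\<^sub>R y \<in> ball 0 r" using nz h(3) unfolding k_def by fastforce
      then have "norm (s *\<^sub>R y) \<le> r + r"
        using norm_triangle_ineq4[of "x0 + s *\<^sub>R y" x0] x0 by simp
      moreover have "1/2 * norm y \<le> norm (s *\<^sub>R y)" using s mult_right_mono[OF s(1) norm_ge_zero[of y]] by simp
      ultimately show False using that s by simp
    qed
    then show "AE x in lborel \<Otimes>\<^sub>M lborel. x \<notin> {1/2..1} \<times> cball 0 (4 * r) \<longrightarrow> (case x of (s, y) \<Rightarrow> k s y) = 0"
      by (intro AE_I2 impI) (metis (no_types, lifting) case_prod_conv surj_pair)
  qed
  have "(\<integral>y. k s y \<partial>lborel) = indicator {1/2..1} s *\<^sub>R (\<integral>x. h x \<partial>lborel)" for s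
  proof (cases "s \<in> {1/2..1}")
    case True
    then show ?thesis using lborel_integral_affine[of h s x0] by (simp add: k_def)
  qed (simp add: k_def)
  then have "(\<integral>y. (\<integral>s. k s y \<partial>lborel) \<partial>lborel) = (\<integral>s. indicator {1/2..1::real} s *\<^sub>R (\<integral>x. h x \<partial>lborel) \<partial>lborel)"
    using lborel_pair.Fubini_integral[OF int] by simp
  also have "\<dots> = (1 / 2) *\<^sub>R (\<integral>x. h x \<partial>lborel)"
    by (subst integral_scaleR_left) (simp_all add: integrable_real_indicator[OF _ emeasure_compact_finite])
  finally have "norm (\<integral>x. h x \<partial>lborel) = 2 * norm (\<integral>y. (\<integral>s. k s y \<partial>lborel) \<partial>lborel)" by simp
  also have "norm (\<integral>y. (\<integral>s. k s y \<partial>lborel) \<partial>lborel) \<le> (\<integral>y. G (x0 + (1 / 2) *\<^sub>R y) \<partial>lborel)"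
  proof (rule Bochner_Integration.integral_norm_bound_integral)
    show "integrable lborel (\<lambda>y. \<integral>s. k s y \<partial>lborel)" by (rule lborel_pair.integrable_snd[OF int])
    show "integrable lborel (\<lambda>y. G (x0 + (1 / 2) *\<^sub>R y))" by (rule lborel_integrable_affine[OF G]) simp
  qed (use le in \<open>simp add: k_def\<close>)
  also have "(\<integral>y. G (x0 + (1 / 2) *\<^sub>R y) \<partial>lborel) = 2 ^ ?n * (\<integral>x. G x \<partial>lborel)"
    using lborel_integral_affine[of G "1 / 2" x0] by (simp add: power_one_over)
  finally show ?thesis by simp
qed

section \<open>Comparing surface measure on the graph with Lebesgue measure\<close>

text \<open>Resolves the definite description into a formula linear in the derivative, from which
  continuity of the gradient, and so of the area density, can be read off.\<close>

lemma grad_eq: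
  fixes f :: "'a::euclidean_space \<Rightarrow> real"
  assumes "(f has_derivative f') (at x)"
  shows "grad f x = (\<Sum>b\<in>Basis. f' b *\<^sub>R b)"
proof -
  define X where "X = (\<Sum>b\<in>Basis. f' b *\<^sub>R b)"
  have "f' h = inner h X" for h
  proof -
    have "f' h = f' (\<Sum>b\<in>Basis. (h \<bullet> b) *\<^sub>R b)" by (simp add: euclidean_representation)
    also have "\<dots> = (\<Sum>b\<in>Basis. (h \<bullet> b) * f' b)"
      using has_derivative_linear[OF assms] by (simp add: linear_sum linear_scale)
    finally show ?thesis by (simp add: X_def inner_sum_right mult.commute)
  qed
  then have D: "GDERIV f x :> X" unfolding gderiv_def using assms by presburger
  have "grad f x = X"
    unfolding grad_def
  proof (rule the_equality[where P = "\<lambda>D. GDERIV f x :> D"])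
    fix D assume "GDERIV f x :> D"
    then have "(\<lambda>h. inner h D) = (\<lambda>h. inner h X)"
      using D unfolding gderiv_def by (rule has_derivative_unique)
    then have "\<forall>h. inner h D = inner h X" by (rule fun_cong[THEN allI])
    then show "D = X" by (rule vector_eq_ldot[THEN iffD1])
  qed (rule D)
  then show ?thesis by (simp add: X_def)
qed

text \<open>The area density is at least 1 and bounded on D. The lower bound converts Lebesgue
  measure of level layers into surface measure; the uniform upper bound B makes the dyadic series
  converge.\<close>

lemma surface_measure_bounds:
  fixes f :: "real ^ 'n \<Rightarrow> real"
  assumes U: "open U" and f: "\<And>x. x \<in> U \<Longrightarrow> (f has_derivative blinfun_apply (f' x)) (at x)" "continuous_on U f'"
    and D: "compact D" "D \<subseteq> U"
  shows "\<exists>B. \<forall>K. compact K \<longrightarrow> K \<subseteq> D \<longrightarrow>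
    measure lborel K \<le> measure (surface_measure U f) ((\<lambda>x. (x, f x)) ` K) \<and>
    measure (surface_measure U f) ((\<lambda>x. (x, f x)) ` K) \<le> B"
proof -
  let ?h = "\<lambda>x. (x, f x)" and ?M = "restrict_space lborel U"
  define a where "a x = sqrt (1 + (norm (grad f x))\<^sup>2)" for x
  have contf: "continuous_on U f"
    using f(1) by (meson continuous_at_imp_continuous_on has_derivative_continuous)
  have "continuous_on U (\<lambda>x. \<Sum>b\<in>Basis. f' x b *\<^sub>R b)"
    by (intro continuous_intros f)
  then have "continuous_on U (grad f)"
    by (rule continuous_on_eq) (use grad_eq[OF f(1)] in simp)
  then have conta: "continuous_on U a" unfolding a_def by (intro continuous_intros)
  have sets: "sets ?M = sets (restrict_space borel U)" by (intro sets_restrict_space_cong) simp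
  have ma: "a \<in> borel_measurable ?M" and mh: "?h \<in> ?M \<rightarrow>\<^sub>M borel"
    using borel_measurable_continuous_on_restrict[OF conta]
      borel_measurable_continuous_on_restrict[of U ?h] contf
    by (auto simp: measurable_cong_sets[OF sets refl] continuous_intros)
  have "compact (a ` D)" using conta D continuous_on_subset by (blast intro: compact_continuous_image)
  then obtain A where A: "\<And>x. x \<in> D \<Longrightarrow> a x \<le> A" "A \<ge> 0"
    using bounded_imp_bdd_above[OF compact_imp_bounded] unfolding bdd_above_def
    by (metis imageI le_max_iff_disj max.cobounded2)
  have a1: "a x \<ge> 1" for x unfolding a_def by simp
  have emeas: "emeasure (surface_measure U f) (?h ` K) = (\<integral>\<^sup>+x. ennreal (a x) * indicator K x \<partial>?M)"
    and Kfin: "emeasure ?M K = emeasure lborel K" "emeasure lborel K < \<infinity>" and KM: "K \<in> sets ?M"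
    if K: "compact K" "K \<subseteq> D" for K
  proof -
    have "K \<subseteq> U" using K D by auto
    have "compact (?h ` K)"
      using K(1) continuous_on_subset[OF contf \<open>K \<subseteq> U\<close>] by (intro compact_continuous_image continuous_intros)
    then have hK: "?h ` K \<in> sets borel" by (rule borel_compact)
    show KM: "K \<in> sets ?M" using borel_compact[OF K(1)] \<open>K \<subseteq> U\<close> U by (subst sets_restrict_space_iff) auto
    have pre: "?h -` (?h ` K) \<inter> space ?M = K" using \<open>K \<subseteq> U\<close> by (auto simp: space_restrict_space)
    show "emeasure (surface_measure U f) (?h ` K) = (\<integral>\<^sup>+x. ennreal (a x) * indicator K x \<partial>?M)"
      unfolding surface_measure_def a_def[symmetric]
      using hK KM mh ma pre by (subst emeasure_distr) (auto simp: emeasure_density)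
    show "emeasure ?M K = emeasure lborel K" using \<open>K \<subseteq> U\<close> U by (intro emeasure_restrict_space) auto
    show "emeasure lborel K < \<infinity>" using K(1) by (rule emeasure_compact_finite)
  qed
  have "measure lborel K \<le> measure (surface_measure U f) (?h ` K) \<and>
      measure (surface_measure U f) (?h ` K) \<le> A * measure lborel D"
    if K: "compact K" "K \<subseteq> D" for K
  proof -
    have DD: "D \<subseteq> D" by simp
    have "(\<integral>\<^sup>+x. ennreal (a x) * indicator K x \<partial>?M) \<le> (\<integral>\<^sup>+x. ennreal A * indicator D x \<partial>?M)"
      using A K(2) by (intro nn_integral_mono) (auto split: split_indicator intro!: ennreal_leI)
    also have "\<dots> = ennreal A * emeasure lborel D"
      using KM[OF D(1) DD] Kfin(1)[OF D(1) DD] by (simp add: nn_integral_cmult_indicator)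
    also have "\<dots> = ennreal (A * measure lborel D)"
      using A(2) Kfin(2)[OF D(1) DD] by (simp add: emeasure_eq_ennreal_measure ennreal_mult')
    finally have up: "emeasure (surface_measure U f) (?h ` K) \<le> ennreal (A * measure lborel D)"
      unfolding emeas[OF K] .
    have "emeasure lborel K = (\<integral>\<^sup>+x. indicator K x \<partial>?M)" using KM[OF K] Kfin(1)[OF K] by simp
    also have "\<dots> \<le> (\<integral>\<^sup>+x. ennreal (a x) * indicator K x \<partial>?M)"
      using a1 by (intro nn_integral_mono) (auto split: split_indicator)
    finally have lo: "emeasure lborel K \<le> emeasure (surface_measure U f) (?h ` K)" unfolding emeas[OF K] .
    have AD: "A * measure lborel D \<ge> 0" using A(2) by simp
    \<comment> \<open>Finiteness matters because \<open>measure\<close> sends an infinite value to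
      0, which would break the lower bound.\<close>
    have fin: "emeasure (surface_measure U f) (?h ` K) < \<infinity>" using up by (simp add: le_less_trans)
    show ?thesis
      using up lo fin AD unfolding measure_def
      by (auto intro!: enn2real_mono enn2real_leI)
  qed
  then show ?thesis by blast
qed

section \<open>From segments to the full integral, and dyadic layers\<close>

text \<open>G stands for any integrable majorant, on the ball, of the smaller of 1 and
  \<open>1 / (\<bar>t\<bar> * (F - F x0))\<close>. The first alternative is the trivial bound for
  the s integral, the second is van der Corput on each of at most N + 1 intervals. One constant, at
  least M, covers both.\<close>

lemma oscillatory_integral_bound:
  fixes f \<phi> G :: "'a::euclidean_space \<Rightarrow> real" and f' :: "'a \<Rightarrow> 'a \<Rightarrow>\<^sub>L real" and f'' :: "'a \<Rightarrow> 'a \<Rightarrow>\<^sub>L ('a \<Rightarrow>\<^sub>L real)"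
    and \<phi>' :: "'a \<Rightarrow> 'a \<Rightarrow>\<^sub>L real" and h :: "'a \<Rightarrow> complex"
  assumes U: "open U" "cball 0 r \<subseteq> U" "convex_on U f"
    and f: "\<And>x. x \<in> U \<Longrightarrow> (f has_derivative f' x) (at x)"
      "\<And>x. x \<in> U \<Longrightarrow> (f' has_derivative f'' x) (at x)" "continuous_on U f''"
    and \<phi>: "\<And>x. (\<phi> has_derivative \<phi>' x) (at x)" "continuous_on UNIV \<phi>'" "\<And>x. x \<notin> ball 0 r \<Longrightarrow> \<phi> x = 0"
    and M: "\<And>x. x \<in> cball 0 r \<Longrightarrow> \<bar>\<phi> x\<bar> \<le> M" "\<And>x. x \<in> cball 0 r \<Longrightarrow> norm (\<phi>' x) \<le> M'"
    and v1: "v1 \<ge> 0" and F_def: "F = (\<lambda>x. v' \<bullet> x + v1 * f x)"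
    and x0: "x0 \<in> cball 0 r" "\<And>x. x \<in> cball 0 r \<Longrightarrow> F x0 \<le> F x"
    and N: "\<And>x y. few_pieces N {s. x + s *\<^sub>R y \<in> cball 0 r} {s. x + s *\<^sub>R y \<in> E}"
    and t: "t \<noteq> 0"
    and h_def: "h = (\<lambda>x. indicator E x *\<^sub>R (exp (- \<i> * of_real (t * F x)) * of_real (\<phi> x)))"
    and h: "integrable lborel h"
    and G: "integrable lborel G" "\<And>z. G z \<ge> 0"
      "\<And>z. z \<in> cball 0 r \<Longrightarrow> F z - F x0 \<le> inverse \<bar>t\<bar> \<Longrightarrow> 1 \<le> G z"
      "\<And>z. z \<in> cball 0 r \<Longrightarrow> inverse \<bar>t\<bar> < F z - F x0 \<Longrightarrow> inverse \<bar>t\<bar> / (F z - F x0) \<le> G z"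
  shows "norm (\<integral>x. h x \<partial>lborel) \<le>
    2 ^ Suc DIM('a) * ((real N + 1) * (3 * M + (real DIM('a) * M + 4 * r * M')) * (\<integral>x. G x \<partial>lborel))"
proof -
  let ?n = "DIM('a)"
  define C where "C = 3 * M + (real ?n * M + 4 * r * M')"
  have M0: "M \<ge> 0" "M' \<ge> 0" using M[OF x0(1)] by (auto intro: order.trans[OF norm_ge_zero])
  have r0: "r \<ge> 0" using x0(1) by (metis cball_eq_empty empty_iff not_le)
  have C0: "C \<ge> 0" "C \<ge> M" unfolding C_def using M0 r0 by auto
  have NC: "(real N + 1) * C \<ge> C" using C0 by (simp add: algebra_simps)
  have norm_h: "norm (h x) \<le> M" for x
  proof (cases "x \<in> ball 0 r")
    case True
    then show ?thesis using M(1)[of x] M0 by (auto simp: h_def norm_mult norm_exp_eq_Re split: split_indicator)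
  qed (use M0 \<phi>(3) in \<open>auto simp: h_def\<close>)
  have "norm (\<integral>s. indicator {1/2..1} s *\<^sub>R (s ^ ?n *\<^sub>R h (x0 + s *\<^sub>R y)) \<partial>lborel)
      \<le> (real N + 1) * C * G (x0 + (1 / 2) *\<^sub>R y)" for y
  proof -
    let ?z = "x0 + (1 / 2) *\<^sub>R y" and ?S = "{1/2..1::real}"
    define u where "u s = s ^ ?n *\<^sub>R h (x0 + s *\<^sub>R y)" for s
    have rhs0: "(real N + 1) * C * G ?z \<ge> 0" using C0 G(2) by simp
    have conv: "x0 + a *\<^sub>R y \<in> cball 0 r" if "x0 + b *\<^sub>R y \<in> cball 0 r" "0 \<le> a" "a \<le> b" for a b
    proof (cases "b = 0")
      case False
      then have b: "b > 0" using that by linarith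
      have "(1 - a / b) *\<^sub>R x0 + (a / b) *\<^sub>R (x0 + b *\<^sub>R y) \<in> cball 0 r"
        using that b x0(1) by (intro convexD[OF convex_cball]) auto
      moreover have "(1 - a / b) *\<^sub>R x0 + (a / b) *\<^sub>R (x0 + b *\<^sub>R y) = x0 + a *\<^sub>R y"
        using b by (simp add: algebra_simps)
      ultimately show ?thesis by simp
    qed (use that in auto)
    show ?thesis
    \<comment> \<open>If \<open>?z\<close> lies outside the ball, then so does the whole segment
      beyond it, by convexity with \<open>x0\<close> in the ball, and u vanishes. If u is not
      integrable, its integral is 0 by convention and the estimate is trivial.\<close>
    proof (cases "?z \<in> cball 0 r \<and> set_integrable lborel ?S u")
      case False
      have "(\<integral>s. indicator ?S s *\<^sub>R u s \<partial>lborel) = 0"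
      proof (cases "?z \<in> cball 0 r")
        case True
        then show ?thesis using False by (intro not_integrable_integral_eq) (simp add: set_integrable_def)
      next
        case z: False
        have "indicator ?S s *\<^sub>R u s = 0" for s
        proof (cases "s \<in> ?S")
          case True
          then have "x0 + s *\<^sub>R y \<notin> ball 0 r" using z conv[of s "1 / 2"] by auto
          then show ?thesis using \<phi>(3) by (simp add: u_def h_def)
        qed simp
        then have "(\<lambda>s. indicator ?S s *\<^sub>R u s) = (\<lambda>_. 0)" by (rule ext)
        then show ?thesis by (simp only: Bochner_Integration.integral_zero)
      qed
      then show ?thesis using rhs0 unfolding u_def by simp
    next
      case True
      then have z: "?z \<in> cball 0 r" and ui: "set_integrable lborel ?S u" by auto
      have LI: "(\<integral>s. indicator ?S s *\<^sub>R u s \<partial>lborel) = integral ?S u" and uint: "u integrable_on ?S"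
        using set_borel_integral_eq_integral[OF ui] by (simp_all add: set_lebesgue_integral_def)
      have norm_u: "norm (u s) \<le> M" if "s \<in> ?S" for s
      proof -
        have "s ^ ?n * norm (h (x0 + s *\<^sub>R y)) \<le> 1 * M" using that norm_h by (intro mult_mono power_le_one) auto
        then show ?thesis using that by (simp add: u_def)
      qed
      have "norm (integral ?S u) \<le> (real N + 1) * C * G ?z"
      proof (cases "F ?z - F x0 \<le> inverse \<bar>t\<bar>")
        case True
        have "norm (integral ?S u) \<le> integral ?S (\<lambda>_. M)"
          using uint norm_u by (intro Henstock_Kurzweil_Integration.integral_norm_bound_integral) auto
        also have "\<dots> \<le> M" using M0 by simp
        also have "\<dots> \<le> (real N + 1) * C * 1" using C0 NC by linarith
        also have "\<dots> \<le> (real N + 1) * C * G ?z" using G(3)[OF z True] C0 by (intro mult_left_mono) auto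
        finally show ?thesis .
      next
        case False
        define \<kappa> where "\<kappa> = F ?z - F x0"
        have it: "inverse \<bar>t\<bar> > 0" using t by simp
        have gt: "inverse \<bar>t\<bar> < \<kappa>" using False by (simp only: \<kappa>_def not_le)
        have \<kappa>: "\<kappa> > 0" using it gt by (rule less_trans)
        have \<kappa>G: "inverse \<bar>t\<bar> / \<kappa> \<le> G ?z" unfolding \<kappa>_def using G(4)[OF z gt[unfolded \<kappa>_def]] .
        \<comment> \<open>The segment stays in the ball for s in an interval
          \<open>[1/2, b]\<close>, where f is known to be convex and C2. Past b the amplitude is
          zero.\<close>
        let ?I = "{s. x0 + s *\<^sub>R y \<in> cball 0 r} \<inter> ?S"
        have "closed {s. x0 + s *\<^sub>R y \<in> cball 0 r}"
          using continuous_closed_vimage[of "cball 0 r" "\<lambda>s. x0 + s *\<^sub>R y"] by (simp add: vimage_def)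
        then have "compact ?I" by (intro closed_Int_compact) auto
        moreover have "is_interval ?I"
          unfolding is_interval_1 using conv z by fastforce
        ultimately obtain a b where ab: "?I = {a..b}"
          using connected_compact_interval_1 is_interval_connected by blast
        have half: "1 / 2 \<in> ?I" using z by simp
        then have "a \<in> ?I" "b \<in> ?I" unfolding ab by auto
        then have a: "a = 1 / 2" using half ab by force
        have b: "1 / 2 \<le> b" "b \<le> 1" using \<open>b \<in> ?I\<close> by auto
        have inI: "x0 + s *\<^sub>R y \<in> cball 0 r" if "s \<in> {1/2..b}" for s using that ab a by blast
        have "u s = 0" if "s \<in> {b..1} - {b}" for s
        proof -
          have "s \<notin> ?I" unfolding ab using that by auto
          then have "x0 + s *\<^sub>R y \<notin> ball 0 r" using that b by auto
          then show ?thesis using \<phi>(3) by (simp add: u_def h_def)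
        qed
        then have "integral {b..1} u = integral {b..1} (\<lambda>_. 0)"
          by (intro integral_spike[where S = "{b}"]) auto
        then have split: "integral ?S u = integral {1/2..b} u"
          using Henstock_Kurzweil_Integration.integral_combine[OF b uint] by simp
        obtain T where T: "finite T" "card T \<le> N"
          "\<And>J. convex J \<Longrightarrow> J \<subseteq> {s. x0 + s *\<^sub>R y \<in> cball 0 r} \<Longrightarrow> J \<inter> T = {} \<Longrightarrow>
            J \<subseteq> {s. x0 + s *\<^sub>R y \<in> E} \<or> J \<inter> {s. x0 + s *\<^sub>R y \<in> E} = {}"
          using N[of x0 y] unfolding few_pieces_def by blast
        have "norm (integral {1/2..b} u) \<le> (real (card T) + 1) * (C / (\<bar>t\<bar> * \<kappa>))"
        proof (rule integral_few_pieces_bound[where Q = "{s. x0 + s *\<^sub>R y \<in> E}"])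
          show "u integrable_on {1/2..b}" by (rule integrable_subinterval_real[OF uint]) (use b in auto)
          show "u s = 0" if "s \<notin> {s. x0 + s *\<^sub>R y \<in> E}" for s using that by (simp add: u_def h_def)
          show "J \<subseteq> {s. x0 + s *\<^sub>R y \<in> E} \<or> J \<inter> {s. x0 + s *\<^sub>R y \<in> E} = {}"
            if "convex J" "J \<subseteq> {1/2<..<b}" "J \<inter> T = {}" for J
            using that inI by (intro T(3)) force+
          fix \<alpha> \<beta> assume \<alpha>\<beta>: "1 / 2 \<le> \<alpha>" "\<alpha> \<le> \<beta>" "\<beta> \<le> b" "{\<alpha><..<\<beta>} \<subseteq> {s. x0 + s *\<^sub>R y \<in> E}"
          have "integral {\<alpha>..\<beta>} u = integral {\<alpha>..\<beta>}
              (\<lambda>s. exp (- \<i> * of_real (t * F (x0 + s *\<^sub>R y))) * of_real (s ^ ?n * \<phi> (x0 + s *\<^sub>R y)))"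
          proof (rule integral_spike[where S = "{\<alpha>, \<beta>}"])
            fix s assume "s \<in> {\<alpha>..\<beta>} - {\<alpha>, \<beta>}"
            then have "s \<in> {\<alpha><..<\<beta>}" by auto
            then have "x0 + s *\<^sub>R y \<in> E" using \<alpha>\<beta>(4) by blast
            then show "exp (- \<i> * of_real (t * F (x0 + s *\<^sub>R y))) * of_real (s ^ ?n * \<phi> (x0 + s *\<^sub>R y)) = u s"
              by (simp add: u_def h_def scaleR_conv_of_real mult_ac)
          qed simp
          also have "norm \<dots> \<le> (3 * M + (real ?n * M + 4 * r * M')) / (\<bar>t\<bar> * \<kappa>)"
          proof (rule segment_oscillation[OF U f \<phi>(1,2) M v1 F_def x0 z \<kappa>_def \<kappa> \<alpha>\<beta>(1,2) _ _ t])
            show "\<beta> \<le> 1" using \<alpha>\<beta>(3) b(2) by linarith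
            show "x0 + s *\<^sub>R y \<in> cball 0 r" if "s \<in> {\<alpha>..\<beta>}" for s
              using that \<alpha>\<beta> by (intro inI) auto
          qed
          finally show "norm (integral {\<alpha>..\<beta>} u) \<le> C / (\<bar>t\<bar> * \<kappa>)" unfolding C_def .
        qed (use T b in auto)
        also have "\<dots> \<le> (real N + 1) * (C / (\<bar>t\<bar> * \<kappa>))"
          using T(2) C0 \<kappa> by (intro mult_right_mono) auto
        also have "\<dots> = (real N + 1) * C * (inverse \<bar>t\<bar> / \<kappa>)" by (simp add: field_simps)
        also have "\<dots> \<le> (real N + 1) * C * G ?z" using \<kappa>G C0 by (intro mult_left_mono) auto
        finally show ?thesis unfolding split .
      qed
      then show ?thesis using LI unfolding u_def by simp
    qed
  qed
  note le = this
  have "norm (\<integral>x. h x \<partial>lborel) \<le> 2 ^ Suc ?n * (\<integral>x. (real N + 1) * C * G x \<partial>lborel)"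
  proof (rule dilation_average_bound[OF h norm_h _ x0(1) _ le])
    show "h x = 0" if "x \<notin> ball 0 r" for x using \<phi>(3)[OF that] by (simp add: h_def)
    show "integrable lborel (\<lambda>x. (real N + 1) * C * G x)" by (intro integrable_mult_right G(1))
  qed
  then show ?thesis by (simp add: C_def)
qed

text \<open>On the layer j one has \<open>F - s0 \<ge> 2 ^ (j - 1) * \<tau>\<close>, so
  \<open>\<tau> / (F - s0)\<close> is at most \<open>2 * (1/2) ^ j\<close>; this is the origin of
  the factor 2. As F is bounded on D, finitely many layers suffice and G is a finite sum. Adjacent
  layers may share points, which only increases G.\<close>

lemma dyadic_majorant:
  fixes F :: "'a::euclidean_space \<Rightarrow> real"
  assumes D: "compact D" "continuous_on D F" "\<And>x. x \<in> D \<Longrightarrow> s0 \<le> F x" and \<tau>: "\<tau> > 0"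
  defines "K \<equiv> \<lambda>lo hi. {x \<in> D. lo \<le> F x \<and> F x \<le> hi}"
  shows "\<exists>G J. integrable lborel G \<and> (\<forall>z. G z \<ge> 0) \<and>
    (\<forall>z\<in>D. F z - s0 \<le> \<tau> \<longrightarrow> 1 \<le> G z) \<and> (\<forall>z\<in>D. \<tau> < F z - s0 \<longrightarrow> \<tau> / (F z - s0) \<le> G z) \<and>
    (\<integral>z. G z \<partial>lborel) = measure lborel (K s0 (s0 + \<tau>)) +
      (\<Sum>j\<in>{1..J::nat}. 2 * (1 / 2) ^ j * measure lborel (K (s0 + 2 ^ (j - 1) * \<tau>) (s0 + 2 ^ j * \<tau>)))"
proof -
  have Kc: "compact (K lo hi)" for lo hi
  proof -
    have "K lo hi = D \<inter> (D \<inter> F -` {lo..hi})" by (auto simp: K_def)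
    moreover have "closed (D \<inter> F -` {lo..hi})"
      by (rule continuous_closed_preimage[OF D(2) compact_imp_closed[OF D(1)]]) simp
    ultimately show ?thesis using compact_Int_closed[OF D(1)] by metis
  qed
  have ind: "integrable lborel (indicator (K lo hi) :: 'a \<Rightarrow> real)" for lo hi
    by (intro integrable_real_indicator emeasure_compact_finite Kc) (simp add: borel_compact[OF Kc])
  have "bdd_above (F ` D)"
    using D by (intro bounded_imp_bdd_above compact_imp_bounded compact_continuous_image)
  then obtain B where B: "\<And>x. x \<in> D \<Longrightarrow> F x \<le> B" unfolding bdd_above_def by blast
  obtain J where J: "(B - s0) / \<tau> < 2 ^ J" using real_arch_pow[of 2] by auto
  define A where "A j = K (s0 + 2 ^ (j - 1) * \<tau>) (s0 + 2 ^ j * \<tau>)" for j :: nat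
  define G where "G z = indicator (K s0 (s0 + \<tau>)) z + (\<Sum>j\<in>{1..J}. 2 * (1 / 2) ^ j * indicator (A j) z :: real)" for z
  have term_int: "integrable lborel (\<lambda>z. 2 * (1 / 2) ^ j * indicator (A j) z :: real)" for j
    unfolding A_def by (intro integrable_mult_right ind)
  have sum_int: "integrable lborel (\<lambda>z. \<Sum>j\<in>{1..J}. 2 * (1 / 2) ^ j * indicator (A j) z :: real)"
    by (rule Bochner_Integration.integrable_sum) (rule term_int)
  have "integrable lborel G" unfolding G_def by (intro Bochner_Integration.integrable_add ind sum_int)
  moreover have "(\<integral>z. G z \<partial>lborel) = measure lborel (K s0 (s0 + \<tau>)) +
      (\<Sum>j\<in>{1..J}. 2 * (1 / 2) ^ j * measure lborel (A j))"
    unfolding G_def Bochner_Integration.integral_add[OF ind sum_int] Bochner_Integration.integral_sum[OF term_int]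
    by simp
  moreover have G0: "G z \<ge> 0" for z unfolding G_def by (intro add_nonneg_nonneg sum_nonneg) auto
  moreover have "1 \<le> G z" if "z \<in> D" "F z - s0 \<le> \<tau>" for z
  proof -
    have "z \<in> K s0 (s0 + \<tau>)" using that D(3) by (auto simp: K_def)
    then show ?thesis unfolding G_def by (auto intro!: sum_nonneg)
  qed
  moreover have "\<tau> / (F z - s0) \<le> G z" if z: "z \<in> D" "\<tau> < F z - s0" for z
  proof -
    define x where "x = (F z - s0) / \<tau>"
    have x1: "x > 1" using z(2) \<tau> by (simp add: x_def)
    have "x \<le> (B - s0) / \<tau>" unfolding x_def using B[OF z(1)] \<tau> by (intro divide_right_mono) auto
    then have xJ: "x \<le> 2 ^ J" using J by linarith
    \<comment> \<open>The least such j leaves \<open>2 ^ (j - 1) < x\<close>, the lower edge of the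
      layer; it is at least 1 because \<open>x > 1\<close>.\<close>
    define j where "j = (LEAST j::nat. x \<le> 2 ^ j)"
    have j: "x \<le> 2 ^ j" "j \<le> J" unfolding j_def using xJ by (auto intro: LeastI Least_le)
    have j1: "j \<ge> 1" using j(1) x1 by (cases j) auto
    have "\<not> x \<le> 2 ^ (j - 1)" unfolding j_def using j1 by (intro not_less_Least) (simp add: j_def)
    then have jl: "2 ^ (j - 1) < x" by simp
    have Fz: "F z = s0 + x * \<tau>" using \<tau> by (simp add: x_def)
    have "z \<in> A j" unfolding A_def K_def Fz using z(1) j(1) jl \<tau> by (simp add: Fz)
    then have "2 * (1 / 2) ^ j \<le> (\<Sum>j\<in>{1..J}. 2 * (1 / 2) ^ j * indicator (A j) z :: real)"
      using j(2) j1 member_le_sum[of j "{1..J}" "\<lambda>j. 2 * (1 / 2) ^ j * indicator (A j) z :: real"] by auto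
    moreover have "(0::real) \<le> indicator (K s0 (s0 + \<tau>)) z" by simp
    moreover have "\<tau> / (F z - s0) = 1 / x" by (simp add: x_def)
    moreover have "1 / x \<le> 1 / 2 ^ (j - 1)" using jl x1 by (intro divide_left_mono) auto
    moreover have "1 / 2 ^ (j - 1) = 2 * (1 / 2 :: real) ^ j" using j1 by (cases j) (auto simp: power_one_over)
    ultimately show ?thesis unfolding G_def by linarith
  qed
  ultimately show ?thesis unfolding A_def by blast
qed

theorem theorem1p2:
  fixes r0 :: real
    and U :: "(real ^ 'n) set"
    and f :: "real ^ 'n \<Rightarrow> real"
    and \<phi> :: "real ^ 'n \<Rightarrow> real"
    and q :: nat
    and W :: "nat \<Rightarrow> (real ^ 'n) set"
    and g :: "nat \<Rightarrow> real ^ 'n \<Rightarrow> real"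
  assumes r0: "r0 > 0"
    and U: "open U" "cball 0 r0 \<subseteq> U"
    and f_convex: "convex_on U f"
    and f_C2: "C2_on U f"
    and f_0: "f 0 = 0" "GDERIV f 0 :> 0"
    and phi_C1: "C1_on UNIV \<phi>"
    and phi_supp: "closure {x. \<phi> x \<noteq> 0} \<subseteq> ball 0 r0"
    and W: "\<And>i. i \<in> {1..q} \<Longrightarrow> open (W i) \<and> cball 0 r0 \<subseteq> W i"
    and g_analytic: "\<And>i. i \<in> {1..q} \<Longrightarrow> real_analytic_on (W i) (g i)"
    and g_nonzero: "\<And>i. i \<in> {1..q} \<Longrightarrow> \<exists>x\<in>W i. g i x \<noteq> 0"
  shows "\<exists>C :: real. \<forall>(v :: (real ^ 'n) \<times> real) (t :: real).
    norm v = 1 \<longrightarrow> snd v \<ge> 0 \<longrightarrow> t \<noteq> 0 \<longrightarrow>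
    (let S = graph_over U f; m = measure (surface_measure U f); s = min_dot r0 S v in
      norm (osc_integral r0 f \<phi> q g (t *\<^sub>R v))
        \<le> C * m {x \<in> S. fst x \<in> cball 0 r0 \<and> s \<le> x \<bullet> v \<and> x \<bullet> v \<le> s + inverse \<bar>t\<bar>}
          + C * (\<Sum>\<^sub>\<infinity>j\<in>{1::nat..}. (1 / 2) ^ j *
              m {x \<in> S. fst x \<in> cball 0 r0 \<and>
                   s + 2 ^ (j - 1) * inverse \<bar>t\<bar> \<le> x \<bullet> v \<and>
                   x \<bullet> v \<le> s + 2 ^ j * inverse \<bar>t\<bar>}))"
proof -
  from f_C2 obtain f' where f': "\<And>x. x \<in> U \<Longrightarrow> (f has_derivative blinfun_apply (f' x)) (at x)" and "C1_on U f'"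
    unfolding C2_on_def by blast
  then obtain f'' where f'': "\<And>x. x \<in> U \<Longrightarrow> (f' has_derivative blinfun_apply (f'' x)) (at x)" "continuous_on U f''"
    unfolding C1_on_def by blast
  from phi_C1 obtain \<phi>' where \<phi>': "\<And>x. (\<phi> has_derivative blinfun_apply (\<phi>' x)) (at x)" "continuous_on UNIV \<phi>'"
    unfolding C1_on_def by blast
  have \<phi>0: "\<phi> x = 0" if "x \<notin> ball 0 r0" for x
    using that phi_supp closure_subset[of "{x. \<phi> x \<noteq> 0}"] by blast
  have contf': "continuous_on U f'"
    using f''(1) by (meson continuous_at_imp_continuous_on has_derivative_continuous)
  have contf: "continuous_on (cball 0 r0) f"
    using f' U(2) by (meson continuous_at_imp_continuous_on has_derivative_continuous subsetD)
  have "continuous_on (cball 0 r0) \<phi>"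
    using \<phi>'(1) by (meson continuous_at_imp_continuous_on has_derivative_continuous)
  then have "bounded (\<phi> ` cball 0 r0)" by (intro compact_imp_bounded compact_continuous_image) auto
  then obtain M where M: "\<And>x. x \<in> cball 0 r0 \<Longrightarrow> \<bar>\<phi> x\<bar> \<le> M" unfolding bounded_iff by (auto simp del: mem_cball mem_cball_0)
  have "continuous_on (cball 0 r0) \<phi>'" using \<phi>'(2) continuous_on_subset by blast
  then have "bounded (\<phi>' ` cball 0 r0)" by (intro compact_imp_bounded compact_continuous_image) auto
  then obtain M' where M': "\<And>x. x \<in> cball 0 r0 \<Longrightarrow> norm (\<phi>' x) \<le> M'" unfolding bounded_iff by (auto simp del: mem_cball mem_cball_0)
  have "0 \<in> cball 0 r0" using r0 by simp
  then have M0: "M \<ge> 0" "M' \<ge> 0" using M[of 0] M'[of 0] by (auto intro: order.trans[OF norm_ge_zero] order.trans[OF abs_ge_zero])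
  have "\<forall>i\<in>{1..q}. \<exists>N. \<forall>x y. few_pieces N {s. x + s *\<^sub>R y \<in> cball 0 r0} {s. g i (x + s *\<^sub>R y) < 0}"
    using few_pieces_analytic[OF g_analytic] W by blast
  then obtain Ni where Ni: "\<And>i x y. i \<in> {1..q} \<Longrightarrow>
      few_pieces (Ni i) {s. x + s *\<^sub>R y \<in> cball 0 r0} {s. g i (x + s *\<^sub>R y) < 0}"
    by metis
  define E where "E = {x. \<forall>i\<in>{1..q}. g i x < 0}"
  define N where "N = (\<Sum>i\<in>{1..q}. Ni i)"
  have N: "few_pieces N {s. x + s *\<^sub>R y \<in> cball 0 r0} {s. x + s *\<^sub>R y \<in> E}" for x y
  proof -
    have "{s. x + s *\<^sub>R y \<in> E} = (\<Inter>i\<in>{1..q}. {s. g i (x + s *\<^sub>R y) < 0})" by (auto simp: E_def)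
    then show ?thesis unfolding N_def by (simp only:) (intro few_pieces_INT Ni finite_atLeastAtMost)
  qed
  obtain B where B: "\<And>K. compact K \<Longrightarrow> K \<subseteq> cball 0 r0 \<Longrightarrow>
      measure lborel K \<le> measure (surface_measure U f) ((\<lambda>x. (x, f x)) ` K) \<and>
      measure (surface_measure U f) ((\<lambda>x. (x, f x)) ` K) \<le> B"
    using surface_measure_bounds[OF U(1) f' contf' compact_cball U(2)] by blast
  let ?n = "DIM(real ^ 'n)"
  \<comment> \<open>The factors come from the dilation average, the number of intervals and van der
    Corput's estimate; none involves v or t. The witness \<open>2 * A\<close> below absorbs the
    factor 2 of the dyadic majorant.\<close>
  define A where "A = 2 ^ Suc ?n * ((real N + 1) * (3 * M + (real ?n * M + 4 * r0 * M')))"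
  have A0: "A \<ge> 0" unfolding A_def using M0 r0 by simp
  show ?thesis
  proof (intro exI[of _ "2 * A"] allI impI)
    fix v :: "(real ^ 'n) \<times> real" and t :: real
    assume v: "norm v = 1" "snd v \<ge> 0" and t: "t \<noteq> 0"
    define F where "F = (\<lambda>x. fst v \<bullet> x + snd v * f x)"
    have dot: "(x, f x) \<bullet> v = F x" for x by (simp add: F_def inner_prod_def inner_commute mult.commute)
    have contF: "continuous_on (cball 0 r0) F" unfolding F_def by (intro continuous_intros contf)
    obtain x0 where x0: "x0 \<in> cball 0 r0" "\<And>x. x \<in> cball 0 r0 \<Longrightarrow> F x0 \<le> F x"
      using continuous_attains_inf[OF compact_cball _ contF] r0 by (metis \<open>0 \<in> cball 0 r0\<close> empty_iff)
    have graph: "x \<in> graph_over U f \<and> fst x \<in> cball 0 r0 \<longleftrightarrow> fst x \<in> cball 0 r0 \<and> x = (fst x, f (fst x))" for x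
      using U(2) by (cases x) (auto simp: graph_over_def)
    have min: "min_dot r0 (graph_over U f) v = F x0"
      unfolding min_dot_def
    proof (rule Least_equality)
      show "F x0 \<in> {x \<bullet> v |x. x \<in> graph_over U f \<and> fst x \<in> cball 0 r0}"
        unfolding graph using x0(1) by (auto intro!: exI[of _ "(x0, f x0)"] simp: dot)
      fix y assume "y \<in> {x \<bullet> v |x. x \<in> graph_over U f \<and> fst x \<in> cball 0 r0}"
      then obtain x where x: "y = x \<bullet> v" "fst x \<in> cball 0 r0" "x = (fst x, f (fst x))" unfolding graph by blast
      then have "y = F (fst x)" using dot[of "fst x"] by simp
      then show "F x0 \<le> y" using x0(2)[OF x(2)] by simp
    qed
    define K where "K lo hi = {x \<in> cball 0 r0. lo \<le> F x \<and> F x \<le> hi}" for lo hi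
    define X where "X lo hi = {x \<in> graph_over U f. fst x \<in> cball 0 r0 \<and> lo \<le> x \<bullet> v \<and> x \<bullet> v \<le> hi}" for lo hi
    have X: "X lo hi = (\<lambda>x. (x, f x)) ` K lo hi" for lo hi
      unfolding X_def K_def using U(2) by (auto simp: graph_over_def dot)
    have K: "compact (K lo hi)" "K lo hi \<subseteq> cball 0 r0" for lo hi
    proof -
      have "K lo hi = cball 0 r0 \<inter> (cball 0 r0 \<inter> F -` {lo..hi})" by (auto simp: K_def)
      moreover have "closed (cball 0 r0 \<inter> F -` {lo..hi})"
        by (rule continuous_closed_preimage[OF contF]) auto
      ultimately show "compact (K lo hi)" using compact_Int_closed[OF compact_cball] by metis
    qed (auto simp: K_def)
    let ?m = "measure (surface_measure U f)" and ?\<tau> = "inverse \<bar>t\<bar>"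
    have mX: "measure lborel (K lo hi) \<le> ?m (X lo hi)" "?m (X lo hi) \<le> B" for lo hi
      unfolding X using B[OF K] by auto
    define Y where "Y j = X (F x0 + 2 ^ (j - 1) * ?\<tau>) (F x0 + 2 ^ j * ?\<tau>)" for j :: nat
    define Z where "Z = X (F x0) (F x0 + ?\<tau>)"
    define \<Sigma> where "\<Sigma> = (\<Sum>\<^sub>\<infinity>j\<in>{1::nat..}. (1 / 2) ^ j * ?m (Y j))"
    \<comment> \<open>Summability has to be established first: \<open>infsum\<close> of a family
      that is not summable is 0 and would not dominate the partial sums.\<close>
    have "summable (\<lambda>j. norm ((1 / 2 :: real) ^ j))" by (simp add: summable_geometric)
    then have "(\<lambda>j. (1 / 2 :: real) ^ j) summable_on {1..}"
      by (rule summable_on_subset[OF norm_summable_imp_summable_on]) simp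
    then have "(\<lambda>j. (1 / 2) ^ j * B) summable_on {1::nat..}" by (rule summable_on_cmult_left)
    then have summ: "(\<lambda>j. (1 / 2) ^ j * ?m (Y j)) summable_on {1::nat..}"
      by (rule summable_on_comparison_test) (auto simp: Y_def intro!: mult_left_mono mX(2))
    have partial: "(\<Sum>j\<in>{1..J}. (1 / 2) ^ j * ?m (Y j)) \<le> \<Sigma>" for J
      unfolding \<Sigma>_def by (rule finite_sum_le_infsum[OF summ]) auto
    have "0 \<le> \<Sigma>" using partial[of 0] by simp
    have rhs0: "0 \<le> ?m Z" by simp
    define h where "h = (\<lambda>x. indicator E x *\<^sub>R (exp (- \<i> * of_real (t * F x)) * complex_of_real (\<phi> x)))"
    have "indicator {x \<in> ball 0 r0. \<forall>i\<in>{1..q}. g i x < 0} x *\<^sub>R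
        (exp (- \<i> * complex_of_real ((\<Sum>k\<in>UNIV. fst (t *\<^sub>R v) $ k * x $ k) + snd (t *\<^sub>R v) * f x)) * complex_of_real (\<phi> x)) = h x" for x
    proof -
      have "(\<Sum>k\<in>UNIV. fst (t *\<^sub>R v) $ k * x $ k) + snd (t *\<^sub>R v) * f x = t * F x"
        by (simp add: F_def inner_vec_def sum_distrib_left distrib_left mult.assoc)
      then show ?thesis using \<phi>0[of x] by (auto simp: h_def E_def split: split_indicator)
    qed
    then have osc: "osc_integral r0 f \<phi> q g (t *\<^sub>R v) = (\<integral>x. h x \<partial>lborel)"
      unfolding osc_integral_def set_lebesgue_integral_def by simp
    have "norm (\<integral>x. h x \<partial>lborel) \<le> 2 * A * ?m Z + 2 * A * \<Sigma>"
    proof (cases "integrable lborel h")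
      case True
      obtain G J where G: "integrable lborel G" "\<And>z. G z \<ge> 0"
        "\<And>z. z \<in> cball 0 r0 \<Longrightarrow> F z - F x0 \<le> ?\<tau> \<Longrightarrow> 1 \<le> G z"
        "\<And>z. z \<in> cball 0 r0 \<Longrightarrow> ?\<tau> < F z - F x0 \<Longrightarrow> ?\<tau> / (F z - F x0) \<le> G z"
        and intG: "(\<integral>z. G z \<partial>lborel) = measure lborel (K (F x0) (F x0 + ?\<tau>)) +
          (\<Sum>j\<in>{1..J::nat}. 2 * (1 / 2) ^ j * measure lborel (K (F x0 + 2 ^ (j - 1) * ?\<tau>) (F x0 + 2 ^ j * ?\<tau>)))"
        using dyadic_majorant[OF compact_cball contF x0(2), of ?\<tau>] t unfolding K_def by auto
      have "(\<integral>x. G x \<partial>lborel) \<le> ?m Z + (\<Sum>j\<in>{1..J}. 2 * (1 / 2) ^ j * ?m (Y j))"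
        unfolding intG Z_def Y_def by (intro add_mono sum_mono mult_left_mono mX) auto
      also have "\<dots> = ?m Z + 2 * (\<Sum>j\<in>{1..J}. (1 / 2) ^ j * ?m (Y j))"
        by (simp add: sum_distrib_left mult.assoc)
      also have "\<dots> \<le> 2 * ?m Z + 2 * \<Sigma>" using partial[of J] rhs0 by linarith
      finally have G_le: "(\<integral>x. G x \<partial>lborel) \<le> 2 * ?m Z + 2 * \<Sigma>" .
      have "norm (\<integral>x. h x \<partial>lborel) \<le>
          2 ^ Suc ?n * ((real N + 1) * (3 * M + (real ?n * M + 4 * r0 * M')) * (\<integral>x. G x \<partial>lborel))"
        by (rule oscillatory_integral_bound[OF U f_convex f' f'' \<phi>' \<phi>0 M M' v(2) F_def x0 N t h_def True G])
      also have "\<dots> = A * (\<integral>x. G x \<partial>lborel)" by (simp only: A_def mult.assoc)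
      also have "\<dots> \<le> A * (2 * ?m Z + 2 * \<Sigma>)" using G_le A0 by (rule mult_left_mono)
      finally show ?thesis by (simp add: algebra_simps)
    next
      \<comment> \<open>never happens, but the junk value 0 of the integral makes it unnecessary to show that the \<open>g i\<close> are measurable\<close>
      case False
      then have "(\<integral>x. h x \<partial>lborel) = 0" by (rule not_integrable_integral_eq)
      then show ?thesis using A0 rhs0 \<open>0 \<le> \<Sigma>\<close> by simp
    qed
    then show "let S = graph_over U f; m = measure (surface_measure U f); s = min_dot r0 S v in
      norm (osc_integral r0 f \<phi> q g (t *\<^sub>R v))
        \<le> 2 * A * m {x \<in> S. fst x \<in> cball 0 r0 \<and> s \<le> x \<bullet> v \<and> x \<bullet> v \<le> s + inverse \<bar>t\<bar>}
          + 2 * A * (\<Sum>\<^sub>\<infinity>j\<in>{1::nat..}. (1 / 2) ^ j *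
              m {x \<in> S. fst x \<in> cball 0 r0 \<and>
                   s + 2 ^ (j - 1) * inverse \<bar>t\<bar> \<le> x \<bullet> v \<and>
                   x \<bullet> v \<le> s + 2 ^ j * inverse \<bar>t\<bar>})"
      unfolding Let_def min osc \<Sigma>_def Y_def Z_def X_def .
  qed
qed

end
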